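(* Let $d\ge1$ and $m>0$, and let $S_t$ denote the semigroup of the SIP($m$) on $\mathbb Z^d$. Let $\mu$ be a probability measure on $\mathbb N^{\mathbb Z^d}$ that is tempered, asymptotically homogeneous (AH) with constant $\rho>0$, and asymptotically independent (AI). Then, as $t\to\infty$, $$\mu S_t\to\nu^m_{\lambda(\rho)}\quad\text{weakly},\qquad\text{with}\quad \lambda(\rho)=\frac{\rho}{1+\rho}.$$
   Context: Let $\mathbb N=\{0,1,2,\dots\}$, and let $p(x,y)=\frac1{2d}$ if $\|x-y\|=1$ ($\ell_1$-norm on $\mathbb Z^d$) and $p(x,y)=0$ otherwise. The symmetric inclusion process SIP($m$) with parameter $m>0$ is the continuous-time Markov process $(\eta_t)_{t\ge0}$ on $\mathbb N^{\mathbb Z^d}$ whose generator acts on functions $f$ depending on finitely many occupation variables by $$\mathcal L f(\eta)=\sum_{x\in\mathbb Z^d}\sum_{y:\|y-x\|=1}p(x,y)\,\eta(x)\Big(\frac m2+\eta(y)\Big)\big(f(\eta^{x,y})-f(\eta)\big),\qquad \eta^{x,y}=\eta-\delta_x+\delta_y,$$ where $\delta_x$ is the configuration with a single particle at $x$. $\mathbb E_\eta$ is expectation for the process started from $\eta$, $S_tf(\eta)=\mathbb E_\eta f(\eta_t)$, and $\mu S_t$ is the law at time $t$ of the process with initial law $\mu$. A finite configuration is $\xi\in\mathbb N^{\mathbb Z^d}$ with $|\xi|:=\sum_x\xi(x)<\infty$. Define $$D(\xi,\eta)=\prod_{x\in\mathbb Z^d}d(\xi(x),\eta(x)),\qquad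 d(k,l)=\frac{l!}{(l-k)!}\frac{\Gamma(m/2)}{\Gamma(m/2+k)}\ \text{ if }k\le l,\quad d(k,l)=0\ \text{ if }k>l.$$ It is a known standing fact (self-duality) that $\mathbb E_\eta D(\xi,\eta_t)=\mathbb E_\xi D(\xi_t,\eta)$ for every finite configuration $\xi$, where $(\xi_t)$ is the SIP($m$) started from $\xi$. Tempered: $\mu$ is tempered if for all $n\in\mathbb N$, $c_n:=\sup_{|\xi|=n}\int D(\xi,\eta)\,\mu(d\eta)<\infty$, and $\sum_{n=1}^\infty c_n^{-1/n}=\infty$ (with $0^{-1/n}=+\infty$). Asymptotically homogeneous (AH): there exists $\rho>0$ such that $$\lim_{t\to\infty}\sup_{x\in\mathbb Z^d}\Big|\mathbb E_x\int D(\delta_{X(t)},\eta)\,\mu(d\eta)-\rho\Big|=0,$$ where $X(t)$ under $\mathbb E_x$ is the continuous-time simple symmetric random walk on $\mathbb Z^d$ started at $x$ (say jumping from $z$ to $y$ at rate $\frac m2p(z,y)$, as a single SIP particle does; the condition does not depend on the constant jump rate). Local function: a function $f:\mathbb N^{\mathbb Z^d}\to\mathbb R$ that is a finite linear combination of the functions $D(\xi,\cdot)$, $\xi$ finite. $\tau_y$ denotes the spatial shift by $y\in\mathbb Z^d$ acting on functions, so that $\tau_yD(\xi,\cdot)=D(\xi(\cdot-y),\cdot)$. Asymptotically independent (AI): for all $n$ and all local functions $f_1,\dots,f_n$, $$\lim\Big(\int\prod_{i=1}^n\tau_{y_i}f_i\,d\mu-\prod_{i=1}^n\int\tau_{y_i}f_i\,d\mu\Big)=0$$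 as $|y_i-y_j|\to\infty$ for all $i\ne j$, i.e. as $\min_{i\neq j}|y_i-y_j|\to\infty$. For $\lambda\in[0,1)$, $\nu^m_\lambda$ is the homogeneous product measure on $\mathbb N^{\mathbb Z^d}$ with marginals $$\nu^m_\lambda\{\eta(x)=k\}=(1-\lambda)^{m/2}\,\frac{\lambda^k}{k!}\,\frac{\Gamma(\frac m2+k)}{\Gamma(\frac m2)},\qquad k\in\mathbb N .$$ *)

theory Defs
  imports "HOL-Probability.Probability"
begin

section \<open>Lattice and configurations\<close>

text \<open>The lattice of dimension \<open>d = CARD('n) \<ge> 1\<close> is the type \<open>int ^ 'n\<close>.\<close>

definition l1norm :: "int ^ 'n \<Rightarrow> int" where
  "l1norm z = (\<Sum>i\<in>UNIV. \<bar>z $ i\<bar>)"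

definition nbrs :: "int ^ 'n \<Rightarrow> (int ^ 'n) set" where
  "nbrs x = {y. l1norm (y - x) = 1}"

definition srw_p :: "int ^ 'n \<Rightarrow> int ^ 'n \<Rightarrow> real" where
  "srw_p x y = (if l1norm (x - y) = 1 then 1 / (2 * real CARD('n)) else 0)"

text \<open>
  The library topology on \<open>'n config\<close> is the product of the discrete topologies; as the
  lattice is countable, \<open>borel\<close> is the product sigma-algebra.
\<close>

type_synonym 'n config = "(int, 'n) vec \<Rightarrow> nat"

definition delta :: "int ^ 'n \<Rightarrow> 'n config" where
  "delta x = (\<lambda>z. if z = x then 1 else 0)"

definition finite_config :: "'n::finite config \<Rightarrow> bool" where
  "finite_config \<xi> \<longleftrightarrow> finite {x. \<xi> x \<noteq> 0}"

definition num_particles :: "'n::finite config \<Rightarrow> nat" where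
  "num_particles \<xi> = (\<Sum>x | \<xi> x \<noteq> 0. \<xi> x)"

text \<open>
  The subtraction is truncated; this is harmless because the jump from \<open>x\<close> has rate 0 when
  \<open>\<eta> x = 0\<close>.
\<close>

definition jump :: "int ^ 'n \<Rightarrow> int ^ 'n \<Rightarrow> 'n config \<Rightarrow> 'n config" where
  "jump x y \<eta> = (\<lambda>z. \<eta> z - delta x z + delta y z)"

section \<open>The symmetric inclusion process\<close>

definition cylinder :: "('n::finite config \<Rightarrow> real) \<Rightarrow> bool" where
  "cylinder f \<longleftrightarrow> (\<exists>A. finite A \<and> (\<forall>\<eta> \<zeta>. (\<forall>x\<in>A. \<eta> x = \<zeta> x) \<longrightarrow> f \<eta> = f \<zeta>))"

text \<open>For a cylinder function only finitely many \<open>x\<close> contribute to the outer sum.\<close>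

definition sip_generator :: "real \<Rightarrow> ('n::finite config \<Rightarrow> real) \<Rightarrow> 'n config \<Rightarrow> real" where
  "sip_generator m f \<eta> =
     (\<Sum>\<^sub>\<infinity>x. \<Sum>y\<in>nbrs x.
        srw_p x y * real (\<eta> x) * (m / 2 + real (\<eta> y)) * (f (jump x y \<eta>) - f \<eta>))"

text \<open>
  \<open>P t \<eta>\<close> is the law at time \<open>t\<close> of the process started from \<open>\<eta>\<close>, so that
  \<open>S\<^sub>t f \<eta> = (\<integral>\<zeta>. f \<zeta> \<partial>P t \<eta>)\<close>. Since the rates are unbounded, the process cannot be started from
  configurations growing too fast at infinity; \<open>\<Omega>\<close> is the set of admissible configurations, and
  the values \<open>P t \<eta>\<close> for \<open>\<eta> \<notin> \<Omega>\<close> are irrelevant. The generator acts on functions of finitely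
  many occupation variables through the forward equation \<open>d/dt S\<^sub>t f = S\<^sub>t (L f)\<close>.
  Started from a finite configuration, the process is the non-explosive jump chain of finitely
  many particles: \<open>conservation\<close> excludes particles entering from or escaping to infinity, which
  functions of finitely many occupation variables cannot see. On configurations with a fixed
  number of particles the total jump rate is bounded, so together with \<open>generator\<close> this
  determines \<open>P t \<xi>\<close> for every finite \<open>\<xi>\<close>.
\<close>

locale sip_process =
  fixes m :: real
    and \<Omega> :: "'n::finite config set"
    and P :: "real \<Rightarrow> 'n config \<Rightarrow> 'n config measure"
  assumes m_pos: "m > 0"
    and admissible_measurable: "\<Omega> \<in> sets borel"
    and finite_admissible: "finite_config \<xi> \<Longrightarrow> \<xi> \<in> \<Omega>"
    and kernel: "t \<ge> 0 \<Longrightarrow> P t \<in> borel \<rightarrow>\<^sub>M prob_algebra borel"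
    and stays_admissible: "t \<ge> 0 \<Longrightarrow> \<eta> \<in> \<Omega> \<Longrightarrow> AE \<zeta> in P t \<eta>. \<zeta> \<in> \<Omega>"
    and initial: "\<eta> \<in> \<Omega> \<Longrightarrow> P 0 \<eta> = return borel \<eta>"
    and markov: "s \<ge> 0 \<Longrightarrow> t \<ge> 0 \<Longrightarrow> \<eta> \<in> \<Omega> \<Longrightarrow> P (s + t) \<eta> = P s \<eta> \<bind> P t"
    and conservation: "t \<ge> 0 \<Longrightarrow> finite_config \<xi> \<Longrightarrow>
          AE \<zeta> in P t \<xi>. finite_config \<zeta> \<and> num_particles \<zeta> = num_particles \<xi>"
    and generator_integrable: "t \<ge> 0 \<Longrightarrow> \<eta> \<in> \<Omega> \<Longrightarrow> cylinder f \<Longrightarrow> bounded (range f) \<Longrightarrow>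
          integrable (P t \<eta>) (sip_generator m f)"
    and generator: "t \<ge> 0 \<Longrightarrow> \<eta> \<in> \<Omega> \<Longrightarrow> cylinder f \<Longrightarrow> bounded (range f) \<Longrightarrow>
          ((\<lambda>s. \<integral>\<zeta>. f \<zeta> \<partial>P s \<eta>) has_real_derivative (\<integral>\<zeta>. sip_generator m f \<zeta> \<partial>P t \<eta>))
            (at t within {0..})"

section \<open>Duality functions\<close>

definition dual1 :: "real \<Rightarrow> nat \<Rightarrow> nat \<Rightarrow> real" where
  "dual1 m k l =
     (if k \<le> l then fact l / fact (l - k) * (Gamma (m / 2) / Gamma (m / 2 + real k)) else 0)"

text \<open>The factors with \<open>\<xi> x = 0\<close> are equal to 1.\<close>

definition dual :: "real \<Rightarrow> 'n::finite config \<Rightarrow> 'n config \<Rightarrow> real" where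
  "dual m \<xi> \<eta> = (\<Prod>x | \<xi> x \<noteq> 0. dual1 m (\<xi> x) (\<eta> x))"

definition self_dual ::
    "real \<Rightarrow> 'n::finite config set \<Rightarrow> (real \<Rightarrow> 'n config \<Rightarrow> 'n config measure) \<Rightarrow> bool" where
  "self_dual m \<Omega> P \<longleftrightarrow>
     (\<forall>t\<ge>0. \<forall>\<xi>. finite_config \<xi> \<longrightarrow> (\<forall>\<eta>\<in>\<Omega>.
        (\<integral>\<^sup>+\<zeta>. ennreal (dual m \<xi> \<zeta>) \<partial>P t \<eta>) = (\<integral>\<^sup>+\<zeta>. ennreal (dual m \<zeta> \<eta>) \<partial>P t \<xi>)))"

section \<open>Conditions on the initial measure\<close>

definition tempered_const :: "real \<Rightarrow> 'n::finite config measure \<Rightarrow> nat \<Rightarrow> ennreal" where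
  "tempered_const m \<mu> n =
     (SUP \<xi>\<in>{\<xi>. finite_config \<xi> \<and> num_particles \<xi> = n}. \<integral>\<^sup>+\<eta>. ennreal (dual m \<xi> \<eta>) \<partial>\<mu>)"

text \<open>In \<open>ennreal\<close>, \<open>inverse 0 = \<infinity>\<close>.\<close>

definition tempered :: "real \<Rightarrow> 'n::finite config measure \<Rightarrow> bool" where
  "tempered m \<mu> \<longleftrightarrow>
     (\<forall>n. tempered_const m \<mu> n < \<infinity>) \<and>
     (\<Sum>n. inverse (ennreal (root (Suc n) (enn2real (tempered_const m \<mu> (Suc n)))))) = \<infinity>"

definition srw_step :: "int ^ 'n \<Rightarrow> (int ^ 'n) pmf" where
  "srw_step x = pmf_of_set (nbrs x)"

text \<open>
  Law at time \<open>t > 0\<close> of the continuous-time simple random walk from \<open>x\<close> with total jump rate \<open>r\<close>: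
  the number of jumps up to time \<open>t\<close> is Poisson distributed with mean \<open>r t\<close>.
\<close>

definition ctrw :: "real \<Rightarrow> real \<Rightarrow> int ^ 'n \<Rightarrow> (int ^ 'n) pmf" where
  "ctrw r t x =
     bind_pmf (poisson_pmf (r * t)) (\<lambda>k. ((\<lambda>q. bind_pmf q srw_step) ^^ k) (return_pmf x))"

definition asymp_homogeneous :: "real \<Rightarrow> 'n::finite config measure \<Rightarrow> real \<Rightarrow> bool" where
  "asymp_homogeneous m \<mu> \<rho> \<longleftrightarrow>
     ((\<lambda>t. SUP x. ennreal
        \<bar>measure_pmf.expectation (ctrw (m / 2) t x) (\<lambda>z. \<integral>\<eta>. dual m (delta z) \<eta> \<partial>\<mu>) - \<rho>\<bar>)
      \<longlongrightarrow> 0) at_top"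

definition local_function :: "real \<Rightarrow> ('n::finite config \<Rightarrow> real) \<Rightarrow> bool" where
  "local_function m f \<longleftrightarrow>
     (\<exists>A c. finite A \<and> (\<forall>\<xi>\<in>A. finite_config \<xi>) \<and> f = (\<lambda>\<eta>. \<Sum>\<xi>\<in>A. c \<xi> * dual m \<xi> \<eta>))"

definition shift :: "int ^ 'n \<Rightarrow> ('n config \<Rightarrow> real) \<Rightarrow> 'n config \<Rightarrow> real" where
  "shift y f \<eta> = f (\<lambda>x. \<eta> (x + y))"

definition asymp_independent :: "real \<Rightarrow> 'n::finite config measure \<Rightarrow> bool" where
  "asymp_independent m \<mu> \<longleftrightarrow>
     (\<forall>n. \<forall>f :: nat \<Rightarrow> 'n config \<Rightarrow> real. (\<forall>i<n. local_function m (f i)) \<longrightarrow>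
       (\<forall>\<epsilon>>0. \<exists>R. \<forall>y :: nat \<Rightarrow> int ^ 'n.
          (\<forall>i<n. \<forall>j<n. i \<noteq> j \<longrightarrow> l1norm (y i - y j) \<ge> R) \<longrightarrow>
          \<bar>(\<integral>\<eta>. (\<Prod>i<n. shift (y i) (f i) \<eta>) \<partial>\<mu>) - (\<Prod>i<n. \<integral>\<eta>. shift (y i) (f i) \<eta> \<partial>\<mu>)\<bar> < \<epsilon>))"

section \<open>Limit measure and weak convergence\<close>

definition sip_marginal :: "real \<Rightarrow> real \<Rightarrow> nat measure" where
  "sip_marginal m l = point_measure UNIV
     (\<lambda>k. ennreal ((1 - l) powr (m / 2) * (l ^ k / fact k) * (Gamma (m / 2 + real k) / Gamma (m / 2))))"

definition sip_product :: "real \<Rightarrow> real \<Rightarrow> 'n::finite config measure" where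
  "sip_product m l = Pi\<^sub>M UNIV (\<lambda>_. sip_marginal m l)"

definition weak_convergence ::
    "('b \<Rightarrow> 'a::topological_space measure) \<Rightarrow> 'a measure \<Rightarrow> 'b filter \<Rightarrow> bool" where
  "weak_convergence M N F \<longleftrightarrow>
     (\<forall>f :: 'a \<Rightarrow> real. continuous_on UNIV f \<longrightarrow> bounded (range f) \<longrightarrow>
        ((\<lambda>t. \<integral>x. f x \<partial>M t) \<longlongrightarrow> (\<integral>x. f x \<partial>N)) F)"

section \<open>Well-definedness of the walk and of the limit measure\<close>

lemma l1norm_eq_1_iff:
  fixes z :: "int ^ 'n"
  shows "l1norm z = 1 \<longleftrightarrow> (\<exists>i. z = axis i 1 \<or> z = axis i (- 1))"
proof
  assume l: "l1norm z = 1"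
  then obtain i where i: "z $ i \<noteq> 0"
    unfolding l1norm_def by (metis abs_zero sum.neutral zero_neq_one)
  have split: "l1norm z = \<bar>z $ i\<bar> + (\<Sum>j\<in>UNIV - {i}. \<bar>z $ j\<bar>)"
    unfolding l1norm_def by (simp add: sum.remove)
  have "(\<Sum>j\<in>UNIV - {i}. \<bar>z $ j\<bar>) \<ge> 0" by (simp add: sum_nonneg)
  with split l i have zi: "\<bar>z $ i\<bar> = 1" and "(\<Sum>j\<in>UNIV - {i}. \<bar>z $ j\<bar>) = 0" by linarith+
  hence "\<forall>j\<in>UNIV - {i}. \<bar>z $ j\<bar> = 0" by (subst (asm) sum_nonneg_eq_0_iff) auto
  hence "z = axis i (z $ i)" by (auto simp: vec_eq_iff axis_def)
  moreover have "z $ i = 1 \<or> z $ i = - 1" using zi by linarith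
  ultimately show "\<exists>i. z = axis i 1 \<or> z = axis i (- 1)" by metis
next
  have "l1norm (axis i c) = \<bar>c\<bar>" for i :: 'n and c :: int
    unfolding l1norm_def axis_def by (simp add: if_distrib[of abs] cong: if_cong)
  thus "\<exists>i. z = axis i 1 \<or> z = axis i (- 1) \<Longrightarrow> l1norm z = 1" by auto
qed

lemma
  fixes x :: "int ^ 'n"
  shows finite_nbrs: "finite (nbrs x)" and card_nbrs: "card (nbrs x) = 2 * CARD('n)"
proof -
  let ?A = "range (\<lambda>i::'n. x + axis i 1)" and ?B = "range (\<lambda>i::'n. x + axis i (- 1))"
  have "y \<in> nbrs x \<longleftrightarrow> y \<in> ?A \<union> ?B" for y
  proof -
    have "y - x = a \<longleftrightarrow> y = x + a" for a by (auto simp: algebra_simps)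
    thus ?thesis unfolding nbrs_def mem_Collect_eq l1norm_eq_1_iff by blast
  qed
  hence eq: "nbrs x = ?A \<union> ?B" by blast
  have "card ?A = CARD('n)" "card ?B = CARD('n)"
    by (auto intro!: card_image injI simp: axis_eq_axis)
  moreover have "?A \<inter> ?B = {}" by (auto simp: axis_eq_axis)
  ultimately show "card (nbrs x) = 2 * CARD('n)" unfolding eq by (simp add: card_Un_disjoint)
  show "finite (nbrs x)" unfolding eq by simp
qed

lemma pmf_srw_step: "pmf (srw_step x) y = srw_p x y"
proof -
  have "l1norm (y - x) = l1norm (x - y)" by (simp add: l1norm_def abs_minus_commute)
  hence "y \<in> nbrs x \<longleftrightarrow> l1norm (x - y) = 1" by (simp add: nbrs_def)
  moreover have "nbrs x \<noteq> {}"
    using card_nbrs[of x] by auto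
  ultimately show ?thesis
    unfolding srw_step_def by (simp add: finite_nbrs card_nbrs srw_p_def indicator_def)
qed

lemma prob_space_sip_marginal:
  assumes "m > 0" "0 \<le> l" "l < 1"
  shows "prob_space (sip_marginal m l)"
proof -
  let ?w = "\<lambda>k. (1 - l) powr (m / 2) * (l ^ k / fact k) * (Gamma (m / 2 + real k) / Gamma (m / 2))"
  have "(\<lambda>k. ((- (m / 2)) gchoose k) * (- l) ^ k) sums (1 + - l) powr (- (m / 2))"
    using assms by (intro gen_binomial_real) auto
  moreover have "((- (m / 2)) gchoose k) * (- l) ^ k =
      l ^ k / fact k * (Gamma (m / 2 + real k) / Gamma (m / 2))" for k
  proof -
    have "pochhammer (m / 2) k = Gamma (m / 2 + real k) / Gamma (m / 2)"
      using assms by (intro pochhammer_Gamma) (auto elim!: nonpos_Ints_cases)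
    moreover have "(- 1) ^ k * (- l) ^ k = l ^ k" by (simp flip: power_mult_distrib)
    ultimately show ?thesis by (simp add: gbinomial_pochhammer field_simps)
  qed
  ultimately have "(\<lambda>k. l ^ k / fact k * (Gamma (m / 2 + real k) / Gamma (m / 2)))
      sums (1 - l) powr (- (m / 2))" by simp
  from sums_mult[OF this, of "(1 - l) powr (m / 2)"] have sums: "?w sums 1"
    using assms by (simp add: mult.assoc flip: powr_add)
  have nn: "?w k \<ge> 0" for k
    using assms by (auto intro!: mult_nonneg_nonneg divide_nonneg_nonneg)
  have "(\<Sum>k. ennreal (?w k)) = 1"
    using suminf_ennreal_eq[OF nn sums] by (simp only: ennreal_1)
  moreover have "emeasure (sip_marginal m l) UNIV = (\<Sum>k. ennreal (?w k))"
    unfolding sip_marginal_def point_measure_def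
    by (simp add: emeasure_density nn_integral_count_space_nat)
  ultimately show ?thesis
    by (intro prob_spaceI) (simp add: sip_marginal_def space_point_measure)
qed

end

theory Submission
  imports Defs
begin

text \<open>
  By self-duality the duality moments of \<open>\<mu> S\<^sub>t\<close> are expectations of \<open>F \<zeta> = \<integral> D(\<zeta>, \<eta>) \<mu>(d\<eta>)\<close> along
  finitely many SIP particles, and no coupling of these with independent walks is needed. The
  expected number of pairs of particles at distance less than \<open>R\<close> obeys a closed equation, that of
  the difference of two particles, which is a reversible nearest-neighbour walk of infinite
  reversible mass; its energy dissipation forces that number to \<open>0\<close> as \<open>t \<rightarrow> \<infinity>\<close>. Once the particles
  are far apart they move like independent walks during any fixed further time \<open>T\<close>, where (AI)
  factorizes \<open>F\<close> and the uniformity in (AH) brings each factor close to \<open>\<rho>\<close>. Hence every duality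
  moment converges to \<open>\<rho>\<close> to the power \<open>|\<xi>|\<close>, the corresponding moment of \<open>\<nu>\<^sub>\<lambda>\<close>. As \<open>\<nu>\<^sub>\<lambda>\<close> has exponential
  moments, convergence of moments passes to moments tilted by \<open>exp (- \<theta> N)\<close> for all \<open>\<theta>\<close> and, as
  \<open>\<theta> \<rightarrow> \<infinity>\<close>, to point probabilities.
\<close>

section \<open>Labelled particles and the jump chain\<close>

text \<open>The generator is tied to the law of the process only through the forward equation for
  bounded functions of finitely many occupation numbers, whereas \<open>F\<close> depends on
  particles anywhere in an infinite lattice. On \<open>n\<close>-particle configurations the total
  jump rate is bounded, so the equation is solved by a Poisson mixture of powers of the bounded
  operator \<open>step_op\<close> (uniformization). Decay of close pairs and comparison with
  independent walks thereby become statements about iterates of one operator. Transience cannot be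
  what drives the particles apart: in dimensions 1 and 2 the difference walk is recurrent. Infinite
  reversible mass works in every dimension. The choices in the long-time limit are ordered: the
  accuracy fixes \<open>T\<close> through (AH), \<open>T\<close> and (AI) fix the distance
  \<open>R\<close>, and only then does \<open>t\<close> tend to infinity. The parameter of the limit
  comes from its one-site duality moments \<open>(l / (1 - l)) ^ k\<close>, which equal
  \<open>\<rho> ^ k\<close> for all \<open>k\<close> exactly when
  \<open>l = \<rho> / (1 + \<rho>)\<close>.\<close>

definition conf :: "nat \<Rightarrow> (nat \<Rightarrow> int ^ 'n) \<Rightarrow> 'n config" where
  "conf n x = (\<lambda>z. card {i. i < n \<and> x i = z})"

lemma conf_eq_sum: "conf n x z = (\<Sum>i<n. of_bool (x i = z))"
proof -
  have "{i. i < n \<and> x i = z} = {i\<in>{..<n}. x i = z}" by auto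
  thus ?thesis unfolding conf_def
    by (simp add: sum.If_cases Int_def of_bool_def flip: sum.inter_filter)
qed

lemma real_conf: "real (conf n x z) = (\<Sum>i<n. of_bool (x i = z))"
  unfolding conf_eq_sum by simp

lemma conf_support: "{z. conf n x z \<noteq> 0} = x ` {..<n}"
  unfolding conf_def by (auto simp: card_eq_0_iff)

lemma finite_config_conf [simp]: "finite_config (conf n x)"
  unfolding finite_config_def conf_support by simp

text \<open>Labels are grouped by the site they occupy. This turns the site sums in the generator
  and in \<open>near_pairs\<close> into sums over labelled particles.\<close>

lemma sum_conf:
  fixes G :: "int ^ 'n::finite \<Rightarrow> real"
  shows "(\<Sum>z | conf n x z \<noteq> 0. real (conf n x z) * G z) = (\<Sum>i<n. G (x i))"
proof -
  have "(\<Sum>i<n. G (x i)) = (\<Sum>z\<in>x ` {..<n}. \<Sum>i\<in>{i\<in>{..<n}. x i = z}. G (x i))"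
    by (rule sum.image_gen) simp
  also have "\<dots> = (\<Sum>z\<in>x ` {..<n}. real (conf n x z) * G z)"
    unfolding conf_def by (intro sum.cong refl) simp
  finally show ?thesis unfolding conf_support by simp
qed

lemma num_particles_conf [simp]: "num_particles (conf n x) = n"
proof -
  have "real (num_particles (conf n x)) = real n"
    unfolding num_particles_def using sum_conf[of n x "\<lambda>_. 1"] by simp
  thus ?thesis by linarith
qed

text \<open>A finite configuration is a multiset of sites, and listing its elements labels the
  particles. Hence statements about all \<open>n\<close>-particle configurations may be proved for
  \<open>conf n x\<close>.\<close>

lemma conf_surj:
  fixes \<xi> :: "'n::finite config"
  assumes "finite_config \<xi>"
  obtains x where "\<xi> = conf (num_particles \<xi>) x"
proof -
  define M where "M = Abs_multiset \<xi>"
  have "finite {z. 0 < \<xi> z}" using assms by (simp add: finite_config_def)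
  hence cM: "count M = \<xi>"
    unfolding M_def by (intro Abs_multiset_inverse) simp
  obtain xs where xs: "mset xs = M" using ex_mset by blast
  have "\<xi> = conf (length xs) (\<lambda>i. xs ! i)"
  proof
    fix z
    have "\<xi> z = count_list xs z" using cM xs by (metis count_mset)
    also have "\<dots> = card {i. i < length xs \<and> xs ! i = z}"
      by (simp add: count_list_eq_length_filter length_filter_conv_card eq_commute)
    finally show "\<xi> z = conf (length xs) (\<lambda>i. xs ! i) z" by (simp add: conf_def)
  qed
  with that show ?thesis by (metis num_particles_conf)
qed

text \<open>Every finite configuration is encoded by a list of sites. Countability is what allows
  the law of finitely many particles to be handled as a \<open>pmf\<close>.\<close>

lemma countable_finite_configs: "countable {\<xi> :: 'n::finite config. finite_config \<xi>}"
proof -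
  have "{\<xi> :: 'n config. finite_config \<xi>} \<subseteq> range (\<lambda>xs. conf (length xs) (\<lambda>i. xs ! i))"
  proof
    fix \<xi> :: "'n config"
    assume "\<xi> \<in> {\<xi>. finite_config \<xi>}"
    then obtain x where x: "\<xi> = conf (num_particles \<xi>) x" using conf_surj by blast
    let ?xs = "map x [0..<num_particles \<xi>]"
    have "\<xi> = conf (length ?xs) (\<lambda>i. ?xs ! i)"
      by (subst x, rule ext) (auto simp: conf_def intro!: arg_cong[where f = card])
    thus "\<xi> \<in> range (\<lambda>xs. conf (length xs) (\<lambda>i. xs ! i))" by blast
  qed
  thus ?thesis by (rule countable_subset) simp
qed

section \<open>Geometry of lattice neighbourhoods\<close>

lemma not_in_nbrs_self [simp]: "x \<notin> nbrs x"
  by (simp add: nbrs_def l1norm_def)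

lemma l1norm_minus_commute: "l1norm (a - b) = l1norm (b - a)"
  by (simp add: l1norm_def abs_minus_commute)

lemma l1norm_triangle: "l1norm (a + b) \<le> l1norm a + l1norm b"
  unfolding l1norm_def by (simp flip: sum.distrib add: sum_mono abs_triangle_ineq)

lemma l1norm_nonneg [simp]: "0 \<le> l1norm a"
  by (simp add: l1norm_def sum_nonneg)

lemma nbrs_eq_image: "nbrs x = (\<lambda>e. x + e) ` nbrs 0"
proof
  show "nbrs x \<subseteq> (\<lambda>e. x + e) ` nbrs 0"
  proof
    fix y assume "y \<in> nbrs x"
    hence "y - x \<in> nbrs 0" "y = x + (y - x)" by (auto simp: nbrs_def)
    thus "y \<in> (\<lambda>e. x + e) ` nbrs 0" by blast
  qed
qed (auto simp: nbrs_def)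

lemma sum_nbrs: "(\<Sum>y\<in>nbrs x. f y) = (\<Sum>e\<in>nbrs 0. f (x + e))"
  unfolding nbrs_eq_image[of x] by (subst sum.reindex) (auto simp: inj_on_def)

lemma nbrs_sym: "y \<in> nbrs x \<longleftrightarrow> x \<in> nbrs y"
  by (simp add: nbrs_def l1norm_minus_commute)

lemma uminus_nbrs0: "uminus ` nbrs 0 = nbrs 0"
proof -
  have "l1norm (- e) = l1norm e" for e :: "int ^ 'a" by (simp add: l1norm_def)
  hence *: "- e \<in> nbrs 0 \<longleftrightarrow> e \<in> nbrs 0" for e :: "int ^ 'a" by (simp add: nbrs_def)
  show ?thesis by (auto simp: *) (metis * image_eqI minus_minus)
qed

lemma sum_nbrs0_uminus: "(\<Sum>e\<in>nbrs 0. f (- e)) = (\<Sum>e\<in>nbrs 0. f e)"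
  by (subst (2) uminus_nbrs0[symmetric], subst sum.reindex) (auto simp: inj_on_def)

section \<open>Jump operators of labelled particles\<close>

lemma jump_conf:
  assumes "i < n" "y \<noteq> x i"
  shows "jump (x i) y (conf n x) = conf n (x(i := y))"
proof
  fix z
  \<comment> \<open>Isolating particle \<open>i\<close> shows that its site is occupied, so the
    truncated subtraction in \<open>jump\<close> loses nothing.\<close>
  have "conf n x z = of_bool (x i = z) + (\<Sum>j\<in>{..<n} - {i}. of_bool (x j = z))"
    unfolding conf_eq_sum using assms by (subst sum.remove[of _ i]) auto
  moreover have "conf n (x(i := y)) z = of_bool (y = z) + (\<Sum>j\<in>{..<n} - {i}. of_bool (x j = z))"
    unfolding conf_eq_sum using assms by (subst sum.remove[of _ i]) auto
  ultimately show "jump (x i) y (conf n x) z = conf n (x(i := y)) z"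
    using assms(2) unfolding jump_def delta_def by auto
qed

text \<open>
  \<open>I + G / \<Lambda>\<close> for the generator \<open>G\<close> of \<open>n\<close> labelled particles, each jumping to its neighbour \<open>y\<close> at
  rate \<open>r x y / (2 d)\<close>; for \<open>\<Lambda>\<close> large it is the transition operator of the uniformized jump chain.
\<close>

definition step_op :: "((nat \<Rightarrow> int ^ 'n) \<Rightarrow> int ^ 'n \<Rightarrow> real) \<Rightarrow> nat \<Rightarrow> real \<Rightarrow>
    ((nat \<Rightarrow> int ^ 'n) \<Rightarrow> real) \<Rightarrow> (nat \<Rightarrow> int ^ 'n) \<Rightarrow> real" where
  "step_op r n \<Lambda> h x = h x +
     (\<Sum>i<n. \<Sum>y\<in>nbrs (x i). r x y * (h (x(i := y)) - h x)) / (2 * real CARD('n) * \<Lambda>)"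

definition sip_rate :: "real \<Rightarrow> nat \<Rightarrow> (nat \<Rightarrow> int ^ 'n) \<Rightarrow> int ^ 'n \<Rightarrow> real" where
  "sip_rate m n x y = m / 2 + real (conf n x y)"

text \<open>The factor \<open>real (\<eta> z)\<close> in the rates counts the labels at
  \<open>z\<close>; distributing it over them lets every labelled particle jump at rate
  \<open>sip_rate\<close>, whatever its label.\<close>

lemma sip_generator_conf:
  fixes x :: "nat \<Rightarrow> int ^ 'n::finite"
  shows "sip_generator m f (conf n x) =
    (\<Sum>i<n. \<Sum>y\<in>nbrs (x i). sip_rate m n x y * (f (conf n (x(i := y))) - f (conf n x))) / (2 * real CARD('n))"
proof -
  let ?\<eta> = "conf n x"
  let ?G = "\<lambda>z. \<Sum>y\<in>nbrs z. (m / 2 + real (?\<eta> y)) * (f (jump z y ?\<eta>) - f ?\<eta>) / (2 * real CARD('n))"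
  have eq: "(\<Sum>y\<in>nbrs z. srw_p z y * real (?\<eta> z) * (m / 2 + real (?\<eta> y)) * (f (jump z y ?\<eta>) - f ?\<eta>))
      = real (?\<eta> z) * ?G z" for z
    unfolding sum_distrib_left
    by (intro sum.cong refl) (simp add: srw_p_def nbrs_def l1norm_minus_commute[of z])
  have "sip_generator m f ?\<eta> = (\<Sum>\<^sub>\<infinity>z\<in>{z. ?\<eta> z \<noteq> 0}. real (?\<eta> z) * ?G z)"
    unfolding sip_generator_def eq by (intro infsum_cong_neutral) auto
  also have "\<dots> = (\<Sum>z | ?\<eta> z \<noteq> 0. real (?\<eta> z) * ?G z)"
    by (intro infsum_finite) (subst conf_support, simp)
  also have "\<dots> = (\<Sum>i<n. ?G (x i))" by (rule sum_conf)
  also have "\<dots> = (\<Sum>i<n. \<Sum>y\<in>nbrs (x i). sip_rate m n x y * (f (conf n (x(i := y))) - f (conf n x)) / (2 * real CARD('n)))"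
  proof (intro sum.cong refl)
    fix i y assume "i \<in> {..<n}" "y \<in> nbrs (x i)"
    hence "jump (x i) y (conf n x) = conf n (x(i := y))" by (intro jump_conf) auto
    thus "(m / 2 + real (conf n x y)) * (f (jump (x i) y (conf n x)) - f (conf n x)) / (2 * real CARD('n)) =
       sip_rate m n x y * (f (conf n (x(i := y))) - f (conf n x)) / (2 * real CARD('n))"
      by (simp add: sip_rate_def)
  qed
  finally show ?thesis by (simp add: sum_divide_distrib)
qed

lemma step_op_sip_rate:
  "step_op (sip_rate m n) n \<Lambda> (\<lambda>x. H (conf n x)) x = H (conf n x) + sip_generator m H (conf n x) / \<Lambda>"
  unfolding step_op_def sip_generator_conf by simp

text \<open>For such \<open>\<Lambda>\<close> the operator takes a convex combination of the value
  at \<open>x\<close> and the values after one jump, hence contracts the sup norm. The bounds are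
  asked for at these points only, because the comparison with independent walks controls nothing
  elsewhere.\<close>

lemma step_op_bounded:
  fixes x :: "nat \<Rightarrow> int ^ 'n::finite"
  assumes r: "\<And>y. 0 \<le> r x y" "\<And>y. r x y \<le> M" and M: "real n * M \<le> \<Lambda>" and \<Lambda>: "0 < \<Lambda>"
    and h: "\<bar>h x\<bar> \<le> C" "\<And>i y. i < n \<Longrightarrow> y \<in> nbrs (x i) \<Longrightarrow> \<bar>h (x(i := y))\<bar> \<le> C"
  shows "\<bar>step_op r n \<Lambda> h x\<bar> \<le> C"
proof -
  let ?c = "2 * real CARD('n) * \<Lambda>"
  define q where "q = (\<Sum>i<n. \<Sum>y\<in>nbrs (x i). r x y)"
  have c: "?c > 0" using \<Lambda> by simp
  have "q \<le> (\<Sum>i<n. \<Sum>y\<in>nbrs (x i). M)" unfolding q_def by (intro sum_mono r)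
  also have "\<dots> = 2 * real CARD('n) * (real n * M)" by (simp add: card_nbrs)
  also have "\<dots> \<le> ?c" using M by simp
  finally have q: "q \<le> ?c" .
  have C: "0 \<le> C" using h(1) by linarith
  have "step_op r n \<Lambda> h x * ?c = (?c - q) * h x + (\<Sum>i<n. \<Sum>y\<in>nbrs (x i). r x y * h (x(i := y)))"
    using \<Lambda> unfolding step_op_def q_def
    by (simp add: field_simps right_diff_distrib sum_subtractf sum_distrib_left)
  also have "\<bar>\<dots>\<bar> \<le> (?c - q) * C + (\<Sum>i<n. \<Sum>y\<in>nbrs (x i). r x y * C)"
  proof (rule order.trans[OF abs_triangle_ineq] add_mono)+
    show "\<bar>(?c - q) * h x\<bar> \<le> (?c - q) * C" using q h(1) by (simp add: abs_mult mult_left_mono)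
    show "\<bar>\<Sum>i<n. \<Sum>y\<in>nbrs (x i). r x y * h (x(i := y))\<bar> \<le> (\<Sum>i<n. \<Sum>y\<in>nbrs (x i). r x y * C)"
      using r h by (intro order.trans[OF sum_abs] sum_mono) (simp add: abs_mult mult_left_mono)
  qed
  also have "\<dots> = C * ?c" unfolding q_def by (simp add: algebra_simps sum_distrib_left)
  finally have "\<bar>step_op r n \<Lambda> h x\<bar> * ?c \<le> C * ?c" using \<Lambda> by (simp add: abs_mult)
  thus ?thesis using c by (rule mult_right_le_imp_le)
qed

lemma step_op_diff:
  "step_op r n \<Lambda> (\<lambda>x. h x - g x) x = step_op r n \<Lambda> h x - step_op r n \<Lambda> g x"
  unfolding step_op_def
  by (simp add: algebra_simps sum.distrib sum_subtractf diff_divide_distrib add_divide_distrib)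

lemma step_op_tendsto:
  assumes "\<And>x. ((\<lambda>k. h k x) \<longlongrightarrow> g x) F"
  shows "((\<lambda>k. step_op r n \<Lambda> (h k) x) \<longlongrightarrow> step_op r n \<Lambda> g x) F"
  unfolding step_op_def divide_inverse by (intro tendsto_intros assms)

lemma funpow_step_op_tendsto:
  assumes "\<And>x. ((\<lambda>k. h k x) \<longlongrightarrow> g x) F"
  shows "((\<lambda>k. (step_op r n \<Lambda> ^^ j) (h k) x) \<longlongrightarrow> (step_op r n \<Lambda> ^^ j) g x) F"
  using assms by (induction j arbitrary: x) (auto intro!: step_op_tendsto)

lemma funpow_step_op_bounded:
  fixes h :: "(nat \<Rightarrow> int ^ 'n::finite) \<Rightarrow> real"
  assumes r: "\<And>x y. 0 \<le> r x y" "\<And>x y. r x y \<le> M" and M: "real n * M \<le> \<Lambda>" and \<Lambda>: "0 < \<Lambda>"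
    and h: "\<And>x. \<bar>h x\<bar> \<le> C"
  shows "\<bar>(step_op r n \<Lambda> ^^ k) h x\<bar> \<le> C"
proof (induction k arbitrary: x)
  case 0 show ?case using h by simp
next
  case (Suc k)
  show ?case
    unfolding funpow.simps o_apply by (rule step_op_bounded[of r _ M, OF r M \<Lambda>]) (rule Suc.IH)+
qed

lemma sip_rate_bounds:
  assumes "0 \<le> m"
  shows "0 \<le> sip_rate m n x y" "sip_rate m n x y \<le> m / 2 + real n"
proof -
  have "real (conf n x y) \<le> (\<Sum>i<n. 1)" unfolding real_conf by (intro sum_mono) simp
  thus "0 \<le> sip_rate m n x y" "sip_rate m n x y \<le> m / 2 + real n"
    using assms by (auto simp: sip_rate_def)
qed

section \<open>The closed equation for pairs of particles\<close>

definition pair_sum :: "nat \<Rightarrow> (int ^ 'n \<Rightarrow> real) \<Rightarrow> (nat \<Rightarrow> int ^ 'n) \<Rightarrow> real" where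
  "pair_sum n \<phi> x = (\<Sum>i<n. \<Sum>j\<in>{..<n} - {i}. \<phi> (x i - x j))"

text \<open>
  The transition operator of the difference of two SIP particles; the additional rate 2 comes from
  either particle jumping onto the other.
\<close>

definition diff_op :: "real \<Rightarrow> real \<Rightarrow> (int ^ 'n \<Rightarrow> real) \<Rightarrow> int ^ 'n \<Rightarrow> real" where
  "diff_op m \<Lambda> \<phi> v = \<phi> v +
     (\<Sum>e\<in>nbrs 0. (m + 2 * of_bool (v + e = 0)) * (\<phi> (v + e) - \<phi> v)) / (2 * real CARD('n) * \<Lambda>)"

lemma sum_off_diag_swap:
  "(\<Sum>i\<in>I. \<Sum>j\<in>I - {i}. f i j) = (\<Sum>i\<in>I. \<Sum>j\<in>I - {i}. (f j i :: real))" if "finite I"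
proof -
  have "(\<Sum>i\<in>I. \<Sum>j\<in>I - {i}. f i j) = (\<Sum>i\<in>I. \<Sum>j\<in>{j. j \<in> I \<and> j \<noteq> i}. f i j)"
    by (intro sum.cong) auto
  also have "\<dots> = (\<Sum>j\<in>I. \<Sum>i\<in>{i. i \<in> I \<and> j \<noteq> i}. f i j)"
    by (rule sum.swap_restrict) (use that in auto)
  also have "\<dots> = (\<Sum>i\<in>I. \<Sum>j\<in>I - {i}. f j i)"
    by (intro sum.cong) auto
  finally show ?thesis .
qed

text \<open>Only pairs containing particle \<open>i\<close> change, and each of them occurs once
  with \<open>i\<close> in first and once with \<open>i\<close> in second position.\<close>

lemma pair_sum_update:
  fixes x :: "nat \<Rightarrow> int ^ 'n::finite"
  assumes "i < n"
  shows "pair_sum n \<phi> (x(i := y)) - pair_sum n \<phi> x =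
    (\<Sum>j\<in>{..<n} - {i}. \<phi> (y - x j) - \<phi> (x i - x j)) + (\<Sum>j\<in>{..<n} - {i}. \<phi> (x j - y) - \<phi> (x j - x i))"
proof -
  have split: "pair_sum n \<phi> z = (\<Sum>j\<in>{..<n} - {i}. \<phi> (z i - z j)) + (\<Sum>j\<in>{..<n} - {i}. \<phi> (z j - z i))
      + (\<Sum>k\<in>{..<n} - {i}. \<Sum>j\<in>{..<n} - {k} - {i}. \<phi> (z k - z j))" for z
  proof -
    have "pair_sum n \<phi> z = (\<Sum>j\<in>{..<n} - {i}. \<phi> (z i - z j)) + (\<Sum>k\<in>{..<n} - {i}. \<Sum>j\<in>{..<n} - {k}. \<phi> (z k - z j))"
      unfolding pair_sum_def using assms by (subst sum.remove[of _ i]) auto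
    also have "(\<Sum>k\<in>{..<n} - {i}. \<Sum>j\<in>{..<n} - {k}. \<phi> (z k - z j)) =
        (\<Sum>k\<in>{..<n} - {i}. \<phi> (z k - z i) + (\<Sum>j\<in>{..<n} - {k} - {i}. \<phi> (z k - z j)))"
      using assms by (intro sum.cong refl sum.remove) auto
    finally show ?thesis by (simp add: sum.distrib)
  qed
  have "(\<Sum>k\<in>{..<n} - {i}. \<Sum>j\<in>{..<n} - {k} - {i}. \<phi> ((x(i := y)) k - (x(i := y)) j)) =
      (\<Sum>k\<in>{..<n} - {i}. \<Sum>j\<in>{..<n} - {k} - {i}. \<phi> (x k - x j))"
    by (intro sum.cong) auto
  moreover have "(\<Sum>j\<in>{..<n} - {i}. \<phi> ((x(i := y)) i - (x(i := y)) j)) = (\<Sum>j\<in>{..<n} - {i}. \<phi> (y - x j))"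
    "(\<Sum>j\<in>{..<n} - {i}. \<phi> ((x(i := y)) j - (x(i := y)) i)) = (\<Sum>j\<in>{..<n} - {i}. \<phi> (x j - y))"
    by (intro sum.cong; simp)+
  ultimately show ?thesis unfolding split[of x] split[of "x(i := y)"] by (simp add: sum_subtractf)
qed

text \<open>
  The jumps of two particles onto a third one contribute antisymmetrically, so the dynamics of a
  pair does not feel the other particles.
\<close>

lemma step_op_pair_sum:
  fixes x :: "nat \<Rightarrow> int ^ 'n::finite"
  shows "step_op (sip_rate m n) n \<Lambda> (pair_sum n \<phi>) x = pair_sum n (diff_op m \<Lambda> \<phi>) x"
proof -
  \<comment> \<open>Effect on a pair when only its first particle moves: free jumps at rate
    \<open>m / 2\<close>, and one extra unit of rate for a jump onto the partner. The generator in
    \<open>diff_op\<close> is twice this.\<close>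
  define D where "D \<psi> v = (\<Sum>e\<in>nbrs 0. (m / 2 + of_bool (v + e = 0)) * (\<psi> (v + e) - \<psi> v))"
    for \<psi> :: "int ^ 'n \<Rightarrow> real" and v
  define T where "T \<psi> i j = (\<Sum>y\<in>nbrs (x i). sip_rate m n x y * (\<psi> (y - x j) - \<psi> (x i - x j)))"
    for \<psi> :: "int ^ 'n \<Rightarrow> real" and i j
  have key: "(\<Sum>i<n. \<Sum>j\<in>{..<n} - {i}. T \<psi> i j) = (\<Sum>i<n. \<Sum>j\<in>{..<n} - {i}. D \<psi> (x i - x j))" for \<psi>
  proof -
    \<comment> \<open>Effect on the pair \<open>(i, j)\<close> of the jump of \<open>i\<close> onto
      particle \<open>k\<close>. The term \<open>k = j\<close> is the attraction inside the pair and
      belongs to \<open>D\<close>.\<close>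
    define U where "U i j k = of_bool (x k \<in> nbrs (x i)) * (\<psi> (x k - x j) - \<psi> (x i - x j))" for i j k
    have T: "T \<psi> i j = D \<psi> (x i - x j) + (\<Sum>k\<in>{..<n} - {j}. U i j k)" if "j < n" for i j
    proof -
      have "(\<Sum>y\<in>nbrs (x i). real (conf n x y) * (\<psi> (y - x j) - \<psi> (x i - x j))) =
          (\<Sum>y\<in>nbrs (x i). \<Sum>k<n. of_bool (x k = y) * (\<psi> (y - x j) - \<psi> (x i - x j)))"
        unfolding real_conf by (simp add: sum_distrib_right)
      also have "\<dots> = (\<Sum>k<n. \<Sum>y\<in>nbrs (x i). of_bool (x k = y) * (\<psi> (y - x j) - \<psi> (x i - x j)))"
        by (rule sum.swap)
      also have "\<dots> = (\<Sum>k<n. U i j k)"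
      proof (intro sum.cong refl)
        fix k
        have "(\<Sum>y\<in>nbrs (x i). of_bool (x k = y) * (\<psi> (y - x j) - \<psi> (x i - x j))) =
            (\<Sum>y\<in>nbrs (x i). if x k = y then \<psi> (y - x j) - \<psi> (x i - x j) else 0)"
          by (intro sum.cong) auto
        thus "(\<Sum>y\<in>nbrs (x i). of_bool (x k = y) * (\<psi> (y - x j) - \<psi> (x i - x j))) = U i j k"
          by (simp add: finite_nbrs U_def)
      qed
      also have "\<dots> = U i j j + (\<Sum>k\<in>{..<n} - {j}. U i j k)"
        using that by (subst sum.remove[of _ j]) auto
      also have "U i j j = (\<Sum>e\<in>nbrs 0. of_bool (x i - x j + e = 0) * (\<psi> (x i - x j + e) - \<psi> (x i - x j)))"
      proof -
        have "(\<Sum>e\<in>nbrs 0. of_bool (x i - x j + e = 0) * (\<psi> (x i - x j + e) - \<psi> (x i - x j))) =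
          (\<Sum>e\<in>nbrs 0. if e = x j - x i then \<psi> 0 - \<psi> (x i - x j) else 0)"
          by (intro sum.cong) (auto simp: algebra_simps)
        also have "\<dots> = of_bool (x j - x i \<in> nbrs 0) * (\<psi> 0 - \<psi> (x i - x j))"
          by (simp add: finite_nbrs)
        finally show ?thesis by (simp add: U_def nbrs_def)
      qed
      finally have "(\<Sum>y\<in>nbrs (x i). real (conf n x y) * (\<psi> (y - x j) - \<psi> (x i - x j))) =
          (\<Sum>e\<in>nbrs 0. of_bool (x i - x j + e = 0) * (\<psi> (x i - x j + e) - \<psi> (x i - x j))) + (\<Sum>k\<in>{..<n} - {j}. U i j k)" .
      moreover have "(\<Sum>y\<in>nbrs (x i). m / 2 * (\<psi> (y - x j) - \<psi> (x i - x j))) =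
          (\<Sum>e\<in>nbrs 0. m / 2 * (\<psi> (x i - x j + e) - \<psi> (x i - x j)))"
        by (subst sum_nbrs) (simp add: algebra_simps)
      ultimately show ?thesis
        unfolding T_def D_def sip_rate_def by (simp add: distrib_right sum.distrib)
    qed
    have U: "(\<Sum>i\<in>{..<n} - {j}. \<Sum>k\<in>{..<n} - {j}. U i j k) = 0" for j
    proof -
      \<comment> \<open>The jumps of \<open>i\<close> onto \<open>k\<close> and of \<open>k\<close>
        onto \<open>i\<close> have equal rates and opposite effects on the pairs formed with
        \<open>j\<close>.\<close>
      have anti: "U k j i = - U i j k" for i k
        unfolding U_def by (auto simp: nbrs_sym[of "x i"])
      have "(\<Sum>i\<in>{..<n} - {j}. \<Sum>k\<in>{..<n} - {j}. U i j k) = (\<Sum>i\<in>{..<n} - {j}. \<Sum>k\<in>{..<n} - {j}. U k j i)"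
        by (rule sum.swap)
      also have "\<dots> = - (\<Sum>i\<in>{..<n} - {j}. \<Sum>k\<in>{..<n} - {j}. U i j k)"
        unfolding sum_negf[symmetric] by (intro sum.cong refl anti)
      finally show ?thesis by simp
    qed
    \<comment> \<open>After the swap the outer index is the particle at rest, so the inner sums of
      \<open>U\<close> run over all movers and all targets, and \<open>U\<close> cancels.\<close>
    have "(\<Sum>i<n. \<Sum>j\<in>{..<n} - {i}. T \<psi> i j) = (\<Sum>i<n. \<Sum>j\<in>{..<n} - {i}. T \<psi> j i)"
      by (rule sum_off_diag_swap) simp
    also have "\<dots> = (\<Sum>i<n. \<Sum>j\<in>{..<n} - {i}. D \<psi> (x j - x i) + (\<Sum>k\<in>{..<n} - {i}. U j i k))"
      by (intro sum.cong refl) (auto simp: T)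
    also have "\<dots> = (\<Sum>i<n. \<Sum>j\<in>{..<n} - {i}. D \<psi> (x j - x i))"
      by (simp add: sum.distrib U)
    also have "\<dots> = (\<Sum>i<n. \<Sum>j\<in>{..<n} - {i}. D \<psi> (x i - x j))"
      by (rule sum_off_diag_swap) simp
    finally show ?thesis .
  qed
  \<comment> \<open>Moving the second particle of a pair is moving the first one under the reflected
    function. Reflection commutes with \<open>D\<close> because \<open>nbrs 0\<close> is
    symmetric.\<close>
  define \<phi>' where "\<phi>' v = \<phi> (- v)" for v
  have D': "D \<phi>' v = D \<phi> (- v)" for v
  proof -
    have "D \<phi>' v = (\<Sum>e\<in>nbrs 0. (m / 2 + of_bool (v + - e = 0)) * (\<phi>' (v + - e) - \<phi>' v))"
      unfolding D_def by (subst sum_nbrs0_uminus[symmetric]) simp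
    also have "\<dots> = D \<phi> (- v)"
      unfolding D_def \<phi>'_def by (intro sum.cong) (auto simp: algebra_simps)
    finally show ?thesis .
  qed
  have "(\<Sum>i<n. \<Sum>y\<in>nbrs (x i). sip_rate m n x y * (pair_sum n \<phi> (x(i := y)) - pair_sum n \<phi> x)) =
      (\<Sum>i<n. \<Sum>y\<in>nbrs (x i). (\<Sum>j\<in>{..<n} - {i}. sip_rate m n x y * (\<phi> (y - x j) - \<phi> (x i - x j)))
        + (\<Sum>j\<in>{..<n} - {i}. sip_rate m n x y * (\<phi>' (y - x j) - \<phi>' (x i - x j))))"
    by (intro sum.cong refl) (simp add: pair_sum_update \<phi>'_def distrib_left flip: sum_distrib_left)
  also have "\<dots> = (\<Sum>i<n. (\<Sum>j\<in>{..<n} - {i}. T \<phi> i j) + (\<Sum>j\<in>{..<n} - {i}. T \<phi>' i j))"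
    unfolding T_def sum.distrib by (intro sum.cong refl arg_cong2[where f = "(+)"] sum.swap)
  also have "\<dots> = (\<Sum>i<n. \<Sum>j\<in>{..<n} - {i}. D \<phi> (x i - x j)) + (\<Sum>i<n. \<Sum>j\<in>{..<n} - {i}. D \<phi> (x j - x i))"
    by (simp add: sum.distrib key D')
  also have "(\<Sum>i<n. \<Sum>j\<in>{..<n} - {i}. D \<phi> (x j - x i)) = (\<Sum>i<n. \<Sum>j\<in>{..<n} - {i}. D \<phi> (x i - x j))"
    by (rule sum_off_diag_swap) simp
  also have "(\<Sum>i<n. \<Sum>j\<in>{..<n} - {i}. D \<phi> (x i - x j)) + (\<Sum>i<n. \<Sum>j\<in>{..<n} - {i}. D \<phi> (x i - x j)) =
      (\<Sum>i<n. \<Sum>j\<in>{..<n} - {i}. 2 * D \<phi> (x i - x j))" by (simp flip: sum_distrib_left)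
  finally have S: "(\<Sum>i<n. \<Sum>y\<in>nbrs (x i). sip_rate m n x y * (pair_sum n \<phi> (x(i := y)) - pair_sum n \<phi> x)) = \<dots>" .
  have "2 * D \<phi> v = (\<Sum>e\<in>nbrs 0. (m + 2 * of_bool (v + e = 0)) * (\<phi> (v + e) - \<phi> v))" for v
    unfolding D_def by (simp add: sum_distrib_left algebra_simps)
  thus ?thesis
    unfolding step_op_def S by (simp add: pair_sum_def diff_op_def sum.distrib sum_divide_distrib)
qed

lemma funpow_step_op_pair_sum:
  "(step_op (sip_rate m n) n \<Lambda> ^^ k) (pair_sum n \<phi>) x = pair_sum n ((diff_op m \<Lambda> ^^ k) \<phi>) x"
proof (induction k arbitrary: x)
  case (Suc k)
  have "(step_op (sip_rate m n) n \<Lambda> ^^ k) (pair_sum n \<phi>) = pair_sum n ((diff_op m \<Lambda> ^^ k) \<phi>)"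
    using Suc.IH by (rule ext)
  thus ?case by (simp add: step_op_pair_sum)
qed simp

section \<open>Decay of the difference walk\<close>

text \<open>The reversible measure of the difference walk. The walk leaves the origin for a given
  neighbour at rate \<open>m\<close> and returns from it at rate \<open>m + 2\<close>, so detailed
  balance puts the extra factor \<open>(m + 2) / m\<close> at 0.\<close>

definition diff_weight :: "real \<Rightarrow> int ^ 'n \<Rightarrow> real" where
  "diff_weight m v = (if v = 0 then (m + 2) / m else 1)"

text \<open>Taking values in \<open>ennreal\<close> lets mass be rearranged and compared without
  summability conditions.\<close>

definition diff_mass :: "real \<Rightarrow> (int ^ 'n \<Rightarrow> real) \<Rightarrow> ennreal" where
  "diff_mass m f = (\<integral>\<^sup>+v. ennreal (diff_weight m v * f v) \<partial>count_space UNIV)"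

section \<open>Reversibility and energy dissipation\<close>

context
  fixes m \<Lambda> :: real
  assumes m: "0 < m" and \<Lambda>: "2 * (m + 2) \<le> \<Lambda>"
begin

private definition jump_prob :: "int ^ 'n \<Rightarrow> int ^ 'n \<Rightarrow> real" where
  "jump_prob v e = (m + 2 * of_bool (v + e = 0)) / (2 * real CARD('n) * \<Lambda>)"

private lemma diff_op_eq: "diff_op m \<Lambda> f v = f v + (\<Sum>e\<in>nbrs 0. jump_prob v e * (f (v + e) - f v))"
  unfolding diff_op_def jump_prob_def by (simp add: sum_divide_distrib)

private lemma \<Lambda>_pos: "0 < \<Lambda>" using m \<Lambda> by (simp add: algebra_simps)

private lemma jump_prob_ge: "m / (2 * real CARD('n) * \<Lambda>) \<le> jump_prob v e" for v :: "int ^ 'n"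
  unfolding jump_prob_def using \<Lambda>_pos by (intro divide_right_mono) auto

private lemma jump_prob_nonneg: "0 \<le> jump_prob v e"
  unfolding jump_prob_def using \<Lambda>_pos m by (intro divide_nonneg_nonneg) auto

text \<open>Every jump has rate at most \<open>m + 2\<close>, so the lower bound on
  \<open>\<Lambda>\<close> makes the walk stay put with probability at least 1/2.\<close>

private lemma jump_prob_sum: "(\<Sum>e\<in>nbrs 0. jump_prob v e) \<le> 1 / 2"
  for v :: "int ^ 'n::finite"
proof -
  have "(\<Sum>e\<in>nbrs 0. jump_prob v e) \<le> (\<Sum>e\<in>nbrs (0 :: int ^ 'n). (m + 2) / (2 * real CARD('n) * \<Lambda>))"
    unfolding jump_prob_def using \<Lambda>_pos by (intro sum_mono divide_right_mono) auto
  also have "\<dots> = (m + 2) / \<Lambda>" by (simp add: card_nbrs)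
  also have "\<dots> \<le> 1 / 2" using \<Lambda>_pos \<Lambda> by (simp add: field_simps)
  finally show ?thesis .
qed

private lemma weight_ge_1: "1 \<le> diff_weight m v"
  unfolding diff_weight_def using m by auto

private lemma detailed_balance:
  assumes "e \<in> nbrs 0"
  shows "diff_weight m (v - e) * jump_prob (v - e) e = diff_weight m v * jump_prob v (- e)"
proof -
  have "e \<noteq> 0" using assms not_in_nbrs_self by blast
  thus ?thesis unfolding diff_weight_def jump_prob_def using m by auto
qed

private lemma diff_op_nonneg:
  assumes "\<And>v. 0 \<le> f v"
  shows "0 \<le> diff_op m \<Lambda> f v"
proof -
  have "diff_op m \<Lambda> f v = (1 - (\<Sum>e\<in>nbrs 0. jump_prob v e)) * f v + (\<Sum>e\<in>nbrs 0. jump_prob v e * f (v + e))"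
    unfolding diff_op_eq by (simp add: algebra_simps sum_subtractf sum_distrib_left)
  moreover have "0 \<le> 1 - (\<Sum>e\<in>nbrs 0. jump_prob v e)" using jump_prob_sum[of v] by linarith
  ultimately show ?thesis
    using jump_prob_nonneg assms by (auto intro!: add_nonneg_nonneg mult_nonneg_nonneg sum_nonneg)
qed

text \<open>A reversible measure is invariant: after translation by \<open>e\<close>, detailed
  balance turns the mass arriving by a jump into mass leaving \<open>v\<close> by the opposite jump,
  and leaving and staying add up to one.\<close>

private lemma diff_mass_invariant:
  fixes f :: "int ^ 'n::finite \<Rightarrow> real"
  assumes f: "\<And>v. 0 \<le> f v"
  shows "diff_mass m (diff_op m \<Lambda> f) = diff_mass m f"
proof -
  let ?\<pi> = "diff_weight m :: int ^ 'n \<Rightarrow> real"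
  let ?M = "count_space (UNIV :: (int ^ 'n) set)"
  let ?stay = "\<lambda>v. 1 - (\<Sum>e\<in>nbrs 0. jump_prob v e)"
  have \<pi>: "0 \<le> ?\<pi> v" for v using weight_ge_1[of v] by linarith
  have stay: "0 \<le> ?stay v" for v :: "int ^ 'n" using jump_prob_sum[of v] by linarith
  have "?\<pi> v * diff_op m \<Lambda> f v = ?\<pi> v * ?stay v * f v + (\<Sum>e\<in>nbrs 0. ?\<pi> v * jump_prob v e * f (v + e))" for v
    unfolding diff_op_eq by (simp add: algebra_simps sum_subtractf sum_distrib_left)
  hence "ennreal (?\<pi> v * diff_op m \<Lambda> f v) =
      ennreal (?\<pi> v * ?stay v * f v) + (\<Sum>e\<in>nbrs 0. ennreal (?\<pi> v * jump_prob v e * f (v + e)))" for v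
    by (simp only:, subst ennreal_plus)
      (auto intro!: sum_nonneg mult_nonneg_nonneg \<pi> stay f jump_prob_nonneg sum_ennreal[symmetric])
  hence "diff_mass m (diff_op m \<Lambda> f) = (\<integral>\<^sup>+v. ennreal (?\<pi> v * ?stay v * f v) \<partial>?M) +
      (\<Sum>e\<in>nbrs 0. \<integral>\<^sup>+v. ennreal (?\<pi> v * jump_prob v e * f (v + e)) \<partial>?M)"
    unfolding diff_mass_def by (simp add: nn_integral_add nn_integral_sum)
  also have "(\<integral>\<^sup>+v. ennreal (?\<pi> v * jump_prob v e * f (v + e)) \<partial>?M) =
      (\<integral>\<^sup>+v. ennreal (?\<pi> v * jump_prob v (- e) * f v) \<partial>?M)" if e: "e \<in> nbrs 0" for e
  proof -
    have "bij (\<lambda>v. v - e)" by (intro bij_betw_byWitness[where f' = "\<lambda>v. v + e"]) auto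
    from nn_integral_bij_count_space[OF this, of "\<lambda>v. ennreal (?\<pi> v * jump_prob v e * f (v + e))"]
    show ?thesis by (simp add: detailed_balance[OF e])
  qed
  hence "(\<Sum>e\<in>nbrs 0. \<integral>\<^sup>+v. ennreal (?\<pi> v * jump_prob v e * f (v + e)) \<partial>?M) =
      (\<Sum>e\<in>nbrs 0. \<integral>\<^sup>+v. ennreal (?\<pi> v * jump_prob v (- e) * f v) \<partial>?M)" by (intro sum.cong refl)
  also have "(\<integral>\<^sup>+v. ennreal (?\<pi> v * ?stay v * f v) \<partial>?M) + \<dots> =
      (\<integral>\<^sup>+v. ennreal (?\<pi> v * ?stay v * f v) + (\<Sum>e\<in>nbrs 0. ennreal (?\<pi> v * jump_prob v (- e) * f v)) \<partial>?M)"
    by (simp add: nn_integral_add nn_integral_sum)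
  also have "\<dots> = diff_mass m f"
    unfolding diff_mass_def
  proof (intro nn_integral_cong)
    fix v :: "int ^ 'n"
    have "(\<Sum>e\<in>nbrs 0. ennreal (?\<pi> v * jump_prob v (- e) * f v)) = (\<Sum>e\<in>nbrs 0. ennreal (?\<pi> v * jump_prob v e * f v))"
      by (rule sum_nbrs0_uminus)
    also have "\<dots> = ennreal (\<Sum>e\<in>nbrs 0. ?\<pi> v * jump_prob v e * f v)"
      by (intro sum_ennreal mult_nonneg_nonneg \<pi> f jump_prob_nonneg)
    finally have "ennreal (?\<pi> v * ?stay v * f v) + (\<Sum>e\<in>nbrs 0. ennreal (?\<pi> v * jump_prob v (- e) * f v)) =
        ennreal (?\<pi> v * ?stay v * f v + (\<Sum>e\<in>nbrs 0. ?\<pi> v * jump_prob v e * f v))"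
      by (subst ennreal_plus) (auto intro!: sum_nonneg mult_nonneg_nonneg \<pi> f stay jump_prob_nonneg)
    also have "?\<pi> v * ?stay v * f v + (\<Sum>e\<in>nbrs 0. ?\<pi> v * jump_prob v e * f v) = ?\<pi> v * f v"
      by (simp add: algebra_simps sum_distrib_left)
    finally show "ennreal (?\<pi> v * ?stay v * f v) + (\<Sum>e\<in>nbrs 0. ennreal (?\<pi> v * jump_prob v (- e) * f v)) =
        ennreal (?\<pi> v * f v)" .
  qed
  finally show ?thesis .
qed

text \<open>Jensen's inequality with the variance kept; holding probability at least \<open>1/2\<close> is used here.\<close>

private lemma diff_op_square:
  fixes f :: "int ^ 'n::finite \<Rightarrow> real"
  assumes e: "e \<in> nbrs 0"
  shows "(diff_op m \<Lambda> f v)\<^sup>2 + m / (4 * real CARD('n) * \<Lambda>) * (f (v + e) - f v)\<^sup>2 \<le> diff_op m \<Lambda> (\<lambda>v. (f v)\<^sup>2) v"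
proof -
  let ?p = "jump_prob v" and ?D = "\<lambda>e. f (v + e) - f v"
  let ?S = "\<Sum>e\<in>nbrs 0. ?p e * ?D e" and ?Q = "\<Sum>e\<in>nbrs 0. ?p e * (?D e)\<^sup>2"
  \<comment> \<open>Cauchy-Schwarz with weights \<open>sqrt (?p e)\<close>. The total jump
    probability is at most 1/2, so half of \<open>?Q\<close> already dominates the square of
    \<open>?S\<close>.\<close>
  have "?S\<^sup>2 = (\<Sum>e\<in>nbrs 0. sqrt (?p e) * (sqrt (?p e) * ?D e))\<^sup>2"
    by (simp flip: mult.assoc add: abs_of_nonneg jump_prob_nonneg)
  also have "\<dots> \<le> (\<Sum>e\<in>nbrs 0. (sqrt (?p e))\<^sup>2) * (\<Sum>e\<in>nbrs 0. (sqrt (?p e) * ?D e)\<^sup>2)"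
    by (rule Cauchy_Schwarz_ineq_sum)
  also have "\<dots> = (\<Sum>e\<in>nbrs 0. ?p e) * ?Q"
    by (simp add: power_mult_distrib jump_prob_nonneg)
  also have "\<dots> \<le> 1 / 2 * ?Q"
    by (intro mult_right_mono jump_prob_sum sum_nonneg mult_nonneg_nonneg jump_prob_nonneg) auto
  finally have S: "?S\<^sup>2 \<le> 1 / 2 * ?Q" .
  have "m / (2 * real CARD('n) * \<Lambda>) * (?D e)\<^sup>2 \<le> ?p e * (?D e)\<^sup>2"
    by (intro mult_right_mono jump_prob_ge) auto
  also have "\<dots> \<le> ?Q"
      using e by (intro member_le_sum mult_nonneg_nonneg jump_prob_nonneg) (auto simp: finite_nbrs)
  finally have "m / (2 * real CARD('n) * \<Lambda>) * (?D e)\<^sup>2 \<le> ?Q" .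
  \<comment> \<open>The remaining half of \<open>?Q\<close> pays for the dissipation; the constant
    is therefore half of the least jump probability along an edge.\<close>
  moreover have "m / (4 * real CARD('n) * \<Lambda>) = 1 / 2 * (m / (2 * real CARD('n) * \<Lambda>))" by simp
  ultimately have Q: "m / (4 * real CARD('n) * \<Lambda>) * (?D e)\<^sup>2 \<le> 1 / 2 * ?Q"
    by (simp only: mult.assoc)
  have "?p e * ((f (v + e))\<^sup>2 - (f v)\<^sup>2) = 2 * f v * (?p e * ?D e) + ?p e * (?D e)\<^sup>2" for e
    by (simp add: power2_eq_square algebra_simps)
  hence "diff_op m \<Lambda> (\<lambda>v. (f v)\<^sup>2) v = (f v)\<^sup>2 + 2 * f v * ?S + ?Q"
    unfolding diff_op_eq by (simp add: sum.distrib sum_distrib_left)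
  moreover have "(diff_op m \<Lambda> f v)\<^sup>2 = (f v)\<^sup>2 + 2 * f v * ?S + ?S\<^sup>2"
    unfolding diff_op_eq by (simp add: power2_eq_square algebra_simps)
  ultimately show ?thesis using S Q by linarith
qed

text \<open>Summing \<open>diff_op_square\<close> against the weights gives the energy inequality,
  since the mass of the squared function is invariant. The gradient term is kept at the single site
  \<open>v\<close>, where its weight is at least 1.\<close>

private lemma diff_mass_square:
  fixes f :: "int ^ 'n::finite \<Rightarrow> real"
  assumes e: "e \<in> nbrs 0"
  shows "diff_mass m (\<lambda>v. (diff_op m \<Lambda> f v)\<^sup>2) + ennreal (m / (4 * real CARD('n) * \<Lambda>) * (f (v + e) - f v)\<^sup>2)
    \<le> diff_mass m (\<lambda>v. (f v)\<^sup>2)"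
proof -
  let ?s = "m / (4 * real CARD('n) * \<Lambda>) * (f (v + e) - f v)\<^sup>2"
  let ?\<pi> = "diff_weight m :: int ^ 'n \<Rightarrow> real"
  have s: "0 \<le> ?s" using m \<Lambda>_pos by simp
  have \<pi>: "0 \<le> ?\<pi> u" for u using weight_ge_1[of u] by linarith
  have "ennreal ?s = (\<integral>\<^sup>+u. ennreal ?s * indicator {v} u \<partial>count_space UNIV)"
    by (simp add: nn_integral_cmult_indicator)
  hence "diff_mass m (\<lambda>v. (diff_op m \<Lambda> f v)\<^sup>2) + ennreal ?s =
      (\<integral>\<^sup>+u. ennreal (?\<pi> u * (diff_op m \<Lambda> f u)\<^sup>2) + ennreal ?s * indicator {v} u \<partial>count_space UNIV)"
    unfolding diff_mass_def by (simp add: nn_integral_add)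
  also have "\<dots> \<le> (\<integral>\<^sup>+u. ennreal (?\<pi> u * diff_op m \<Lambda> (\<lambda>v. (f v)\<^sup>2) u) \<partial>count_space UNIV)"
  proof (intro nn_integral_mono)
    fix u
    have "?\<pi> u * (diff_op m \<Lambda> f u)\<^sup>2 + ?s * indicator {v} u \<le>
        ?\<pi> u * ((diff_op m \<Lambda> f u)\<^sup>2 + ?s * indicator {v} u)"
      using s weight_ge_1[of u] mult_right_mono[OF weight_ge_1[of u] s] by (auto simp: indicator_def distrib_left)
    also have "(diff_op m \<Lambda> f u)\<^sup>2 + ?s * indicator {v} u \<le> diff_op m \<Lambda> (\<lambda>v. (f v)\<^sup>2) u"
    proof (cases "u = v")
      case False
      have "0 \<le> m / (4 * real CARD('n) * \<Lambda>) * (f (u + e) - f u)\<^sup>2" using m \<Lambda>_pos by simp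
      thus ?thesis using False diff_op_square[OF e, of f u] by simp
    qed (use diff_op_square[OF e, of f v] in simp)
    finally have "?\<pi> u * (diff_op m \<Lambda> f u)\<^sup>2 + ?s * indicator {v} u \<le> ?\<pi> u * diff_op m \<Lambda> (\<lambda>v. (f v)\<^sup>2) u"
      using \<pi>[of u] by (simp add: mult_left_mono)
    moreover have "ennreal (?\<pi> u * (diff_op m \<Lambda> f u)\<^sup>2) + ennreal ?s * indicator {v} u =
        ennreal (?\<pi> u * (diff_op m \<Lambda> f u)\<^sup>2 + ?s * indicator {v} u)"
      using s \<pi>[of u] by (simp add: indicator_def)
    ultimately show "ennreal (?\<pi> u * (diff_op m \<Lambda> f u)\<^sup>2) + ennreal ?s * indicator {v} u \<le>
        ennreal (?\<pi> u * diff_op m \<Lambda> (\<lambda>v. (f v)\<^sup>2) u)" by (simp add: ennreal_leI)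
  qed
  also have "\<dots> = diff_mass m (\<lambda>v. (f v)\<^sup>2)"
    using diff_mass_invariant[of "\<lambda>v. (f v)\<^sup>2"] by (simp add: diff_mass_def)
  finally show ?thesis .
qed

text \<open>
  The energy dissipation makes the iterates asymptotically flat along every edge, and a flat
  function of bounded mass on an infinite line is small.
\<close>

lemma diff_op_decay:
  fixes v w :: "int ^ 'n::finite"
  shows "(\<lambda>k. (diff_op m \<Lambda> ^^ k) (indicator {w}) v) \<longlonglongrightarrow> 0"
proof -
  define f where "f k = (diff_op m \<Lambda> ^^ k) (indicator {w})" for k
  have f_Suc: "f (Suc k) = diff_op m \<Lambda> (f k)" for k by (simp add: f_def)
  have f_nonneg: "0 \<le> f k u" for k u
    by (induction k arbitrary: u) (auto simp: f_Suc f_def[of 0] intro: diff_op_nonneg)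
  have delta_mass: "diff_mass m (indicator {w} :: int ^ 'n \<Rightarrow> real) = ennreal (diff_weight m w)"
    "diff_mass m (\<lambda>u. (indicator {w} u)\<^sup>2) = ennreal (diff_weight m w)"
  proof -
    have "ennreal (diff_weight m u * indicator {w} u) = ennreal (diff_weight m w) * indicator {w} u"
      "ennreal (diff_weight m u * (indicator {w} u)\<^sup>2) = ennreal (diff_weight m w) * indicator {w} u" for u
      by (auto simp: indicator_def)
    thus "diff_mass m (indicator {w} :: int ^ 'n \<Rightarrow> real) = ennreal (diff_weight m w)"
      "diff_mass m (\<lambda>u. (indicator {w} u)\<^sup>2) = ennreal (diff_weight m w)"
      unfolding diff_mass_def by (simp_all add: nn_integral_cmult_indicator)
  qed
  have mass: "diff_mass m (f k) = ennreal (diff_weight m w)" for k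
    by (induction k) (simp_all add: f_Suc f_def[of 0] delta_mass diff_mass_invariant f_nonneg)
  \<comment> \<open>The energies decrease and stay nonnegative, so their decrements tend to 0, and
    these dominate the squared gradient along the edge.\<close>
  have flat: "(\<lambda>k. f k (u + e) - f k u) \<longlonglongrightarrow> 0" if e: "e \<in> nbrs 0" for u e
  proof -
    define E where "E k = diff_mass m (\<lambda>v. (f k v)\<^sup>2)" for k
    let ?\<gamma> = "m / (4 * real CARD('n) * \<Lambda>)"
    have \<gamma>: "0 < ?\<gamma>" using m \<Lambda>_pos by simp
    have step: "E (Suc k) + ennreal (?\<gamma> * (f k (u + e) - f k u)\<^sup>2) \<le> E k" for k
      using diff_mass_square[OF e, of "f k" u] by (simp add: E_def f_Suc)
    have fin: "E k < \<infinity>" for k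
    proof (induction k)
      case 0 show ?case by (simp add: E_def f_def delta_mass)
    next
      case (Suc k)
      have "E (Suc k) \<le> E k" using step[of k] by (rule order.trans[rotated]) simp
      thus ?case using Suc.IH by simp
    qed
    define R where "R k = enn2real (E k)" for k
    have ER: "E k = ennreal (R k)" for k using fin[of k] by (simp add: R_def)
    have R_nonneg: "0 \<le> R k" for k by (simp add: R_def)
    have stepR: "R (Suc k) + ?\<gamma> * (f k (u + e) - f k u)\<^sup>2 \<le> R k" for k
    proof -
      have "ennreal (R (Suc k) + ?\<gamma> * (f k (u + e) - f k u)\<^sup>2) \<le> ennreal (R k)"
        using step[of k] R_nonneg[of "Suc k"] mult_nonneg_nonneg[OF less_imp_le[OF \<gamma>] zero_le_power2]
        unfolding ER by (subst ennreal_plus)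
      thus ?thesis using R_nonneg by simp
    qed
    have "R (Suc k) \<le> R k" for k
      using stepR[of k] \<gamma> by (smt (verit) mult_nonneg_nonneg zero_le_power2)
    hence "decseq R" by (rule decseq_SucI)
    then obtain L where L: "R \<longlonglongrightarrow> L"
      by (rule decseq_convergent[of R 0]) (simp add: R_nonneg)
    have "(\<lambda>k. (R k - R (Suc k)) / ?\<gamma>) \<longlonglongrightarrow> (L - L) / ?\<gamma>"
      using \<gamma> L LIMSEQ_Suc[OF L] by (intro tendsto_intros) auto
    hence lim: "(\<lambda>k. (R k - R (Suc k)) / ?\<gamma>) \<longlonglongrightarrow> 0" by simp
    have "(f k (u + e) - f k u)\<^sup>2 \<le> (R k - R (Suc k)) / ?\<gamma>" for k
    proof -
      have "?\<gamma> * (f k (u + e) - f k u)\<^sup>2 \<le> R k - R (Suc k)" using stepR[of k] by linarith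
      thus ?thesis using \<gamma> by (subst pos_le_divide_eq) (auto simp: mult.commute)
    qed
    hence "(\<lambda>k. (f k (u + e) - f k u)\<^sup>2) \<longlonglongrightarrow> 0"
      by (intro tendsto_sandwich[OF _ _ tendsto_const lim]) auto
    from tendsto_real_sqrt[OF this] show ?thesis
      by (simp add: tendsto_rabs_zero_iff)
  qed
  fix i :: 'n
  \<comment> \<open>A ray along a coordinate axis: infinitely many distinct sites, consecutive ones
    joined by an edge.\<close>
  define p where "p j = v + axis i (int j)" for j
  have p_Suc: "p (Suc j) = p j + axis i 1" for j
    by (simp add: p_def vec_eq_iff axis_def)
  have inj: "inj p"
    by (rule injI) (auto simp: p_def axis_eq_axis)
  have axis: "axis i 1 \<in> nbrs (0 :: int ^ 'n)"
    by (auto simp: nbrs_def l1norm_eq_1_iff)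
  have flat_p: "(\<lambda>k. f k (p j) - f k v) \<longlonglongrightarrow> 0" for j
  proof (induction j)
    case 0 show ?case by (simp add: p_def axis_def zero_vec_def[symmetric])
  next
    case (Suc j)
    have "(\<lambda>k. (f k (p j + axis i 1) - f k (p j)) + (f k (p j) - f k v)) \<longlonglongrightarrow> 0 + 0"
      by (intro tendsto_add flat axis Suc.IH)
    thus ?case by (simp add: p_Suc)
  qed
  \<comment> \<open>The sites are distinct and their weights at least 1, so the invariant mass
    bounds the sum uniformly in \<open>k\<close> and \<open>N\<close>.\<close>
  have sum_le: "(\<Sum>j<N. f k (p j)) \<le> diff_weight m w" for N k
  proof -
    have "(\<Sum>j<N. ennreal (f k (p j))) \<le> (\<Sum>j<N. ennreal (diff_weight m (p j) * f k (p j)))"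
    proof (intro sum_mono ennreal_leI)
      fix j
      show "f k (p j) \<le> diff_weight m (p j) * f k (p j)"
        using mult_right_mono[OF weight_ge_1[of "p j"] f_nonneg[of k "p j"]] by simp
    qed
    also have "\<dots> = (\<Sum>u\<in>p ` {..<N}. ennreal (diff_weight m u * f k u))"
      using inj by (subst sum.reindex) (auto simp: inj_on_def)
    also have "\<dots> = (\<integral>\<^sup>+u. ennreal (diff_weight m u * f k u) \<partial>count_space (p ` {..<N}))"
      by (simp add: nn_integral_count_space_finite)
    also have "\<dots> \<le> diff_mass m (f k)"
      unfolding diff_mass_def
      by (subst nn_integral_count_space_indicator) (auto intro!: nn_integral_mono simp: indicator_def)
    finally have "ennreal (\<Sum>j<N. f k (p j)) \<le> ennreal (diff_weight m w)"
      using f_nonneg by (simp add: mass)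
    thus ?thesis using weight_ge_1[of w] by simp
  qed

  have "(\<lambda>k. f k v) \<longlonglongrightarrow> 0"
  proof (rule order_tendstoI)
    fix a :: real assume "a < 0"
    thus "\<forall>\<^sub>F k in sequentially. a < f k v" using f_nonneg by (intro always_eventually) (auto intro: less_le_trans)
  next
    fix a :: real assume a: "0 < a"
    \<comment> \<open>If \<open>N\<close> values were equal and summed to at most
      \<open>diff_weight m w\<close>, each would be below \<open>a / 2\<close>; the deviation from
      equality uses up the other half of \<open>a\<close>.\<close>
    obtain N :: nat where N: "diff_weight m w / (a / 2) < real N" using reals_Archimedean2 by blast
    have "0 < diff_weight m w / (a / 2)" using a weight_ge_1[of w] by simp
    hence N0: "0 < real N" using N by linarith
    have "(\<lambda>k. (\<Sum>j<N. f k (p j) - f k v)) \<longlonglongrightarrow> (\<Sum>j<N. 0)" by (intro tendsto_sum flat_p)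
    hence "\<forall>\<^sub>F k in sequentially. \<bar>\<Sum>j<N. f k (p j) - f k v\<bar> < a / 2 * real N"
      using a N0 by (intro order_tendstoD(2)[of _ 0]) (auto intro: tendsto_rabs_zero)
    thus "\<forall>\<^sub>F k in sequentially. f k v < a"
    proof eventually_elim
      case (elim k)
      have "real N * f k v = (\<Sum>j<N. f k (p j)) - (\<Sum>j<N. f k (p j) - f k v)"
        by (simp add: sum_subtractf)
      also have "\<dots> < diff_weight m w + a / 2 * real N" using sum_le[of k N] elim by linarith
      also have "\<dots> \<le> a / 2 * real N + a / 2 * real N"
        using N a by (simp add: field_simps)
      finally have "real N * f k v < real N * a" by (simp add: mult.commute)
      thus ?case using N0 by (simp add: mult_less_cancel_left_pos)
    qed
  qed
  thus ?thesis by (simp add: f_def)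
qed

end

section \<open>Poisson representation of the finite-particle process\<close>

text \<open>Preimages are unions of sets that fix finitely many discrete coordinates, so a cylinder
  function is even continuous.\<close>

lemma cylinder_measurable:
  fixes f :: "'n::finite config \<Rightarrow> real"
  assumes "cylinder f"
  shows "f \<in> borel_measurable borel"
proof (rule borel_measurable_continuous_onI, unfold continuous_on_open_vimage[OF open_UNIV], intro allI impI)
  fix S :: "real set"
  assume "open S"
  from assms obtain A where A: "finite A" and f: "\<And>\<eta> \<zeta>. (\<forall>x\<in>A. \<eta> x = \<zeta> x) \<Longrightarrow> f \<eta> = f \<zeta>"
    unfolding cylinder_def by metis
  have op: "open (\<Inter>x\<in>A. (\<lambda>\<zeta> :: 'n config. \<zeta> x) -` {\<eta> x})" for \<eta>
    using A by (intro open_INT ballI open_vimage discrete_topology_class.open_discrete continuous_on_product_coordinates)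
  have eq: "f -` S \<inter> UNIV = (\<Union>\<eta>\<in>f -` S. \<Inter>x\<in>A. (\<lambda>\<zeta>. \<zeta> x) -` {\<eta> x})"
    using f by fastforce
  show "open (f -` S \<inter> UNIV)" unfolding eq by (intro open_UN ballI op)
qed

section \<open>Laws carried by countable sets\<close>

lemma singleton_config_borel: "{\<zeta> :: 'n::finite config} \<in> sets borel"
proof -
  have "closed (\<Inter>z. (\<lambda>\<eta> :: 'n config. \<eta> z) -` {\<zeta> z})"
    by (intro closed_INT ballI closed_vimage continuous_on_product_coordinates closed_singleton)
  moreover have "(\<Inter>z. (\<lambda>\<eta> :: 'n config. \<eta> z) -` {\<zeta> z}) = {\<zeta>}" by auto
  ultimately show ?thesis by simp
qed

text \<open>Meaningful only when the point masses of \<open>M\<close> add up to 1, as they do if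
  \<open>M\<close> is a probability carried by a countable set.\<close>

definition pmf_of_measure :: "'a measure \<Rightarrow> 'a pmf" where
  "pmf_of_measure M = embed_pmf (\<lambda>x. measure M {x})"

lemma
  assumes M: "prob_space M" "\<And>x. {x} \<in> sets M" and E: "countable E" "AE x in M. x \<in> E"
  shows pmf_pmf_of_measure: "pmf (pmf_of_measure M) x = measure M {x}"
    and set_pmf_of_measure: "set_pmf (pmf_of_measure M) \<subseteq> E"
    and distr_pmf_of_measure: "M = distr (measure_pmf (pmf_of_measure M)) M id"
proof -
  interpret prob_space M by fact
  have sets_E: "B \<in> sets M" if "countable B" for B
    using that M(2) by (rule sets.countable[rotated])
  have space: "space M = UNIV" using sets.sets_into_space[OF M(2)] by auto
  have out: "emeasure M {x} = 0" if "x \<notin> E" for x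
  proof -
    have "AE y in M. y \<in> {x} \<longleftrightarrow> y \<in> {}" using E(2) by eventually_elim (use that in auto)
    from emeasure_eq_AE[OF this] show ?thesis using sets_E[of "{x}"] by simp
  qed
  have sum: "(\<integral>\<^sup>+x. emeasure M {x} \<partial>count_space A) = emeasure M A" if A: "A \<in> sets M" for A
  proof -
    have "(\<integral>\<^sup>+x. emeasure M {x} \<partial>count_space A) = (\<integral>\<^sup>+x. emeasure M {x} \<partial>count_space (A \<inter> E))"
      by (rule nn_integral_count_space_eq) (auto simp: out)
    also have "\<dots> = emeasure M (A \<inter> E)"
      using E(1) by (intro emeasure_countable_singleton[symmetric] sets_E) auto
    also have "\<dots> = emeasure M A"
      using E A sets_E[of E] by (intro emeasure_eq_AE) auto
    finally show ?thesis .
  qed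
  have "(\<integral>\<^sup>+x. ennreal (measure M {x}) \<partial>count_space UNIV) = emeasure M UNIV"
    using sum[OF sets.top] by (simp add: emeasure_eq_measure space)
  also have "\<dots> = 1" using emeasure_space_1 by (simp add: space)
  finally show pmf: "pmf (pmf_of_measure M) x = measure M {x}" for x
    unfolding pmf_of_measure_def by (intro pmf_embed_pmf) simp_all
  show "set_pmf (pmf_of_measure M) \<subseteq> E"
  proof
    fix x assume "x \<in> set_pmf (pmf_of_measure M)"
    hence "measure M {x} \<noteq> 0" by (simp add: set_pmf_iff pmf)
    thus "x \<in> E" using out[of x] by (auto simp: emeasure_eq_measure)
  qed
  show "M = distr (measure_pmf (pmf_of_measure M)) M id"
  proof (rule measure_eqI)
    fix A assume A: "A \<in> sets M"
    have "emeasure M A = (\<integral>\<^sup>+x. ennreal (pmf (pmf_of_measure M) x) \<partial>count_space A)"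
      using sum[OF A] by (simp add: pmf emeasure_eq_measure)
    also have "\<dots> = emeasure (measure_pmf (pmf_of_measure M)) A" by (rule nn_integral_pmf)
    finally show "emeasure M A = emeasure (distr (measure_pmf (pmf_of_measure M)) M id) A"
      using A by (simp add: emeasure_distr space)
  qed simp
qed

lemma integrable_pmf_bounded:
  fixes H :: "'a \<Rightarrow> real"
  assumes "\<And>\<zeta>. \<zeta> \<in> set_pmf p \<Longrightarrow> \<bar>H \<zeta>\<bar> \<le> C"
  shows "integrable (measure_pmf p) H"
  using assms by (intro measure_pmf.integrable_const_bound[where B = C]) (auto simp: AE_measure_pmf_iff)

lemma abs_expectation_pmf_le:
  fixes H :: "'a \<Rightarrow> real"
  assumes "\<And>\<zeta>. \<zeta> \<in> set_pmf p \<Longrightarrow> \<bar>H \<zeta>\<bar> \<le> C"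
  shows "\<bar>measure_pmf.expectation p H\<bar> \<le> C"
proof -
  obtain \<zeta> where "\<zeta> \<in> set_pmf p" using set_pmf_not_empty by fast
  hence C: "0 \<le> C" using assms[of \<zeta>] by linarith
  have "\<bar>measure_pmf.expectation p H\<bar> \<le> measure_pmf.expectation p (\<lambda>\<zeta>. \<bar>H \<zeta>\<bar>)"
    by (rule integral_abs_bound)
  also have "\<dots> \<le> measure_pmf.expectation p (\<lambda>_. C)"
    using assms C by (intro integral_mono_AE integrable_pmf_bounded[where C = C]) (auto simp: AE_measure_pmf_iff)
  finally show ?thesis by simp
qed

section \<open>Taylor and Poisson series\<close>

lemma power_over_fact_tendsto_0: "(\<lambda>n. (r :: real) ^ n / fact n) \<longlonglongrightarrow> 0"
  using summable_exp[of r] by (intro summable_LIMSEQ_zero) (simp add: field_simps)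

text \<open>Geometric growth of the derivatives is beaten by the factorial in the remainder.
  One-sided derivatives are used because the process has no negative times.\<close>

lemma taylor_sums_right:
  fixes f :: "nat \<Rightarrow> real \<Rightarrow> real"
  assumes deriv: "\<And>k t. 0 \<le> t \<Longrightarrow> (f k has_real_derivative f (Suc k) t) (at t within {0..})"
    and bound: "\<And>k t. 0 \<le> t \<Longrightarrow> t \<le> T \<Longrightarrow> \<bar>f k t\<bar> \<le> C * \<Lambda> ^ k" and T: "0 \<le> T"
  shows "(\<lambda>k. f k 0 * T ^ k / fact k) sums f 0 T"
proof -
  have bd: "\<bar>f 0 T - (\<Sum>k\<le>n. f k 0 * T ^ k / fact k)\<bar> \<le> C * \<Lambda> * T * ((\<Lambda> * T) ^ n / fact n)" for n
  proof -
    have "norm (f 0 T - (\<Sum>k\<le>n. f k 0 * (T - 0) ^ k / fact k)) \<le> C * \<Lambda> ^ Suc n * norm (T - 0) ^ Suc n / fact n"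
    proof (rule field_Taylor[where S = "{0..T}"])
      show "(f i has_real_derivative f (Suc i) x) (at x within {0..T})" if "x \<in> {0..T}" for i x
        using that by (intro DERIV_subset[OF deriv]) auto
    qed (use bound[where k = "Suc n"] T in auto)
    thus ?thesis using T by (simp add: power_mult_distrib mult_ac)
  qed
  have lim: "(\<lambda>n. C * \<Lambda> * T * ((\<Lambda> * T) ^ n / fact n)) \<longlonglongrightarrow> 0"
    using tendsto_mult_right_zero[OF power_over_fact_tendsto_0] .
  have "(\<lambda>n. f 0 T - (\<Sum>k\<le>n. f k 0 * T ^ k / fact k)) \<longlonglongrightarrow> 0"
    by (rule Lim_null_comparison[OF _ lim], rule always_eventually, rule allI, unfold real_norm_def, rule bd)
  from tendsto_diff[OF tendsto_const[of "f 0 T"] this] show ?thesis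
    by (simp add: sums_def_le)
qed

lemma poisson_expectation_sums:
  fixes a :: "nat \<Rightarrow> real"
  assumes r: "0 < r" and a: "\<And>k. \<bar>a k\<bar> \<le> C"
  shows "(\<lambda>k. a k * r ^ k / fact k) sums (exp r * measure_pmf.expectation (poisson_pmf r) a)"
proof -
  have int: "integrable (measure_pmf (poisson_pmf r)) a"
    using a by (rule integrable_pmf_bounded)
  hence "integrable (count_space UNIV) (\<lambda>k. pmf (poisson_pmf r) k *\<^sub>R a k)"
    unfolding measure_pmf_eq_density by (subst (asm) integrable_density) auto
  hence "(\<lambda>k. pmf (poisson_pmf r) k *\<^sub>R a k) sums (\<integral>k. pmf (poisson_pmf r) k *\<^sub>R a k \<partial>count_space UNIV)"
    by (rule sums_integral_count_space_nat)
  also have "(\<integral>k. pmf (poisson_pmf r) k *\<^sub>R a k \<partial>count_space UNIV) = measure_pmf.expectation (poisson_pmf r) a"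
    unfolding measure_pmf_eq_density by (subst integral_density) auto
  finally have "(\<lambda>k. exp r * (pmf (poisson_pmf r) k *\<^sub>R a k)) sums (exp r * measure_pmf.expectation (poisson_pmf r) a)"
    by (rule sums_mult)
  moreover have "exp r * (pmf (poisson_pmf r) k *\<^sub>R a k) = a k * r ^ k / fact k" for k
    using r by (simp add: exp_minus field_simps)
  ultimately show ?thesis by simp
qed

section \<open>The law of finitely many particles\<close>

context sip_process
begin

definition law :: "real \<Rightarrow> 'n config \<Rightarrow> 'n config pmf" where
  "law t \<xi> = pmf_of_measure (P t \<xi>)"

lemma
  assumes "0 \<le> t"
  shows prob_space_P: "prob_space (P t \<eta>)" and sets_P: "sets (P t \<eta>) = sets borel"
proof -
  have "P t \<eta> \<in> space (prob_algebra borel)"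
    using measurable_space[OF kernel[OF assms]] by simp
  thus "prob_space (P t \<eta>)" "sets (P t \<eta>) = sets borel" by (auto simp: space_prob_algebra)
qed

lemma
  assumes t: "0 \<le> t" and \<xi>: "finite_config \<xi>"
  shows pmf_law: "pmf (law t \<xi>) \<zeta> = measure (P t \<xi>) {\<zeta>}"
    and set_law: "set_pmf (law t \<xi>) \<subseteq> {\<zeta>. finite_config \<zeta> \<and> num_particles \<zeta> = num_particles \<xi>}"
    and P_eq_law: "P t \<xi> = distr (measure_pmf (law t \<xi>)) borel id"
proof -
  let ?E = "{\<zeta> :: 'n config. finite_config \<zeta> \<and> num_particles \<zeta> = num_particles \<xi>}"
  have "countable ?E" by (rule countable_subset[OF _ countable_finite_configs]) auto
  moreover have "AE \<zeta> in P t \<xi>. \<zeta> \<in> ?E" using conservation[OF t \<xi>] by simp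
  moreover have "{\<zeta>} \<in> sets (P t \<xi>)" for \<zeta> unfolding sets_P[OF t] by (rule singleton_config_borel)
  moreover have "distr (measure_pmf p) (P t \<xi>) id = distr (measure_pmf p) borel id" for p
    by (intro distr_cong sets_P[OF t]) auto
  ultimately show "pmf (law t \<xi>) \<zeta> = measure (P t \<xi>) {\<zeta>}"
    "set_pmf (law t \<xi>) \<subseteq> ?E" "P t \<xi> = distr (measure_pmf (law t \<xi>)) borel id"
    unfolding law_def
    using prob_space_P[OF t] pmf_pmf_of_measure distr_pmf_of_measure set_pmf_of_measure by metis+
qed

lemma integral_P_eq_law:
  fixes f :: "'n config \<Rightarrow> real"
  assumes "0 \<le> t" "finite_config \<xi>" "f \<in> borel_measurable borel"
  shows "(\<integral>\<zeta>. f \<zeta> \<partial>P t \<xi>) = measure_pmf.expectation (law t \<xi>) f"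
  by (subst P_eq_law[OF assms(1,2)], subst integral_distr) (use assms(3) in auto)

lemma nn_integral_P_eq_law:
  assumes "0 \<le> t" "finite_config \<xi>" "f \<in> borel_measurable borel"
  shows "(\<integral>\<^sup>+\<zeta>. f \<zeta> \<partial>P t \<xi>) = (\<integral>\<^sup>+\<zeta>. f \<zeta> \<partial>measure_pmf (law t \<xi>))"
  by (subst P_eq_law[OF assms(1,2)], subst nn_integral_distr) (use assms(3) in auto)

lemma law_cong:
  assumes "0 \<le> t" "\<And>y. f (conf n y) = g (conf n y)"
  shows "measure_pmf.expectation (law t (conf n x)) f = measure_pmf.expectation (law t (conf n x)) g"
proof (intro integral_cong_AE)
  have "f \<zeta> = g \<zeta>" if "\<zeta> \<in> set_pmf (law t (conf n x))" for \<zeta>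
  proof -
    have "finite_config \<zeta>" "num_particles \<zeta> = n" using set_law[OF assms(1), of "conf n x"] that by auto
    then obtain y where "\<zeta> = conf n y" using conf_surj by metis
    thus ?thesis using assms(2) by simp
  qed
  thus "AE \<zeta> in law t (conf n x). f \<zeta> = g \<zeta>" by (simp add: AE_measure_pmf_iff)
qed simp_all

lemma set_law_conf:
  assumes "0 \<le> t" "\<zeta> \<in> set_pmf (law t (conf n x))"
  obtains y where "\<zeta> = conf n y"
proof -
  have "finite_config \<zeta>" "num_particles \<zeta> = n" using set_law[OF assms(1), of "conf n x"] assms(2) by auto
  thus ?thesis using that conf_surj by metis
qed

lemma law_0: "law 0 (conf n x) = return_pmf (conf n x)"
proof (rule pmf_eqI)
  fix \<zeta>
  have "pmf (law 0 (conf n x)) \<zeta> = measure (return borel (conf n x)) {\<zeta>}"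
    using pmf_law[of 0 "conf n x"] initial[OF finite_admissible, of "conf n x"] by simp
  moreover note singleton_config_borel[of \<zeta>]
  ultimately show "pmf (law 0 (conf n x)) \<zeta> = pmf (return_pmf (conf n x)) \<zeta>"
    by (simp add: measure_return indicator_def)
qed

text \<open>
  A function of \<open>n\<close>-particle configurations that vanishes unless all particles lie in the box \<open>B\<close>
  coincides on them with a bounded cylinder function, to which the forward equation applies.
\<close>

lemma forward_equation_box:
  assumes t: "0 \<le> t" and B: "finite B" and H: "\<And>y. \<bar>H (conf n y)\<bar> \<le> C"
    and box: "\<And>y i. i < n \<Longrightarrow> y i \<notin> B \<Longrightarrow> H (conf n y) = 0"
  shows "((\<lambda>s. measure_pmf.expectation (law s (conf n x)) H) has_real_derivative
    measure_pmf.expectation (law t (conf n x)) (sip_generator m H)) (at t within {0..})"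
proof -
  \<comment> \<open>The presence of all \<open>n\<close> particles in \<open>B\<close> is read off
    from the number of particles inside \<open>B\<close>, so \<open>f\<close> looks at no other
    site.\<close>
  define f where "f \<eta> = (if (\<Sum>z\<in>B. \<eta> z) = n then H (\<lambda>z. if z \<in> B then \<eta> z else 0) else 0)" for \<eta>
  have "f \<eta> = f \<zeta>" if "\<forall>x\<in>B. \<eta> x = \<zeta> x" for \<eta> \<zeta>
  proof -
    have "(\<lambda>z. if z \<in> B then \<eta> z else 0) = (\<lambda>z. if z \<in> B then \<zeta> z else 0)" "(\<Sum>z\<in>B. \<eta> z) = (\<Sum>z\<in>B. \<zeta> z)"
      using that by (auto intro: sum.cong)
    thus ?thesis by (simp add: f_def)
  qed
  hence cyl: "cylinder f" unfolding cylinder_def using B by blast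
  have "\<bar>f \<eta>\<bar> \<le> C" for \<eta>
  proof (cases "(\<Sum>z\<in>B. \<eta> z) = n")
    case True
    let ?\<zeta> = "\<lambda>z. if z \<in> B then \<eta> z else 0"
    have sub: "{z. ?\<zeta> z \<noteq> 0} \<subseteq> B" by auto
    have "finite_config ?\<zeta>" unfolding finite_config_def using finite_subset[OF sub B] .
    moreover have "num_particles ?\<zeta> = n"
    proof -
      have "(\<Sum>z | ?\<zeta> z \<noteq> 0. ?\<zeta> z) = (\<Sum>z\<in>B. ?\<zeta> z)" by (rule sum.mono_neutral_left) (use B in auto)
      thus ?thesis unfolding num_particles_def using True by simp
    qed
    ultimately obtain y where "?\<zeta> = conf n y" using conf_surj by metis
    thus ?thesis using True H by (simp add: f_def)
  next
    case False
    thus ?thesis using order.trans[OF abs_ge_zero H] by (simp add: f_def)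
  qed
  hence bd: "bounded (range f)" by (intro boundedI[where B = C]) auto
  have fH: "f (conf n y) = H (conf n y)" for y
  proof (cases "\<forall>i<n. y i \<in> B")
    case True
    have "(\<lambda>z. if z \<in> B then conf n y z else 0) = conf n y"
      using True by (auto simp: conf_def fun_eq_iff)
    moreover have "(\<Sum>z\<in>B. conf n y z) = n"
    proof -
      have "(\<Sum>z | conf n y z \<noteq> 0. conf n y z) = (\<Sum>z\<in>B. conf n y z)"
        using B True by (intro sum.mono_neutral_left) (simp_all only: conf_support, auto simp: conf_def)
      thus ?thesis using num_particles_conf[of n y] by (simp add: num_particles_def)
    qed
    ultimately show ?thesis by (simp add: f_def)
  next
    case False
    then obtain i where i: "i < n" "y i \<notin> B" by blast
    have "(\<Sum>z\<in>B. conf n y z) < n"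
    proof -
      have "(\<Sum>z\<in>B. conf n y z) < (\<Sum>z\<in>insert (y i) B. conf n y z)"
        using i B by (auto simp: conf_def card_gt_0_iff)
      also have "\<dots> \<le> (\<Sum>z\<in>B \<union> {z. conf n y z \<noteq> 0}. conf n y z)"
        using B i by (intro sum_mono2) (auto simp: conf_support conf_def card_gt_0_iff)
      also have "\<dots> = (\<Sum>z | conf n y z \<noteq> 0. conf n y z)"
        using B by (intro sum.mono_neutral_right) (simp_all only: conf_support, auto simp: conf_def)
      also have "\<dots> = n" using num_particles_conf[of n y] by (simp add: num_particles_def)
      finally show ?thesis .
    qed
    moreover have "H (conf n y) = 0" using i by (rule box)
    ultimately show ?thesis by (simp add: f_def)
  qed
  \<comment> \<open>Jumps preserve the number of particles, so the generator at an
    \<open>n\<close>-particle configuration sees only values where \<open>f\<close> and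
    \<open>H\<close> agree.\<close>
  have gen: "sip_generator m f (conf n y) = sip_generator m H (conf n y)" for y
    unfolding sip_generator_conf fH ..
  have "sip_generator m f \<in> borel_measurable borel"
  proof -
    \<comment> \<open>Measurability of the generator is extracted from its integrability under one
      law of the process, here the one started from the empty configuration.\<close>
    have "integrable (P 0 (\<lambda>_. 0)) (sip_generator m f)"
      by (intro generator_integrable finite_admissible cyl bd) (auto simp: finite_config_def)
    hence "sip_generator m f \<in> borel_measurable (P 0 (\<lambda>_. 0))" by (rule borel_measurable_integrable)
    thus ?thesis using measurable_cong_sets[OF sets_P[OF order.refl] refl] by blast
  qed
  hence E_gen: "(\<integral>\<zeta>. sip_generator m f \<zeta> \<partial>P t (conf n x)) =
      measure_pmf.expectation (law t (conf n x)) (sip_generator m H)"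
    using t by (subst integral_P_eq_law) (auto intro: law_cong gen)
  have E_f: "(\<integral>\<zeta>. f \<zeta> \<partial>P s (conf n x)) = measure_pmf.expectation (law s (conf n x)) H" if "0 \<le> s" for s
    using that cylinder_measurable[OF cyl] by (subst integral_P_eq_law) (auto intro: law_cong fH)
  have "((\<lambda>s. \<integral>\<zeta>. f \<zeta> \<partial>P s (conf n x)) has_real_derivative (\<integral>\<zeta>. sip_generator m f \<zeta> \<partial>P t (conf n x)))
      (at t within {0..})"
    using t by (intro generator finite_admissible cyl bd) auto
  thus ?thesis unfolding E_gen
    by (rule has_field_derivative_transform_within[where d = 1]) (use t E_f in auto)
qed

text \<open>The forward equation links the expectation of each iterate of
  \<open>I + L / \<Lambda>\<close> to that of the next. All derivatives in time are thus known and
  bounded, and Taylor's formula at 0 is the exponential series, that is, a Poisson average of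
  iterates.\<close>

lemma law_expectation_box:
  assumes t: "0 < t" and B: "finite B" and H: "\<And>y. \<bar>H (conf n y)\<bar> \<le> C"
    and box: "\<And>y i. i < n \<Longrightarrow> y i \<notin> B \<Longrightarrow> H (conf n y) = 0"
    and \<Lambda>: "0 < \<Lambda>" "real n * (m / 2 + real n) \<le> \<Lambda>"
  shows "measure_pmf.expectation (law t (conf n x)) H = measure_pmf.expectation (poisson_pmf (\<Lambda> * t))
    (\<lambda>k. (step_op (sip_rate m n) n \<Lambda> ^^ k) (\<lambda>y. H (conf n y)) x)"
proof -
  define K where "K G \<zeta> = G \<zeta> + sip_generator m G \<zeta> / \<Lambda>" for G :: "'n config \<Rightarrow> real" and \<zeta>
  have K_conf: "(K ^^ k) H (conf n y) = (step_op (sip_rate m n) n \<Lambda> ^^ k) (\<lambda>y. H (conf n y)) y" for k y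
  proof (induction k arbitrary: y)
    case (Suc k)
    have "(step_op (sip_rate m n) n \<Lambda> ^^ k) (\<lambda>y. H (conf n y)) = (\<lambda>y. (K ^^ k) H (conf n y))"
      using Suc.IH by (intro ext) simp
    thus ?case by (simp add: step_op_sip_rate) (simp add: K_def)
  qed simp
  have K_bound: "\<bar>(K ^^ k) H (conf n y)\<bar> \<le> C" for k y
    unfolding K_conf
    by (rule funpow_step_op_bounded[where M = "m / 2 + real n"])
      (use \<Lambda> H m_pos in \<open>auto intro!: sip_rate_bounds\<close>)
  \<comment> \<open>One step reaches only neighbouring sites, so every iterate still vanishes
    outside a finite, growing box and the forward equation applies to it.\<close>
  have K_box: "\<exists>B'. finite B' \<and> (\<forall>y i. i < n \<longrightarrow> y i \<notin> B' \<longrightarrow> (K ^^ k) H (conf n y) = 0)" for k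
  proof (induction k)
    case 0
    show ?case using B box by auto
  next
    case (Suc k)
    then obtain B' where B': "finite B'" "\<And>y i. i < n \<Longrightarrow> y i \<notin> B' \<Longrightarrow> (K ^^ k) H (conf n y) = 0" by blast
    have "(K ^^ Suc k) H (conf n y) = 0" if i: "i < n" "y i \<notin> B' \<union> (\<Union>z\<in>B'. nbrs z)" for y i
    proof -
      have 0: "(K ^^ k) H (conf n y) = 0" using B'(2)[of i y] i by auto
      have "(K ^^ k) H (conf n (y(j := z))) = 0" if "z \<in> nbrs (y j)" for j z
        using B'(2)[of i "y(j := z)"] i that nbrs_sym by (cases "i = j") auto
      thus ?thesis using 0 by (simp add: K_def sip_generator_conf)
    qed
    thus ?case using B'(1) finite_nbrs by (intro exI[of _ "B' \<union> (\<Union>z\<in>B'. nbrs z)"]) auto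
  qed
  define E where "E k s = measure_pmf.expectation (law s (conf n x)) ((K ^^ k) H)" for k s
  have E_bound: "\<bar>E k s\<bar> \<le> C" if "0 \<le> s" for k s
    unfolding E_def by (rule abs_expectation_pmf_le) (use that K_bound in \<open>auto elim!: set_law_conf\<close>)
  have E_deriv: "(E k has_real_derivative \<Lambda> * (E (Suc k) s - E k s)) (at s within {0..})" if s: "0 \<le> s" for k s
  proof -
    obtain B' where B': "finite B'" "\<And>y i. i < n \<Longrightarrow> y i \<notin> B' \<Longrightarrow> (K ^^ k) H (conf n y) = 0" using K_box by blast
    have int: "integrable (law s (conf n x)) ((K ^^ j) H)" for j
      by (rule integrable_pmf_bounded[where C = C]) (use s K_bound in \<open>auto elim!: set_law_conf\<close>)
    have "measure_pmf.expectation (law s (conf n x)) (sip_generator m ((K ^^ k) H)) =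
        measure_pmf.expectation (law s (conf n x)) (\<lambda>\<zeta>. \<Lambda> * ((K ^^ Suc k) H \<zeta> - (K ^^ k) H \<zeta>))"
      using \<Lambda> by (intro arg_cong[where f = "measure_pmf.expectation _"] ext) (simp add: K_def)
    also have "\<dots> = \<Lambda> * (E (Suc k) s - E k s)"
      unfolding E_def using int[of k] int[of "Suc k"] by (subst integral_mult_right_zero, subst Bochner_Integration.integral_diff) auto
    finally show ?thesis
      using forward_equation_box[of s B' "(K ^^ k) H" n C x, OF s B'(1) K_bound B'(2)]
      unfolding E_def[abs_def] by simp
  qed
  \<comment> \<open>The exponential factor cancels the loss term \<open>- \<Lambda> * E k s\<close>,
    so that differentiation is exactly the passage from \<open>k\<close> to
    \<open>Suc k\<close>.\<close>
  have "((\<lambda>s. exp (\<Lambda> * s) * \<Lambda> ^ k * E k s) has_real_derivative exp (\<Lambda> * s) * \<Lambda> ^ Suc k * E (Suc k) s)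
      (at s within {0..})" if s: "0 \<le> s" for k s
  proof -
    have "((\<lambda>s. exp (\<Lambda> * s) * \<Lambda> ^ k * E k s) has_real_derivative
      exp (\<Lambda> * s) * \<Lambda> * \<Lambda> ^ k * E k s + exp (\<Lambda> * s) * \<Lambda> ^ k * (\<Lambda> * (E (Suc k) s - E k s))) (at s within {0..})"
      by (rule derivative_eq_intros E_deriv[OF s] refl | simp)+
    thus ?thesis by (simp add: algebra_simps)
  qed
  moreover have "\<bar>exp (\<Lambda> * s) * \<Lambda> ^ k * E k s\<bar> \<le> exp (\<Lambda> * t) * C * \<Lambda> ^ k" if "0 \<le> s" "s \<le> t" for k s
  proof -
    have "\<bar>exp (\<Lambda> * s) * \<Lambda> ^ k * E k s\<bar> = (exp (\<Lambda> * s) * \<bar>E k s\<bar>) * \<Lambda> ^ k" using \<Lambda> by (simp add: abs_mult)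
    also have "\<dots> \<le> (exp (\<Lambda> * t) * C) * \<Lambda> ^ k"
      using \<Lambda> that E_bound by (intro mult_right_mono mult_mono) auto
    finally show ?thesis by simp
  qed
  ultimately have "(\<lambda>k. exp (\<Lambda> * 0) * \<Lambda> ^ k * E k 0 * t ^ k / fact k) sums (exp (\<Lambda> * t) * \<Lambda> ^ 0 * E 0 t)"
    using t by (intro taylor_sums_right[where f = "\<lambda>k s. exp (\<Lambda> * s) * \<Lambda> ^ k * E k s"]) auto
  moreover have "E k 0 = (step_op (sip_rate m n) n \<Lambda> ^^ k) (\<lambda>y. H (conf n y)) x" for k
    unfolding E_def by (simp add: law_0 K_conf)
  ultimately have "(\<lambda>k. (step_op (sip_rate m n) n \<Lambda> ^^ k) (\<lambda>y. H (conf n y)) x * (\<Lambda> * t) ^ k / fact k) sums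
      (exp (\<Lambda> * t) * E 0 t)"
    by (simp add: power_mult_distrib mult_ac)
  moreover have "(\<lambda>k. (step_op (sip_rate m n) n \<Lambda> ^^ k) (\<lambda>y. H (conf n y)) x * (\<Lambda> * t) ^ k / fact k) sums
      (exp (\<Lambda> * t) * measure_pmf.expectation (poisson_pmf (\<Lambda> * t))
        (\<lambda>k. (step_op (sip_rate m n) n \<Lambda> ^^ k) (\<lambda>y. H (conf n y)) x))"
    using t \<Lambda> K_bound unfolding K_conf by (intro poisson_expectation_sums) auto
  ultimately have "exp (\<Lambda> * t) * E 0 t = exp (\<Lambda> * t) * measure_pmf.expectation (poisson_pmf (\<Lambda> * t))
        (\<lambda>k. (step_op (sip_rate m n) n \<Lambda> ^^ k) (\<lambda>y. H (conf n y)) x)" by (rule sums_unique2)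
  thus ?thesis by (simp add: E_def)
qed

text \<open>The lattice is exhausted by the finite sets \<open>B N\<close>. Truncation and iteration
  both respect the bound \<open>C\<close>, so dominated convergence removes the box on either
  side.\<close>

lemma law_expectation:
  assumes t: "0 < t" and H: "\<And>y. \<bar>H (conf n y)\<bar> \<le> C"
    and \<Lambda>: "0 < \<Lambda>" "real n * (m / 2 + real n) \<le> \<Lambda>"
  shows "measure_pmf.expectation (law t (conf n x)) H = measure_pmf.expectation (poisson_pmf (\<Lambda> * t))
    (\<lambda>k. (step_op (sip_rate m n) n \<Lambda> ^^ k) (\<lambda>y. H (conf n y)) x)"
proof -
  define B :: "nat \<Rightarrow> (int ^ 'n) set" where "B N = from_nat_into UNIV ` {..<N}" for N
  have B_all: "\<forall>\<^sub>F N in sequentially. z \<in> B N" for z :: "int ^ 'n"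
  proof -
    have "from_nat_into UNIV (to_nat_on UNIV z) = z" by (rule from_nat_into_to_nat_on) auto
    hence "z \<in> B N" if "N > to_nat_on UNIV z" for N unfolding B_def using that by (metis image_eqI lessThan_iff)
    thus ?thesis using eventually_gt_at_top[of "to_nat_on UNIV z"] by (rule eventually_mono[rotated])
  qed
  define G where "G N \<zeta> = (if {z. \<zeta> z \<noteq> 0} \<subseteq> B N then H \<zeta> else 0)" for N \<zeta>
  have G_lim: "(\<lambda>N. G N (conf n y)) \<longlonglongrightarrow> H (conf n y)" for y
  proof (rule tendsto_eventually)
    have "\<forall>\<^sub>F N in sequentially. \<forall>z\<in>y ` {..<n}. z \<in> B N"
      using B_all by (intro eventually_ball_finite) auto
    thus "\<forall>\<^sub>F N in sequentially. G N (conf n y) = H (conf n y)"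
      by eventually_elim (simp only: G_def conf_support, auto)
  qed
  have G_bound: "\<bar>G N (conf n y)\<bar> \<le> C" for N y
    using H[of y] order.trans[OF abs_ge_zero H] by (simp add: G_def)
  have G_box: "G N (conf n y) = 0" if "i < n" "y i \<notin> B N" for N y i
    using that unfolding G_def conf_support by auto
  have l1: "(\<lambda>N. measure_pmf.expectation (law t (conf n x)) (G N)) \<longlonglongrightarrow> measure_pmf.expectation (law t (conf n x)) H"
    by (rule integral_dominated_convergence[where w = "\<lambda>_. C"])
      (use t G_lim G_bound in \<open>auto simp: AE_measure_pmf_iff elim!: set_law_conf[OF less_imp_le[OF t]]\<close>)
  have l2: "(\<lambda>N. measure_pmf.expectation (poisson_pmf (\<Lambda> * t))
        (\<lambda>k. (step_op (sip_rate m n) n \<Lambda> ^^ k) (\<lambda>y. G N (conf n y)) x)) \<longlonglongrightarrow>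
      measure_pmf.expectation (poisson_pmf (\<Lambda> * t)) (\<lambda>k. (step_op (sip_rate m n) n \<Lambda> ^^ k) (\<lambda>y. H (conf n y)) x)"
  proof (rule integral_dominated_convergence[where w = "\<lambda>_. C"])
    have "\<bar>(step_op (sip_rate m n) n \<Lambda> ^^ k) (\<lambda>y. G N (conf n y)) x\<bar> \<le> C" for N k
      by (rule funpow_step_op_bounded[where M = "m / 2 + real n"])
        (use \<Lambda> G_bound m_pos in \<open>auto intro!: sip_rate_bounds\<close>)
    thus "AE k in poisson_pmf (\<Lambda> * t). norm ((step_op (sip_rate m n) n \<Lambda> ^^ k) (\<lambda>y. G N (conf n y)) x) \<le> C" for N
      by simp
  qed (use G_lim in \<open>auto intro!: funpow_step_op_tendsto\<close>)
  have "finite (B N)" for N by (simp add: B_def)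
  hence eq: "measure_pmf.expectation (law t (conf n x)) (G N) = measure_pmf.expectation (poisson_pmf (\<Lambda> * t))
    (\<lambda>k. (step_op (sip_rate m n) n \<Lambda> ^^ k) (\<lambda>y. G N (conf n y)) x)" for N
    by (intro law_expectation_box[where B = "B N" and C = C] t \<Lambda> G_bound G_box)
  from l1[unfolded eq] l2 show ?thesis by (rule LIMSEQ_unique)
qed

end

section \<open>Separation of particles and comparison with independent walks\<close>

lemma integral_bind_pmf_bounded:
  fixes f :: "'a \<Rightarrow> real"
  assumes "\<And>y. \<bar>f y\<bar> \<le> C"
  shows "measure_pmf.expectation (bind_pmf p k) f = measure_pmf.expectation p (\<lambda>x. measure_pmf.expectation (k x) f)"
  unfolding measure_pmf_bind
  by (rule integral_bind[where K = "count_space UNIV" and B = C and B' = 1])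
    (use assms measurable_measure_pmf[of k] in
      \<open>auto simp: measure_pmf.emeasure_space_1 intro: measure_pmf.finite_measure_axioms\<close>)

lemma expectation_add_indicator:
  fixes a c :: real
  shows "measure_pmf.expectation p (\<lambda>k. a + c * indicator A k) = a + c * measure p A"
proof -
  have "integrable p (\<lambda>k. c * indicator A k)"
    by (rule integrable_pmf_bounded[where C = "\<bar>c\<bar>"]) (auto simp: indicator_def)
  hence "measure_pmf.expectation p (\<lambda>k. a + c * indicator A k) = a + measure_pmf.expectation p (\<lambda>k. c * indicator A k)"
    by (subst Bochner_Integration.integral_add) auto
  thus ?thesis by simp
qed

text \<open>A Poisson law of growing mean leaves every finite set, so in the end only the tail of
  \<open>a\<close> is averaged.\<close>

lemma poisson_mixture_tendsto_0:
  fixes a :: "nat \<Rightarrow> real"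
  assumes \<Lambda>: "0 < \<Lambda>" and lim: "a \<longlonglongrightarrow> 0" and bd: "\<And>k. \<bar>a k\<bar> \<le> C"
  shows "((\<lambda>t. measure_pmf.expectation (poisson_pmf (\<Lambda> * t)) a) \<longlongrightarrow> 0) at_top"
proof (rule tendstoI)
  fix \<epsilon> :: real
  assume \<epsilon>: "0 < \<epsilon>"
  have C: "0 \<le> C" using order.trans[OF abs_ge_zero bd] .
  obtain N where N: "\<And>k. N \<le> k \<Longrightarrow> \<bar>a k\<bar> < \<epsilon> / 2"
    using LIMSEQ_D[OF lim, of "\<epsilon> / 2"] \<epsilon> by auto
  have at_top: "filterlim (\<lambda>t. \<Lambda> * t) at_top at_top"
    using \<Lambda> by (intro filterlim_tendsto_pos_mult_at_top[OF tendsto_const] filterlim_ident)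
  have pmf0: "((\<lambda>t. pmf (poisson_pmf (\<Lambda> * t)) k) \<longlongrightarrow> 0) at_top" for k
  proof -
    have lim0: "((\<lambda>t. (\<Lambda> * t) ^ k / exp (\<Lambda> * t) / fact k) \<longlongrightarrow> 0 / fact k) at_top"
      by (intro tendsto_divide tendsto_const filterlim_compose[OF tendsto_power_div_exp_0 at_top]) simp
    have "\<forall>\<^sub>F t in at_top. (\<Lambda> * t) ^ k / exp (\<Lambda> * t) / fact k = pmf (poisson_pmf (\<Lambda> * t)) k"
      using eventually_gt_at_top[of 0] by eventually_elim (use \<Lambda> in \<open>simp add: exp_minus field_simps\<close>)
    from Lim_transform_eventually[OF lim0 this] show ?thesis by simp
  qed
  have "((\<lambda>t. C * (\<Sum>k<N. pmf (poisson_pmf (\<Lambda> * t)) k)) \<longlongrightarrow> C * (\<Sum>k<N. 0)) at_top"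
    by (intro tendsto_intros pmf0)
  hence "\<forall>\<^sub>F t in at_top. C * (\<Sum>k<N. pmf (poisson_pmf (\<Lambda> * t)) k) < \<epsilon> / 2"
    using \<epsilon> by (intro order_tendstoD(2)) auto
  thus "\<forall>\<^sub>F t in at_top. dist (measure_pmf.expectation (poisson_pmf (\<Lambda> * t)) a) 0 < \<epsilon>"
  proof eventually_elim
    case (elim t)
    let ?p = "poisson_pmf (\<Lambda> * t)"
    have "\<bar>measure_pmf.expectation ?p a\<bar> \<le> measure_pmf.expectation ?p (\<lambda>k. \<bar>a k\<bar>)"
      by (rule integral_abs_bound)
    also have "\<dots> \<le> measure_pmf.expectation ?p (\<lambda>k. \<epsilon> / 2 + C * indicator {..<N} k)"
    proof (rule integral_mono)
      show "integrable ?p (\<lambda>k. \<bar>a k\<bar>)" using bd by (intro integrable_pmf_bounded[where C = C]) auto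
      show "integrable ?p (\<lambda>k. \<epsilon> / 2 + C * indicator {..<N} k)"
        by (rule integrable_pmf_bounded[where C = "\<bar>\<epsilon> / 2\<bar> + \<bar>C\<bar>"]) (auto simp: indicator_def)
      show "\<bar>a k\<bar> \<le> \<epsilon> / 2 + C * indicator {..<N} k" for k
        using N[of k] bd[of k] \<epsilon> C by (cases "k < N") auto
    qed
    also have "\<dots> = \<epsilon> / 2 + C * measure ?p {..<N}" by (rule expectation_add_indicator)
    also have "measure ?p {..<N} = (\<Sum>k<N. pmf ?p k)" by (simp add: measure_measure_pmf_finite)
    finally show ?case using elim by simp
  qed
qed

section \<open>Close pairs and separated particles\<close>

lemma finite_l1norm_ball: "finite {v :: int ^ 'n::finite. l1norm v < R}"
proof (rule finite_subset)
  show "{v :: int ^ 'n. l1norm v < R} \<subseteq> vec_lambda ` (PiE UNIV (\<lambda>_. {- R..R}))"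
  proof
    fix v :: "int ^ 'n"
    assume v: "v \<in> {v. l1norm v < R}"
    have "\<bar>v $ i\<bar> \<le> l1norm v" for i
      unfolding l1norm_def by (intro member_le_sum) auto
    hence "\<bar>v $ i\<bar> < R" for i using v by (auto intro: le_less_trans)
    hence "(\<lambda>i. v $ i) \<in> PiE UNIV (\<lambda>_. {- R..R})"
      by (auto simp: abs_less_iff less_imp_le) (metis abs_le_iff less_imp_le minus_le_iff)
    thus "v \<in> vec_lambda ` (PiE UNIV (\<lambda>_. {- R..R}))" by (metis image_eqI vec_lambda_eta)
  qed
qed (intro finite_imageI finite_PiE, auto)

lemma diff_op_sum:
  "diff_op m \<Lambda> (\<lambda>u. \<Sum>w\<in>W. f w u) v = (\<Sum>w\<in>W. diff_op m \<Lambda> (f w) v)"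
proof -
  have "(\<Sum>e\<in>nbrs 0. (m + 2 * of_bool (v + e = 0)) * ((\<Sum>w\<in>W. f w (v + e)) - (\<Sum>w\<in>W. f w v))) =
      (\<Sum>w\<in>W. \<Sum>e\<in>nbrs 0. (m + 2 * of_bool (v + e = 0)) * (f w (v + e) - f w v))"
    by (subst sum.swap) (simp add: sum_subtractf sum_distrib_left flip: sum_subtractf)
  thus ?thesis unfolding diff_op_def by (simp add: sum.distrib sum_divide_distrib)
qed

lemma funpow_diff_op_sum:
  "(diff_op m \<Lambda> ^^ k) (\<lambda>u. \<Sum>w\<in>W. f w u) v = (\<Sum>w\<in>W. (diff_op m \<Lambda> ^^ k) (f w) v)"
proof (induction k arbitrary: v)
  case (Suc k)
  have "(diff_op m \<Lambda> ^^ k) (\<lambda>u. \<Sum>w\<in>W. f w u) = (\<lambda>u. \<Sum>w\<in>W. (diff_op m \<Lambda> ^^ k) (f w) u)"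
    using Suc.IH by (rule ext)
  thus ?case by (simp add: diff_op_sum)
qed simp

definition near :: "int \<Rightarrow> int ^ 'n \<Rightarrow> real" where
  "near R v = of_bool (l1norm v < R)"

lemma funpow_diff_op_near_decay:
  fixes v :: "int ^ 'n::finite"
  assumes "0 < m" "2 * (m + 2) \<le> \<Lambda>"
  shows "(\<lambda>k. (diff_op m \<Lambda> ^^ k) (near R) v) \<longlonglongrightarrow> 0"
proof -
  let ?W = "{w :: int ^ 'n. l1norm w < R}"
  have "near R = (\<lambda>u. \<Sum>w\<in>?W. indicator {w} u)"
    by (auto simp: near_def fun_eq_iff indicator_def finite_l1norm_ball of_bool_def)
  moreover have "(\<lambda>k. \<Sum>w\<in>?W. (diff_op m \<Lambda> ^^ k) (indicator {w}) v) \<longlonglongrightarrow> (\<Sum>w\<in>?W. 0)"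
    by (intro tendsto_sum diff_op_decay assms)
  ultimately show ?thesis by (simp add: funpow_diff_op_sum)
qed

text \<open>The subtracted term removes the pairs formed by a particle with itself.\<close>

definition near_pairs :: "int \<Rightarrow> 'n::finite config \<Rightarrow> real" where
  "near_pairs R \<zeta> = (\<Sum>u | \<zeta> u \<noteq> 0. real (\<zeta> u) * ((\<Sum>v | \<zeta> v \<noteq> 0. real (\<zeta> v) * near R (u - v)) - near R (u - u)))"

lemma near_pairs_conf: "near_pairs R (conf n x) = pair_sum n (near R) x"
proof -
  have "near_pairs R (conf n x) = (\<Sum>i<n. (\<Sum>j<n. near R (x i - x j)) - near R (x i - x i))"
    unfolding near_pairs_def sum_conf by simp
  also have "\<dots> = pair_sum n (near R) x"
    unfolding pair_sum_def by (intro sum.cong refl) (simp add: sum.remove[of "{..<n}"])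
  finally show ?thesis .
qed

lemma pair_sum_near_bounds: "0 \<le> pair_sum n (near R) x" "\<bar>pair_sum n (near R) x\<bar> \<le> real n * real n"
proof -
  show nn: "0 \<le> pair_sum n (near R) x" unfolding pair_sum_def near_def by (intro sum_nonneg) auto
  have "pair_sum n (near R) x \<le> (\<Sum>i<n. \<Sum>j\<in>{..<n} - {i}. 1)"
    unfolding pair_sum_def near_def by (intro sum_mono) auto
  also have "\<dots> \<le> (\<Sum>i<n. real n)" by (intro sum_mono) (auto simp: card_Diff_singleton_if)
  finally show "\<bar>pair_sum n (near R) x\<bar> \<le> real n * real n" using nn by simp
qed

definition separated :: "nat \<Rightarrow> int \<Rightarrow> (nat \<Rightarrow> int ^ 'n) \<Rightarrow> bool" where
  "separated n R x \<longleftrightarrow> (\<forall>i<n. \<forall>j<n. i \<noteq> j \<longrightarrow> R \<le> l1norm (x i - x j))"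

text \<open>The Markov inequality in disguise: the number of close pairs dominates the indicator of
  the configurations that are not separated.\<close>

lemma pair_sum_near_ge_1:
  assumes "\<not> separated n R x"
  shows "1 \<le> pair_sum n (near R) x"
proof -
  obtain i j where ij: "i < n" "j < n" "i \<noteq> j" "l1norm (x i - x j) < R"
    using assms by (auto simp: separated_def not_le)
  have "1 = near R (x i - x j)" using ij by (simp add: near_def)
  also have "\<dots> \<le> (\<Sum>j\<in>{..<n} - {i}. near R (x i - x j))"
    using ij by (intro member_le_sum) (auto simp: near_def)
  also have "\<dots> \<le> pair_sum n (near R) x"
    unfolding pair_sum_def using ij
    by (intro member_le_sum[where f = "\<lambda>i. \<Sum>j\<in>{..<n} - {i}. near R (x i - x j)"]) (auto simp: near_def intro: sum_nonneg)
  finally show ?thesis .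
qed

text \<open>At mutual distance at least 2 no neighbour of a particle is occupied, so the attraction
  part of \<open>sip_rate\<close> vanishes at every possible target.\<close>

lemma step_op_separated:
  assumes "separated n 2 x"
  shows "step_op (sip_rate m n) n \<Lambda> h x = step_op (\<lambda>_ _. m / 2) n \<Lambda> h x"
proof -
  have "conf n x y = 0" if "i < n" "y \<in> nbrs (x i)" for i y
  proof -
    have "x j \<noteq> y" if "j < n" for j
    proof
      assume "x j = y"
      hence "l1norm (x j - x i) = 1" "i \<noteq> j" using \<open>y \<in> nbrs (x i)\<close> by (auto simp: nbrs_def l1norm_def)
      thus False using assms that \<open>i < n\<close> unfolding separated_def by fastforce
    qed
    thus ?thesis by (auto simp: conf_def)
  qed
  hence "(\<Sum>i<n. \<Sum>y\<in>nbrs (x i). sip_rate m n x y * (h (x(i := y)) - h x)) =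
      (\<Sum>i<n. \<Sum>y\<in>nbrs (x i). m / 2 * (h (x(i := y)) - h x))"
    unfolding sip_rate_def by (intro sum.cong refl) auto
  thus ?thesis unfolding step_op_def by simp
qed

lemma separated_update:
  assumes "separated n (R + 1) x" "i < n" "y \<in> nbrs (x i)"
  shows "separated n R (x(i := y))"
proof -
  have y: "l1norm (x i - y) = 1" using assms(3) by (simp add: nbrs_def l1norm_minus_commute)
  have *: "R \<le> l1norm (y - x j)" if "j < n" "j \<noteq> i" for j
  proof -
    have "R + 1 \<le> l1norm (x i - x j)" using assms that unfolding separated_def by auto
    also have "\<dots> \<le> l1norm (x i - y) + l1norm (y - x j)"
      using l1norm_triangle[of "x i - y" "y - x j"] by simp
    finally show ?thesis using y by simp
  qed
  have "R \<le> l1norm (x j - x k)" if "j < n" "k < n" "j \<noteq> k" for j k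
    using assms(1) that unfolding separated_def by fastforce
  thus ?thesis unfolding separated_def using * by (auto simp: l1norm_minus_commute[of "x _" y])
qed

text \<open>Each jump shortens distances by at most 1, so from distance \<open>R + k\<close> the
  particles stay at distance \<open>R\<close> for \<open>k\<close> steps, where both operators agree
  and contract the error.\<close>

lemma funpow_step_op_separated:
  fixes x :: "nat \<Rightarrow> int ^ 'n::finite"
  assumes m: "0 \<le> m" and \<Lambda>: "0 < \<Lambda>" "real n * (m / 2) \<le> \<Lambda>" and R: "2 \<le> R"
    and FG: "\<And>x. separated n R x \<Longrightarrow> \<bar>F x - G x\<bar> \<le> \<epsilon>"
    and x: "separated n (R + int k) x"
  shows "\<bar>(step_op (sip_rate m n) n \<Lambda> ^^ k) F x - (step_op (\<lambda>_ _. m / 2) n \<Lambda> ^^ k) G x\<bar> \<le> \<epsilon>"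
  using x
proof (induction k arbitrary: x)
  case 0
  thus ?case using FG by simp
next
  case (Suc k)
  let ?f = "(step_op (sip_rate m n) n \<Lambda> ^^ k) F" and ?g = "(step_op (\<lambda>_ _. m / 2) n \<Lambda> ^^ k) G"
  have sep: "separated n 2 x" "separated n (R + int k) x"
    using Suc.prems R unfolding separated_def by fastforce+
  have "\<bar>step_op (\<lambda>_ _. m / 2) n \<Lambda> (\<lambda>x. ?f x - ?g x) x\<bar> \<le> \<epsilon>"
  proof (rule step_op_bounded[where M = "m / 2"])
    fix i y assume "i < n" "y \<in> nbrs (x i)"
    hence "separated n (R + int k) (x(i := y))" using Suc.prems by (intro separated_update) (auto simp: algebra_simps)
    thus "\<bar>?f (x(i := y)) - ?g (x(i := y))\<bar> \<le> \<epsilon>" by (rule Suc.IH)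
  qed (use m \<Lambda> Suc.IH[OF sep(2)] in auto)
  thus ?case by (simp add: step_op_separated[OF sep(1)] step_op_diff)
qed

section \<open>Heat flow of independent walkers\<close>

definition nbr_avg :: "(int ^ 'n \<Rightarrow> real) \<Rightarrow> int ^ 'n \<Rightarrow> real" where
  "nbr_avg g z = (\<Sum>y\<in>nbrs z. g y) / (2 * real CARD('n))"

lemma nbr_avg_bounded:
  fixes g :: "int ^ 'n::finite \<Rightarrow> real"
  assumes "\<And>y. \<bar>g y\<bar> \<le> C"
  shows "\<bar>nbr_avg g z\<bar> \<le> C"
proof -
  have "\<bar>\<Sum>y\<in>nbrs z. g y\<bar> \<le> (\<Sum>y\<in>nbrs z. C)" by (intro order.trans[OF sum_abs] sum_mono assms)
  also have "\<dots> = 2 * real CARD('n) * C" by (simp add: card_nbrs)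
  finally show ?thesis by (simp add: nbr_avg_def field_simps)
qed

lemma funpow_nbr_avg_bounded:
  fixes g :: "int ^ 'n::finite \<Rightarrow> real"
  assumes "\<And>y. \<bar>g y\<bar> \<le> C"
  shows "\<bar>(nbr_avg ^^ k) g z\<bar> \<le> C"
  using assms by (induction k arbitrary: z) (auto intro: nbr_avg_bounded)

lemma expectation_ctrw:
  fixes g :: "int ^ 'n::finite \<Rightarrow> real"
  assumes g: "\<And>z. \<bar>g z\<bar> \<le> C"
  shows "measure_pmf.expectation (ctrw r t z) g = measure_pmf.expectation (poisson_pmf (r * t)) (\<lambda>k. (nbr_avg ^^ k) g z)"
proof -
  have step: "measure_pmf.expectation (srw_step y) h = nbr_avg h y" for h :: "int ^ 'n \<Rightarrow> real" and y
  proof -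
    have "nbrs y \<noteq> {}" using card_nbrs[of y] by auto
    thus ?thesis unfolding srw_step_def nbr_avg_def
      by (simp add: integral_pmf_of_set finite_nbrs card_nbrs)
  qed
  have "measure_pmf.expectation (((\<lambda>q. bind_pmf q srw_step) ^^ k) (return_pmf z)) h = (nbr_avg ^^ k) h z"
    if "\<And>z. \<bar>h z\<bar> \<le> C" for k and h :: "int ^ 'n \<Rightarrow> real"
    using that
  proof (induction k arbitrary: h)
    case (Suc k)
    have "measure_pmf.expectation (((\<lambda>q. bind_pmf q srw_step) ^^ Suc k) (return_pmf z)) h =
        measure_pmf.expectation (((\<lambda>q. bind_pmf q srw_step) ^^ k) (return_pmf z)) (nbr_avg h)"
      by (simp add: integral_bind_pmf_bounded[where f = h, OF Suc.prems] step)
    also have "\<dots> = (nbr_avg ^^ k) (nbr_avg h) z" by (intro Suc.IH nbr_avg_bounded Suc.prems)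
    finally show ?case by (simp add: funpow_swap1)
  qed simp
  thus ?thesis unfolding ctrw_def using g by (simp add: integral_bind_pmf_bounded[where f = g, OF g])
qed

text \<open>
  The heat semigroup of the walk with jump rate \<open>r\<close> as a power series; unlike \<open>ctrw\<close>, whose
  Poisson law is only specified for a positive mean, it makes sense at \<open>t = 0\<close> as well.
\<close>

definition heat :: "real \<Rightarrow> (int ^ 'n \<Rightarrow> real) \<Rightarrow> real \<Rightarrow> int ^ 'n \<Rightarrow> real" where
  "heat r g t z = exp (- (r * t)) * (\<Sum>k. (nbr_avg ^^ k) g z * r ^ k / fact k * t ^ k)"

context
  fixes g :: "int ^ 'n::finite \<Rightarrow> real" and C :: real
  assumes g: "\<And>z. \<bar>g z\<bar> \<le> C"
begin

lemma heat_0: "heat r g 0 z = g z"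
  using powser_zero[of "\<lambda>k. (nbr_avg ^^ k) g z * r ^ k / fact k"] by (simp add: heat_def)

lemma heat_eq_ctrw:
  assumes "0 < r" "0 < t"
  shows "heat r g t z = measure_pmf.expectation (ctrw r t z) g"
proof -
  have "(\<lambda>k. (nbr_avg ^^ k) g z * (r * t) ^ k / fact k) sums
      (exp (r * t) * measure_pmf.expectation (poisson_pmf (r * t)) (\<lambda>k. (nbr_avg ^^ k) g z))"
    using assms funpow_nbr_avg_bounded[OF g] by (intro poisson_expectation_sums) auto
  hence "heat r g t z = exp (- (r * t)) * (exp (r * t) * measure_pmf.expectation (ctrw r t z) g)"
    unfolding heat_def expectation_ctrw[OF g] by (simp add: sums_iff power_mult_distrib mult_ac)
  thus ?thesis by (simp add: exp_minus)
qed

lemma heat_bounded: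
  assumes "0 < r" "0 \<le> t"
  shows "\<bar>heat r g t z\<bar> \<le> C"
proof (cases "t = 0")
  case False
  thus ?thesis using assms g by (simp add: heat_eq_ctrw abs_expectation_pmf_le)
qed (simp add: heat_0 g)

private lemma heat_summable: "summable (\<lambda>k. (nbr_avg ^^ (k + j)) g z * r ^ k / fact k * t ^ k)" for r t :: real
proof (rule summable_comparison_test')
  show "summable (\<lambda>k. C * (\<bar>r * t\<bar> ^ k / fact k))"
    using summable_exp[of "\<bar>r * t\<bar>"] by (intro summable_mult) (simp add: field_simps)
  fix k :: nat
  have "norm ((nbr_avg ^^ (k + j)) g z * r ^ k / fact k * t ^ k) = \<bar>(nbr_avg ^^ (k + j)) g z\<bar> * (\<bar>r * t\<bar> ^ k / fact k)"
    by (simp add: abs_mult power_abs power_mult_distrib)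
  also have "\<dots> \<le> C * (\<bar>r * t\<bar> ^ k / fact k)"
    by (intro mult_right_mono funpow_nbr_avg_bounded g) auto
  finally show "norm ((nbr_avg ^^ (k + j)) g z * r ^ k / fact k * t ^ k) \<le> C * (\<bar>r * t\<bar> ^ k / fact k)" .
qed

text \<open>Differentiating the power series term by term shifts its coefficients, which amounts to
  one application of \<open>nbr_avg\<close>; the exponential prefactor contributes the loss
  term.\<close>

lemma heat_deriv:
  "((\<lambda>t. heat r g t z) has_real_derivative r * (nbr_avg (heat r g t) z - heat r g t z)) (at t)"
proof -
  define c where "c z k = (nbr_avg ^^ k) g z * r ^ k / fact k" for z k
  have smb: "summable (\<lambda>k. c z k * t ^ k)" for z t
    using heat_summable[of 0 z r t] by (simp add: c_def)
  have "diffs (c z) k * t ^ k = r * ((\<Sum>y\<in>nbrs z. c y k * t ^ k) / (2 * real CARD('n)))" for k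
    unfolding c_def diffs_def
    by (simp add: nbr_avg_def sum_distrib_left sum_distrib_right sum_divide_distrib, intro sum.cong refl)
      (simp add: field_simps)
  hence "(\<lambda>k. diffs (c z) k * t ^ k) sums (r * ((\<Sum>y\<in>nbrs z. \<Sum>k. c y k * t ^ k) / (2 * real CARD('n))))"
    using smb by (auto intro!: sums_mult sums_divide sums_sum summable_sums)
  hence "(\<Sum>k. diffs (c z) k * t ^ k) = r * ((\<Sum>y\<in>nbrs z. \<Sum>k. c y k * t ^ k) / (2 * real CARD('n)))"
    by (simp add: sums_iff)
  with termdiffs_strong_converges_everywhere[of "c z" t] smb
  have "((\<lambda>t. \<Sum>k. c z k * t ^ k) has_real_derivative r * ((\<Sum>y\<in>nbrs z. \<Sum>k. c y k * t ^ k) / (2 * real CARD('n)))) (at t)"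
    by simp
  hence "((\<lambda>t. exp (- (r * t)) * (\<Sum>k. c z k * t ^ k)) has_real_derivative
      exp (- (r * t)) * (- r) * (\<Sum>k. c z k * t ^ k) +
      (r * ((\<Sum>y\<in>nbrs z. \<Sum>k. c y k * t ^ k) / (2 * real CARD('n)))) * exp (- (r * t))) (at t)"
    by (auto intro!: derivative_eq_intros)
  moreover have "heat r g t z = exp (- (r * t)) * (\<Sum>k. c z k * t ^ k)" for t z by (simp add: heat_def c_def)
  ultimately show ?thesis
    by (simp add: nbr_avg_def algebra_simps flip: sum_distrib_left)
qed

end

lemma step_op_const_mult: "step_op r n \<Lambda> (\<lambda>x. c * h x) x = c * step_op r n \<Lambda> h x"
  unfolding step_op_def by (simp add: algebra_simps sum_distrib_left)

lemma funpow_step_op_const_mult: "(step_op r n \<Lambda> ^^ k) (\<lambda>x. c * h x) x = c * (step_op r n \<Lambda> ^^ k) h x"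
proof (induction k arbitrary: x)
  case (Suc k)
  have "(step_op r n \<Lambda> ^^ k) (\<lambda>x. c * h x) = (\<lambda>x. c * (step_op r n \<Lambda> ^^ k) h x)" using Suc.IH by (rule ext)
  thus ?case by (simp add: step_op_const_mult)
qed simp

lemma step_op_deriv:
  assumes "\<And>x. ((\<lambda>t. h t x) has_real_derivative h' x) (at s)"
  shows "((\<lambda>t. step_op r n \<Lambda> (h t) x) has_real_derivative step_op r n \<Lambda> h' x) (at s)"
  unfolding step_op_def divide_inverse
  by (intro DERIV_add DERIV_cmult_right DERIV_sum DERIV_cmult DERIV_diff assms)

lemma funpow_step_op_deriv:
  assumes "\<And>x. ((\<lambda>t. h t x) has_real_derivative h' x) (at s)"
  shows "((\<lambda>t. (step_op r n \<Lambda> ^^ k) (h t) x) has_real_derivative (step_op r n \<Lambda> ^^ k) h' x) (at s)"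
  using assms by (induction k arbitrary: x) (auto intro: step_op_deriv)

text \<open>By the Leibniz rule a product of one-particle solutions solves the equation of
  \<open>n\<close> independent walkers. Expanding that solution in a Taylor series, as was done for
  the SIP, puts both systems in the same form, with a common Poisson clock.\<close>

lemma prod_heat_eq_poisson:
  fixes g :: "int ^ 'n::finite \<Rightarrow> real"
  assumes g: "\<And>z. \<bar>g z\<bar> \<le> C" and r: "0 < r" and T: "0 < T" and \<Lambda>: "0 < \<Lambda>" "real n * r \<le> \<Lambda>"
  shows "(\<Prod>i<n. heat r g T (x i)) =
    measure_pmf.expectation (poisson_pmf (\<Lambda> * T)) (\<lambda>k. (step_op (\<lambda>_ _. r) n \<Lambda> ^^ k) (\<lambda>x. \<Prod>i<n. g (x i)) x)"
proof -
  let ?S = "step_op (\<lambda>_ _. r) n \<Lambda>"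
  define h where "h t x = (\<Prod>i<n. heat r g t (x i))" for t and x :: "nat \<Rightarrow> int ^ 'n"
  \<comment> \<open>The factor \<open>exp (\<Lambda> * t)\<close> turns
    \<open>\<Lambda> * (?S - I)\<close> into \<open>\<Lambda> * ?S\<close>, so that time derivatives
    of \<open>w\<close> are pure powers of \<open>?S\<close>.\<close>
  define w where "w t x = exp (\<Lambda> * t) * h t x" for t x
  have C: "0 \<le> C" using order.trans[OF abs_ge_zero g] .
  have h_bound: "\<bar>h t x\<bar> \<le> C ^ n" if "0 \<le> t" for t x
  proof -
    have "\<bar>h t x\<bar> = (\<Prod>i<n. \<bar>heat r g t (x i)\<bar>)" unfolding h_def by (rule abs_prod)
    also have "\<dots> \<le> (\<Prod>i<n. C)" using heat_bounded[OF g r that] by (intro prod_mono) auto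
    finally show ?thesis by simp
  qed
  have h_deriv: "((\<lambda>t. h t x) has_real_derivative \<Lambda> * (?S (h t) x - h t x)) (at t)" for t x
  proof -
    have "((\<lambda>t. h t x) has_real_derivative
        (\<Sum>i<n. r * (nbr_avg (heat r g t) (x i) - heat r g t (x i)) * (\<Prod>j\<in>{..<n} - {i}. heat r g t (x j)))) (at t)"
      unfolding h_def by (intro has_field_derivative_prod heat_deriv[OF g])
    also have "(\<Sum>i<n. r * (nbr_avg (heat r g t) (x i) - heat r g t (x i)) * (\<Prod>j\<in>{..<n} - {i}. heat r g t (x j))) =
        (\<Sum>i<n. (\<Sum>y\<in>nbrs (x i). r * (h t (x(i := y)) - h t x)) / (2 * real CARD('n)))"
    proof (intro sum.cong refl)
      fix i assume i: "i \<in> {..<n}"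
      let ?p = "\<Prod>j\<in>{..<n} - {i}. heat r g t (x j)"
      have "(\<Prod>j\<in>{..<n} - {i}. heat r g t ((x(i := y)) j)) = ?p" for y by (intro prod.cong) auto
      hence hy: "h t (x(i := y)) = heat r g t y * ?p" "h t x = heat r g t (x i) * ?p" for y
        using i by (auto simp: h_def prod.remove[of "{..<n}" i])
      have "(\<Sum>y\<in>nbrs (x i). r * (h t (x(i := y)) - h t x)) =
          r * ((\<Sum>y\<in>nbrs (x i). heat r g t y) - (\<Sum>y\<in>nbrs (x i). heat r g t (x i))) * ?p"
        unfolding hy by (simp only: sum_subtractf[symmetric] sum_distrib_left sum_distrib_right left_diff_distrib mult.assoc)
      also have "\<dots> = 2 * real CARD('n) * (r * (nbr_avg (heat r g t) (x i) - heat r g t (x i)) * ?p)"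
        by (simp add: nbr_avg_def card_nbrs field_simps)
      finally show "r * (nbr_avg (heat r g t) (x i) - heat r g t (x i)) * ?p =
          (\<Sum>y\<in>nbrs (x i). r * (h t (x(i := y)) - h t x)) / (2 * real CARD('n))" by simp
    qed
    also have "\<dots> = \<Lambda> * (?S (h t) x - h t x)"
      unfolding step_op_def using \<Lambda> by (simp flip: sum_divide_distrib)
    finally show ?thesis .
  qed
  have w_deriv: "((\<lambda>t. w t x) has_real_derivative \<Lambda> * ?S (w t) x) (at t)" for t x
  proof -
    have "((\<lambda>t. w t x) has_real_derivative exp (\<Lambda> * t) * \<Lambda> * h t x + \<Lambda> * (?S (h t) x - h t x) * exp (\<Lambda> * t)) (at t)"
      unfolding w_def by (auto intro!: derivative_eq_intros h_deriv)
    also have "exp (\<Lambda> * t) * \<Lambda> * h t x + \<Lambda> * (?S (h t) x - h t x) * exp (\<Lambda> * t) = \<Lambda> * ?S (w t) x"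
      unfolding w_def[abs_def] step_op_const_mult by (simp add: algebra_simps)
    finally show ?thesis .
  qed
  have "(\<lambda>k. (\<Lambda> ^ k * (?S ^^ k) (w 0) x) * T ^ k / fact k) sums (\<Lambda> ^ 0 * (?S ^^ 0) (w T) x)"
  proof (rule taylor_sums_right[where f = "\<lambda>k t. \<Lambda> ^ k * (?S ^^ k) (w t) x" and C = "exp (\<Lambda> * T) * C ^ n" and \<Lambda> = \<Lambda>])
    fix k and t :: real
    have "((\<lambda>t. \<Lambda> ^ k * (?S ^^ k) (w t) x) has_real_derivative \<Lambda> ^ k * (?S ^^ k) (\<lambda>x. \<Lambda> * ?S (w t) x) x) (at t)"
      by (intro DERIV_cmult funpow_step_op_deriv w_deriv)
    also have "\<Lambda> ^ k * (?S ^^ k) (\<lambda>x. \<Lambda> * ?S (w t) x) x = \<Lambda> ^ Suc k * (?S ^^ Suc k) (w t) x"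
      unfolding funpow_step_op_const_mult by (simp add: funpow_swap1)
    finally show "((\<lambda>t. \<Lambda> ^ k * (?S ^^ k) (w t) x) has_real_derivative \<Lambda> ^ Suc k * (?S ^^ Suc k) (w t) x) (at t within {0..})"
      by (rule has_field_derivative_at_within)
    assume t: "0 \<le> t" "t \<le> T"
    have "\<bar>w t x\<bar> \<le> exp (\<Lambda> * T) * C ^ n" for x
      unfolding w_def abs_mult using t \<Lambda> h_bound by (intro mult_mono) auto
    hence "\<bar>(?S ^^ k) (w t) x\<bar> \<le> exp (\<Lambda> * T) * C ^ n"
      by (intro funpow_step_op_bounded[where M = r]) (use r \<Lambda> in auto)
    thus "\<bar>\<Lambda> ^ k * (?S ^^ k) (w t) x\<bar> \<le> exp (\<Lambda> * T) * C ^ n * \<Lambda> ^ k"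
      using \<Lambda> by (simp add: abs_mult mult.commute mult_left_mono)
  qed (use T in auto)
  moreover have "w 0 = (\<lambda>x. \<Prod>i<n. g (x i))" by (rule ext) (simp add: w_def h_def heat_0[OF g])
  ultimately have "(\<lambda>k. (?S ^^ k) (\<lambda>x. \<Prod>i<n. g (x i)) x * (\<Lambda> * T) ^ k / fact k) sums (exp (\<Lambda> * T) * h T x)"
    by (simp add: power_mult_distrib mult_ac w_def)
  moreover have "(\<lambda>k. (?S ^^ k) (\<lambda>x. \<Prod>i<n. g (x i)) x * (\<Lambda> * T) ^ k / fact k) sums
      (exp (\<Lambda> * T) * measure_pmf.expectation (poisson_pmf (\<Lambda> * T)) (\<lambda>k. (?S ^^ k) (\<lambda>x. \<Prod>i<n. g (x i)) x))"
  proof (rule poisson_expectation_sums)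
    have "\<bar>\<Prod>i<n. g (x i)\<bar> \<le> C ^ n" for x using h_bound[of 0 x] by (simp add: h_def heat_0[OF g])
    thus "\<bar>(?S ^^ k) (\<lambda>x. \<Prod>i<n. g (x i)) x\<bar> \<le> C ^ n" for k
      by (intro funpow_step_op_bounded[where M = r]) (use r \<Lambda> in auto)
  qed (use \<Lambda> T in simp)
  ultimately have "exp (\<Lambda> * T) * h T x = exp (\<Lambda> * T) *
      measure_pmf.expectation (poisson_pmf (\<Lambda> * T)) (\<lambda>k. (?S ^^ k) (\<lambda>x. \<Prod>i<n. g (x i)) x)" by (rule sums_unique2)
  thus ?thesis by (simp add: h_def)
qed

text \<open>Telescoping: factors are replaced by \<open>\<rho>\<close> one at a time at cost
  \<delta>, the others being bounded by \<open>K\<close>; \<open>1 \<le> K\<close> absorbs a missing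
  power.\<close>

lemma prod_near_power:
  fixes a :: "nat \<Rightarrow> real"
  assumes a: "\<And>i. i < n \<Longrightarrow> \<bar>a i - \<rho>\<bar> \<le> \<delta>" and bd: "\<And>i. i < n \<Longrightarrow> \<bar>a i\<bar> \<le> K" "\<bar>\<rho>\<bar> \<le> K" "1 \<le> K"
  shows "\<bar>(\<Prod>i<n. a i) - \<rho> ^ n\<bar> \<le> real n * K ^ n * \<delta>"
  using a bd(1)
proof (induction n)
  case (Suc n)
  have IH: "\<bar>(\<Prod>i<n. a i) - \<rho> ^ n\<bar> \<le> real n * K ^ n * \<delta>" using Suc by simp
  have \<delta>: "0 \<le> \<delta>" using Suc.prems(1)[of 0] by linarith
  have "(\<Prod>i<Suc n. a i) - \<rho> ^ Suc n = ((\<Prod>i<n. a i) - \<rho> ^ n) * a n + \<rho> ^ n * (a n - \<rho>)"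
    by (simp add: algebra_simps)
  also have "\<bar>\<dots>\<bar> \<le> \<bar>(\<Prod>i<n. a i) - \<rho> ^ n\<bar> * \<bar>a n\<bar> + \<bar>\<rho>\<bar> ^ n * \<bar>a n - \<rho>\<bar>"
    by (simp add: order.trans[OF abs_triangle_ineq] abs_mult power_abs)
  also have "\<dots> \<le> real n * K ^ n * \<delta> * K + K ^ n * K * \<delta>"
  proof (intro add_mono mult_mono IH Suc.prems)
    have "\<bar>\<rho>\<bar> ^ n * 1 \<le> K ^ n * K" using bd by (intro mult_mono power_mono) auto
    thus "\<bar>\<rho>\<bar> ^ n \<le> K ^ n * K" by simp
  qed (use bd \<delta> in auto)
  finally show ?case by (simp add: algebra_simps)
qed simp

section \<open>Long-time limit for finitely many particles\<close>

context sip_process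
begin

text \<open>The first summand bounds the total jump rate of \<open>n\<close> particles; the second
  gives the difference walk its holding probability 1/2. One clock thus serves the process, the
  pairs and the independent walkers.\<close>

definition unif_rate :: "nat \<Rightarrow> real" where
  "unif_rate n = real n * (m / 2 + real n) + 2 * (m + 2)"

lemma unif_rate:
  "0 < unif_rate n" "real n * (m / 2 + real n) \<le> unif_rate n" "2 * (m + 2) \<le> unif_rate n" "real n * (m / 2) \<le> unif_rate n"
proof -
  have "0 \<le> real n * (m / 2 + real n)" "real n * (m / 2) \<le> real n * (m / 2 + real n)"
    using m_pos by (auto simp del: times_divide_eq_right intro!: mult_nonneg_nonneg mult_left_mono)
  thus "0 < unif_rate n" "real n * (m / 2 + real n) \<le> unif_rate n" "2 * (m + 2) \<le> unif_rate n" "real n * (m / 2) \<le> unif_rate n"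
    using m_pos unfolding unif_rate_def distrib_left[of 2 m 2] by linarith+
qed

text \<open>Every pair contributes a null sequence of \<open>diff_op\<close> iterates, and the bound
  \<open>n * n\<close> on the sum lets the Poisson average inherit the limit.\<close>

lemma near_pairs_vanish:
  "((\<lambda>t. measure_pmf.expectation (law t (conf n x)) (near_pairs R)) \<longlongrightarrow> 0) at_top"
proof -
  let ?a = "\<lambda>k. (step_op (sip_rate m n) n (unif_rate n) ^^ k) (pair_sum n (near R)) x"
  have "((\<lambda>t. measure_pmf.expectation (poisson_pmf (unif_rate n * t)) ?a) \<longlongrightarrow> 0) at_top"
  proof (rule poisson_mixture_tendsto_0)
    show "\<bar>?a k\<bar> \<le> real n * real n" for k
      by (rule funpow_step_op_bounded[where M = "m / 2 + real n"])
        (use unif_rate m_pos pair_sum_near_bounds in \<open>auto intro!: sip_rate_bounds\<close>)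
    have "(\<lambda>k. pair_sum n ((diff_op m (unif_rate n) ^^ k) (near R)) x) \<longlonglongrightarrow> (\<Sum>i<n. \<Sum>j\<in>{..<n} - {i}. 0)"
      unfolding pair_sum_def using m_pos unif_rate by (intro tendsto_sum funpow_diff_op_near_decay)
    thus "?a \<longlonglongrightarrow> 0" by (simp add: funpow_step_op_pair_sum)
  qed (rule unif_rate)
  thus ?thesis
  proof (rule Lim_transform_eventually)
    show "\<forall>\<^sub>F t in at_top. measure_pmf.expectation (poisson_pmf (unif_rate n * t)) ?a =
        measure_pmf.expectation (law t (conf n x)) (near_pairs R)"
      using eventually_gt_at_top[of 0]
    proof eventually_elim
      case (elim t)
      show ?case
        using law_expectation[OF elim _ unif_rate(1,2), where H = "near_pairs R" and C = "real n * real n" and n = n and x = x]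
          pair_sum_near_bounds(2)[where ?'a = 'n] by (simp add: near_pairs_conf)
    qed
  qed
qed

lemma law_add:
  assumes "0 \<le> s" "0 \<le> t" "finite_config \<xi>"
  shows "law (s + t) \<xi> = bind_pmf (law s \<xi>) (law t)"
proof (rule pmf_eqI)
  fix \<zeta> :: "'n config"
  have kern: "P t \<in> P s \<xi> \<rightarrow>\<^sub>M subprob_algebra borel"
    using measurable_prob_algebraD[OF kernel[OF assms(2)]] measurable_cong_sets[OF sets_P[OF assms(1)] refl] by blast
  have meas: "(\<lambda>\<eta>. emeasure (P t \<eta>) {\<zeta>}) \<in> borel_measurable borel"
    by (intro measurable_emeasure_kernel[OF measurable_prob_algebraD[OF kernel[OF assms(2)]]] singleton_config_borel)
  have "ennreal (pmf (law (s + t) \<xi>) \<zeta>) = emeasure (P s \<xi> \<bind> P t) {\<zeta>}"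
    using assms markov[OF assms(1,2) finite_admissible] prob_space_P[of "s + t" \<xi>]
    by (simp add: pmf_law finite_measure.emeasure_eq_measure prob_space_def)
  also have "\<dots> = (\<integral>\<^sup>+\<eta>. emeasure (P t \<eta>) {\<zeta>} \<partial>P s \<xi>)"
    by (rule emeasure_bind[OF _ kern singleton_config_borel]) (simp add: prob_space.not_empty[OF prob_space_P[OF assms(1)]])
  also have "\<dots> = (\<integral>\<^sup>+\<eta>. emeasure (P t \<eta>) {\<zeta>} \<partial>law s \<xi>)"
    using meas by (intro nn_integral_P_eq_law assms)
  also have "\<dots> = (\<integral>\<^sup>+\<eta>. ennreal (pmf (law t \<eta>) \<zeta>) \<partial>law s \<xi>)"
  \<comment> \<open>\<open>pmf_law\<close> describes \<open>law t \<eta>\<close> for finite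
    \<open>\<eta>\<close> only, and \<open>law s \<xi>\<close> charges no other
    configurations.\<close>
  proof (intro nn_integral_cong_AE, subst AE_measure_pmf_iff, intro ballI)
    fix \<eta> assume "\<eta> \<in> set_pmf (law s \<xi>)"
    hence "finite_config \<eta>" using set_law[OF assms(1,3)] by auto
    thus "emeasure (P t \<eta>) {\<zeta>} = ennreal (pmf (law t \<eta>) \<zeta>)"
      using assms(2) prob_space_P[OF assms(2), of \<eta>]
      by (simp add: pmf_law finite_measure.emeasure_eq_measure prob_space_def)
  qed
  also have "\<dots> = ennreal (pmf (bind_pmf (law s \<xi>) (law t)) \<zeta>)" by (rule ennreal_pmf_bind[symmetric])
  finally show "pmf (law (s + t) \<xi>) \<zeta> = pmf (bind_pmf (law s \<xi>) (law t)) \<zeta>" by simp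
qed

text \<open>Both expectations are Poisson mixtures with the same clock. With fewer than
  \<open>N\<close> jumps the iterates agree up to \<open>\<epsilon> / 2\<close> once the initial
  distances reach \<open>R + N\<close>; \<open>N\<close> or more jumps within time \<open>T\<close>
  have small probability, uniformly in the starting point.\<close>

lemma law_expectation_separated:
  fixes F :: "'n config \<Rightarrow> real" and g :: "int ^ 'n \<Rightarrow> real"
  assumes F: "\<And>y. \<bar>F (conf n y)\<bar> \<le> C" and g: "\<And>z. \<bar>g z\<bar> \<le> C'"
    and asymp: "\<And>\<epsilon>. 0 < \<epsilon> \<Longrightarrow> \<exists>R. \<forall>y. separated n R y \<longrightarrow> \<bar>F (conf n y) - (\<Prod>i<n. g (y i))\<bar> \<le> \<epsilon>"
    and T: "0 < T" and \<epsilon>: "0 < \<epsilon>"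
  shows "\<exists>R. \<forall>y. separated n R y \<longrightarrow>
    \<bar>measure_pmf.expectation (law T (conf n y)) F - (\<Prod>i<n. heat (m / 2) g T (y i))\<bar> \<le> \<epsilon>"
proof -
  let ?\<Lambda> = "unif_rate n"
  let ?p = "poisson_pmf (?\<Lambda> * T)"
  define a where "a y k = (step_op (sip_rate m n) n ?\<Lambda> ^^ k) (\<lambda>y. F (conf n y)) y" for y k
  define b where "b y k = (step_op (\<lambda>_ _. m / 2) n ?\<Lambda> ^^ k) (\<lambda>y. \<Prod>i<n. g (y i)) y" for y k
  have C': "0 \<le> C'" using order.trans[OF abs_ge_zero g] .
  have a_bd: "\<bar>a y k\<bar> \<le> C" for y k
    unfolding a_def by (rule funpow_step_op_bounded[where M = "m / 2 + real n"])
      (use unif_rate m_pos F in \<open>auto intro!: sip_rate_bounds\<close>)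
  have b_bd: "\<bar>b y k\<bar> \<le> C' ^ n" for y k
    unfolding b_def
  proof (rule funpow_step_op_bounded[where M = "m / 2"])
    show "\<bar>\<Prod>i<n. g (x i)\<bar> \<le> C' ^ n" for x
      using prod_mono[of "{..<n}" "\<lambda>i. \<bar>g (x i)\<bar>" "\<lambda>_. C'"] g by (simp add: abs_prod)
  qed (use unif_rate m_pos in auto)
  have D: "0 \<le> C + C' ^ n" using order.trans[OF abs_ge_zero a_bd] C' by simp
  obtain R0 where R0: "\<And>y. separated n R0 y \<Longrightarrow> \<bar>F (conf n y) - (\<Prod>i<n. g (y i))\<bar> \<le> \<epsilon> / 2"
    using asymp[of "\<epsilon> / 2"] \<epsilon> by auto
  \<comment> \<open>The distance must be at least 2 for the inclusion rates to vanish.\<close>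
  define R where "R = max R0 2"
  have R: "\<And>y. separated n R y \<Longrightarrow> \<bar>F (conf n y) - (\<Prod>i<n. g (y i))\<bar> \<le> \<epsilon> / 2" "2 \<le> R"
    using R0 by (auto simp: R_def separated_def)
  have "(\<lambda>N. (\<Sum>k<N. pmf ?p k)) \<longlonglongrightarrow> 1"
  proof -
    have "(\<lambda>k. 1 * (?\<Lambda> * T) ^ k / fact k) sums (exp (?\<Lambda> * T) * measure_pmf.expectation ?p (\<lambda>_. 1))"
      using T unif_rate by (intro poisson_expectation_sums[where C = 1]) auto
    hence "(\<lambda>k. exp (- (?\<Lambda> * T)) * (1 * (?\<Lambda> * T) ^ k / fact k)) sums
        (exp (- (?\<Lambda> * T)) * (exp (?\<Lambda> * T) * measure_pmf.expectation ?p (\<lambda>_. 1)))" by (rule sums_mult)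
    moreover have "exp (- (?\<Lambda> * T)) * (1 * (?\<Lambda> * T) ^ k / fact k) = pmf ?p k" for k
      using T unif_rate by simp
    ultimately show ?thesis by (simp add: sums_def exp_minus)
  qed
  hence "(\<lambda>N. (C + C' ^ n) * (1 - (\<Sum>k<N. pmf ?p k))) \<longlonglongrightarrow> (C + C' ^ n) * (1 - 1)"
    by (intro tendsto_intros)
  hence "\<forall>\<^sub>F N in sequentially. (C + C' ^ n) * (1 - (\<Sum>k<N. pmf ?p k)) < \<epsilon> / 2"
    using \<epsilon> by (intro order_tendstoD(2)) auto
  then obtain N where N: "(C + C' ^ n) * (1 - (\<Sum>k<N. pmf ?p k)) < \<epsilon> / 2"
    by (auto simp: eventually_at_top_linorder)
  have "\<bar>measure_pmf.expectation (law T (conf n y)) F - (\<Prod>i<n. heat (m / 2) g T (y i))\<bar> \<le> \<epsilon>"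
    if y: "separated n (R + int N) y" for y
  proof -
    have int: "integrable ?p (a y)" "integrable ?p (b y)"
      by (rule integrable_pmf_bounded, rule a_bd, rule integrable_pmf_bounded, rule b_bd)
    have ab: "\<bar>a y k - b y k\<bar> \<le> \<epsilon> / 2 + (C + C' ^ n) * indicator {N..} k" for k
    proof (cases "k < N")
      case True
      have "separated n (R + int k) y" using y True unfolding separated_def by fastforce
      hence "\<bar>a y k - b y k\<bar> \<le> \<epsilon> / 2"
        unfolding a_def b_def using R m_pos unif_rate by (intro funpow_step_op_separated) auto
      thus ?thesis using True by simp
    next
      case False
      thus ?thesis using a_bd[of y k] b_bd[of y k] \<epsilon> by (simp add: indicator_def)
    qed
    have "\<bar>measure_pmf.expectation (law T (conf n y)) F - (\<Prod>i<n. heat (m / 2) g T (y i))\<bar> =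
        \<bar>measure_pmf.expectation ?p (a y) - measure_pmf.expectation ?p (b y)\<bar>"
      using law_expectation[where H = F, OF T F unif_rate(1,2)]
        prod_heat_eq_poisson[of g C' "m / 2" T "unif_rate n" n y, OF g _ T unif_rate(1,4)] m_pos
      by (simp add: a_def[abs_def] b_def[abs_def])
    also have "\<dots> = \<bar>measure_pmf.expectation ?p (\<lambda>k. a y k - b y k)\<bar>" using int by simp
    also have "\<dots> \<le> measure_pmf.expectation ?p (\<lambda>k. \<bar>a y k - b y k\<bar>)" by (rule integral_abs_bound)
    also have "\<dots> \<le> measure_pmf.expectation ?p (\<lambda>k. \<epsilon> / 2 + (C + C' ^ n) * indicator {N..} k)"
    proof (rule integral_mono[OF _ _ ab])
      show "integrable ?p (\<lambda>k. \<epsilon> / 2 + (C + C' ^ n) * indicator {N..} k)"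
        by (rule integrable_pmf_bounded[where C = "\<bar>\<epsilon> / 2\<bar> + \<bar>C + C' ^ n\<bar>"]) (auto simp: indicator_def)
    qed (use int in auto)
    also have "\<dots> = \<epsilon> / 2 + (C + C' ^ n) * measure ?p {N..}" by (rule expectation_add_indicator)
    also have "{N..} = space ?p - {..<N}" by auto
    also have "measure ?p (space ?p - {..<N}) = 1 - (\<Sum>k<N. pmf ?p k)"
      by (subst measure_pmf.prob_compl) (auto simp: measure_measure_pmf_finite)
    finally show ?thesis using N by linarith
  qed
  thus ?thesis by blast
qed

text \<open>
  At time \<open>t\<close> the particles are far apart; during the last \<open>T\<close> units of time they then move
  like independent walkers, and uniform asymptotic homogeneity averages \<open>g\<close> to \<open>\<rho>\<close>.
\<close>

lemma law_expectation_tendsto_power: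
  fixes F :: "'n config \<Rightarrow> real" and g :: "int ^ 'n \<Rightarrow> real"
  assumes F: "\<And>\<zeta>. \<bar>F \<zeta>\<bar> \<le> C" and g: "\<And>z. \<bar>g z\<bar> \<le> C'"
    and asymp: "\<And>\<epsilon>. 0 < \<epsilon> \<Longrightarrow> \<exists>R. \<forall>y. separated n R y \<longrightarrow> \<bar>F (conf n y) - (\<Prod>i<n. g (y i))\<bar> \<le> \<epsilon>"
    and homog: "\<And>\<epsilon>. 0 < \<epsilon> \<Longrightarrow> \<exists>T>0. \<forall>z. \<bar>heat (m / 2) g T z - \<rho>\<bar> \<le> \<epsilon>"
  shows "((\<lambda>t. measure_pmf.expectation (law t (conf n x)) F) \<longlongrightarrow> \<rho> ^ n) at_top"
proof (rule tendstoI)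
  fix \<epsilon> :: real
  assume \<epsilon>: "0 < \<epsilon>"
  define K where "K = max 1 (max C' \<bar>\<rho>\<bar>)"
  have K: "1 \<le> K" "C' \<le> K" "\<bar>\<rho>\<bar> \<le> K" by (auto simp: K_def)
  \<comment> \<open>Chosen so that \<open>prod_near_power\<close> loses at most
    \<open>\<epsilon> / 4\<close>; \<open>Suc n\<close> keeps the divisor positive when
    \<open>n = 0\<close>.\<close>
  define \<delta> where "\<delta> = \<epsilon> / 4 / (real (Suc n) * K ^ n)"
  have \<delta>: "0 < \<delta>" unfolding \<delta>_def using \<epsilon> K by (intro divide_pos_pos mult_pos_pos) auto
  have "real n * K ^ n * \<delta> \<le> real (Suc n) * K ^ n * \<delta>"
    using \<delta> K by (intro mult_right_mono) auto
  also have "\<dots> = \<epsilon> / 4" unfolding \<delta>_def using K by simp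
  finally have n\<delta>: "real n * K ^ n * \<delta> \<le> \<epsilon> / 4" .
  obtain T where T: "0 < T" "\<And>z. \<bar>heat (m / 2) g T z - \<rho>\<bar> \<le> \<delta>" using homog[OF \<delta>] by blast
  obtain R where R: "\<And>y. separated n R y \<Longrightarrow>
      \<bar>measure_pmf.expectation (law T (conf n y)) F - (\<Prod>i<n. heat (m / 2) g T (y i))\<bar> \<le> \<epsilon> / 4"
    using law_expectation_separated[where F = F and C = C and g = g and C' = C' and n = n and T = T and \<epsilon> = "\<epsilon> / 4"]
      F g asymp T(1) \<epsilon> by auto
  define B where "B \<zeta> = measure_pmf.expectation (law T \<zeta>) F" for \<zeta>
  define D where "D = C + \<bar>\<rho> ^ n\<bar>"
  have B_bd: "\<bar>B \<zeta>\<bar> \<le> C" for \<zeta> unfolding B_def by (rule abs_expectation_pmf_le) (rule F)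
  have D: "0 \<le> D" using order.trans[OF abs_ge_zero F] by (simp add: D_def)
  \<comment> \<open>On configurations that are not separated the trivial bound \<open>D\<close> is
    multiplied by the number of close pairs, whose expectation vanishes.\<close>
  have B: "\<bar>B (conf n y) - \<rho> ^ n\<bar> \<le> \<epsilon> / 2 + D * near_pairs R (conf n y)" for y
  proof (cases "separated n R y")
    case True
    have "\<bar>heat (m / 2) g T z\<bar> \<le> K" for z
      using heat_bounded[of g C' "m / 2" T z, OF g] m_pos T(1) K(2) by linarith
    hence "\<bar>(\<Prod>i<n. heat (m / 2) g T (y i)) - \<rho> ^ n\<bar> \<le> real n * K ^ n * \<delta>"
      using T K by (intro prod_near_power) auto
    hence "\<bar>B (conf n y) - \<rho> ^ n\<bar> \<le> \<epsilon> / 2" using R[OF True] n\<delta> unfolding B_def by linarith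
    moreover have "0 \<le> D * near_pairs R (conf n y)"
      using D by (simp add: near_pairs_conf pair_sum_near_bounds(1))
    ultimately show ?thesis by linarith
  next
    case False
    have "\<bar>B (conf n y) - \<rho> ^ n\<bar> \<le> D" using B_bd[of "conf n y"] unfolding D_def by linarith
    also have "D * 1 \<le> D * near_pairs R (conf n y)"
      unfolding near_pairs_conf by (intro mult_left_mono pair_sum_near_ge_1 False D)
    finally show ?thesis using \<epsilon> by simp
  qed
  have "((\<lambda>t. D * measure_pmf.expectation (law t (conf n x)) (near_pairs R)) \<longlongrightarrow> D * 0) at_top"
    by (intro tendsto_intros near_pairs_vanish)
  hence "\<forall>\<^sub>F t in at_top. D * measure_pmf.expectation (law t (conf n x)) (near_pairs R) < \<epsilon> / 2"
    using \<epsilon> by (intro order_tendstoD(2)) auto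
  hence "\<forall>\<^sub>F t in at_top. dist (measure_pmf.expectation (law (t + T) (conf n x)) F) (\<rho> ^ n) < \<epsilon>"
    using eventually_ge_at_top[of 0]
  proof eventually_elim
    case (elim t)
    let ?p = "law t (conf n x)"
    have int: "integrable ?p B" using B_bd by (intro integrable_pmf_bounded)
    have int': "integrable ?p (near_pairs R)"
      by (rule integrable_pmf_bounded[where C = "real n * real n"])
        (auto elim!: set_law_conf[OF elim(2)] simp: near_pairs_conf pair_sum_near_bounds simp del: abs_le_iff
          intro: order.trans[OF abs_ge_self pair_sum_near_bounds(2)])
    have "measure_pmf.expectation (law (t + T) (conf n x)) F = measure_pmf.expectation ?p B"
      using elim T(1) unfolding B_def by (subst law_add) (auto intro!: integral_bind_pmf_bounded F)
    hence "\<bar>measure_pmf.expectation (law (t + T) (conf n x)) F - \<rho> ^ n\<bar> = \<bar>measure_pmf.expectation ?p (\<lambda>\<zeta>. B \<zeta> - \<rho> ^ n)\<bar>"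
      using int by simp
    also have "\<dots> \<le> measure_pmf.expectation ?p (\<lambda>\<zeta>. \<bar>B \<zeta> - \<rho> ^ n\<bar>)" by (rule integral_abs_bound)
    also have "\<dots> \<le> measure_pmf.expectation ?p (\<lambda>\<zeta>. \<epsilon> / 2 + D * near_pairs R \<zeta>)"
      using int int' B by (intro integral_mono_AE) (auto simp: AE_measure_pmf_iff elim!: set_law_conf[OF elim(2)])
    also have "\<dots> = \<epsilon> / 2 + D * measure_pmf.expectation ?p (near_pairs R)" using int' by simp
    finally show ?case using elim by (simp add: dist_real_def)
  qed
  thus "\<forall>\<^sub>F t in at_top. dist (measure_pmf.expectation (law t (conf n x)) F) (\<rho> ^ n) < \<epsilon>"
    unfolding eventually_at_top_linorder by (metis add.commute diff_add_cancel le_diff_eq)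
qed

end

section \<open>From duality moments to weak convergence\<close>

text \<open>Meant for unbounded \<open>f\<close> such as duality functions. Integrability is
  included since the integral of a non-integrable function is 0 by default.\<close>

definition conv_integral :: "('b \<Rightarrow> 'a measure) \<Rightarrow> 'a measure \<Rightarrow> 'b filter \<Rightarrow> ('a \<Rightarrow> real) \<Rightarrow> bool" where
  "conv_integral M N F f \<longleftrightarrow> (\<forall>\<^sub>F t in F. integrable (M t) f) \<and> integrable N f \<and>
     ((\<lambda>t. \<integral>x. f x \<partial>M t) \<longlongrightarrow> (\<integral>x. f x \<partial>N)) F"

lemma conv_integral_add:
  assumes "conv_integral M N F f" "conv_integral M N F g"
  shows "conv_integral M N F (\<lambda>x. f x + g x)"
proof -
  have ev: "\<forall>\<^sub>F t in F. integrable (M t) f \<and> integrable (M t) g"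
    using assms by (auto simp: conv_integral_def eventually_conj_iff)
  have int: "integrable N f" "integrable N g" using assms by (auto simp: conv_integral_def)
  have "((\<lambda>t. (\<integral>x. f x \<partial>M t) + (\<integral>x. g x \<partial>M t)) \<longlongrightarrow> (\<integral>x. f x \<partial>N) + (\<integral>x. g x \<partial>N)) F"
    using assms by (intro tendsto_add) (auto simp: conv_integral_def)
  hence "((\<lambda>t. \<integral>x. f x + g x \<partial>M t) \<longlongrightarrow> (\<integral>x. f x \<partial>N) + (\<integral>x. g x \<partial>N)) F"
    by (rule Lim_transform_eventually) (use ev in eventually_elim, auto)
  thus ?thesis unfolding conv_integral_def using int ev by (auto elim: eventually_mono)
qed

lemma conv_integral_cmult:
  assumes "conv_integral M N F f"
  shows "conv_integral M N F (\<lambda>x. c * f x)"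
  using assms unfolding conv_integral_def by (auto elim!: eventually_mono intro!: tendsto_intros)

lemma conv_integral_sum:
  assumes "\<And>i. i \<in> I \<Longrightarrow> conv_integral M N F (f i)"
  shows "conv_integral M N F (\<lambda>x. \<Sum>i\<in>I. f i x)"
  using assms
proof (induction I rule: infinite_finite_induct)
  case (insert i I)
  thus ?case by (simp add: conv_integral_add)
qed (simp_all add: conv_integral_def)

text \<open>The error bound \<open>r\<close> has converging integrals itself, so its smallness under
  the limit \<open>N\<close> carries over to \<open>M t\<close> for late \<open>t\<close>.\<close>

lemma conv_integral_approx:
  assumes sets: "\<forall>\<^sub>F t in F. sets (M t) = sets N" and g: "g \<in> borel_measurable N"
    and approx: "\<And>\<epsilon>. 0 < \<epsilon> \<Longrightarrow> \<exists>f r. conv_integral M N F f \<and> conv_integral M N F r \<and>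
      (\<forall>x. \<bar>g x - f x\<bar> \<le> r x) \<and> (\<integral>x. r x \<partial>N) < \<epsilon>"
  shows "conv_integral M N F g"
proof -
  have int: "integrable L g" if "integrable L f" "integrable L r" "\<And>x. \<bar>g x - f x\<bar> \<le> r x" "g \<in> borel_measurable L"
    for L f r
  proof (rule Bochner_Integration.integrable_bound)
    show "integrable L (\<lambda>x. \<bar>f x\<bar> + r x)" using that by (intro Bochner_Integration.integrable_add integrable_abs)
    have "\<bar>g x\<bar> \<le> \<bar>\<bar>f x\<bar> + r x\<bar>" for x using that(3)[of x] by linarith
    thus "AE x in L. norm (g x) \<le> norm (\<bar>f x\<bar> + r x)" by simp
  qed fact
  have ev: "\<forall>\<^sub>F t in F. g \<in> borel_measurable (M t)"
    using sets by eventually_elim (use g measurable_cong_sets[OF _ refl] in blast)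
  obtain f r where fr: "conv_integral M N F f" "conv_integral M N F r" "\<And>x. \<bar>g x - f x\<bar> \<le> r x"
    using approx[of 1] by auto
  have ev_int: "\<forall>\<^sub>F t in F. integrable (M t) g"
  proof -
    have "\<forall>\<^sub>F t in F. integrable (M t) f" "\<forall>\<^sub>F t in F. integrable (M t) r" using fr by (auto simp: conv_integral_def)
    thus ?thesis using ev by eventually_elim (rule int[OF _ _ fr(3)])
  qed
  have intN: "integrable N g" using fr g by (intro int[of N f r]) (auto simp: conv_integral_def)
  have bound: "\<bar>(\<integral>x. g x \<partial>L) - (\<integral>x. f x \<partial>L)\<bar> \<le> (\<integral>x. r x \<partial>L)"
    if "integrable L g" "integrable L f" "integrable L r" "\<And>x. \<bar>g x - f x\<bar> \<le> r x" for L f r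
  proof -
    have "\<bar>(\<integral>x. g x \<partial>L) - (\<integral>x. f x \<partial>L)\<bar> = \<bar>\<integral>x. g x - f x \<partial>L\<bar>" using that by simp
    also have "\<dots> \<le> (\<integral>x. \<bar>g x - f x\<bar> \<partial>L)" by (rule integral_abs_bound)
    also have "\<dots> \<le> (\<integral>x. r x \<partial>L)" using that by (intro integral_mono) auto
    finally show ?thesis .
  qed
  have "((\<lambda>t. \<integral>x. g x \<partial>M t) \<longlongrightarrow> (\<integral>x. g x \<partial>N)) F"
  proof (rule tendstoI)
    fix \<epsilon> :: real assume \<epsilon>: "0 < \<epsilon>"
    obtain f r where fr: "conv_integral M N F f" "conv_integral M N F r" "\<And>x. \<bar>g x - f x\<bar> \<le> r x"
      and small: "(\<integral>x. r x \<partial>N) < \<epsilon> / 4"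
      using approx[of "\<epsilon> / 4"] \<epsilon> by auto
    have "\<forall>\<^sub>F t in F. (\<integral>x. r x \<partial>M t) < \<epsilon> / 4"
      using fr(2) by (intro order_tendstoD(2)[OF _ small]) (simp add: conv_integral_def)
    moreover have "\<forall>\<^sub>F t in F. dist (\<integral>x. f x \<partial>M t) (\<integral>x. f x \<partial>N) < \<epsilon> / 4"
      using fr(1) \<epsilon> by (intro tendstoD) (auto simp: conv_integral_def)
    moreover have "\<forall>\<^sub>F t in F. integrable (M t) f" "\<forall>\<^sub>F t in F. integrable (M t) r"
      using fr by (auto simp: conv_integral_def)
    ultimately show "\<forall>\<^sub>F t in F. dist (\<integral>x. g x \<partial>M t) (\<integral>x. g x \<partial>N) < \<epsilon>"
      using ev_int
    proof eventually_elim
      case (elim t)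
      have "\<bar>(\<integral>x. g x \<partial>M t) - (\<integral>x. f x \<partial>M t)\<bar> \<le> (\<integral>x. r x \<partial>M t)"
        using elim fr(3) by (intro bound)
      moreover have "\<bar>(\<integral>x. g x \<partial>N) - (\<integral>x. f x \<partial>N)\<bar> \<le> (\<integral>x. r x \<partial>N)"
        using fr intN by (intro bound) (auto simp: conv_integral_def)
      ultimately show ?case using elim(1,2) small unfolding dist_real_def by linarith
    qed
  qed
  thus ?thesis using ev_int intN by (simp add: conv_integral_def)
qed

section \<open>Exponential bounds\<close>

lemma power_le_exp:
  fixes y c :: real
  assumes "0 \<le> y" "0 < c"
  shows "y ^ j \<le> fact j / c ^ j * exp (c * y)"
proof -
  have s: "(\<lambda>j. (c * y) ^ j / fact j) sums exp (c * y)"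
    using exp_converges[of "c * y"] by (simp add: field_simps)
  have "(\<Sum>i\<in>{j}. (c * y) ^ i / fact i) \<le> (\<Sum>i. (c * y) ^ i / fact i)"
    using s assms by (intro sum_le_suminf) (auto simp: sums_iff)
  hence "(c * y) ^ j / fact j \<le> exp (c * y)" using s by (simp add: sums_iff)
  thus ?thesis using assms by (simp add: power_mult_distrib field_simps)
qed

text \<open>The intermediate point of the Lagrange remainder is negative, so its exponential is at
  most 1 and a pure power of \<open>x\<close> remains. This is what lets moments control the
  remainder.\<close>

lemma exp_minus_taylor:
  fixes x :: real
  assumes "0 \<le> x"
  shows "\<bar>exp (- x) - (\<Sum>j<I. (- x) ^ j / fact j)\<bar> \<le> x ^ I / fact I"
proof (cases "x = 0 \<or> I = 0")
  case True
  thus ?thesis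
  proof (cases "I = 0")
    case False
    with True have "x = 0" by simp
    moreover have "(\<Sum>j<I. (- 0 :: real) ^ j / fact j) = 1"
      using False by (simp add: sum.remove[of "{..<I}" 0] sum.neutral)
    ultimately show ?thesis by simp
  qed (use assms in auto)
next
  case False
  hence "\<exists>t. - x < t \<and> t < 0 \<and> exp (- x) = (\<Sum>j<I. exp 0 / fact j * (- x) ^ j) + exp t / fact I * (- x) ^ I"
    using assms by (intro Maclaurin_minus[where diff = "\<lambda>_. exp"]) (auto intro: DERIV_exp)
  then obtain t where t: "t < 0" "exp (- x) - (\<Sum>j<I. (- x) ^ j / fact j) = exp t / fact I * (- x) ^ I"
    by (auto simp: field_simps)
  have "\<bar>exp t / fact I * (- x) ^ I\<bar> = exp t * (x ^ I / fact I)"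
    using assms by (simp add: abs_mult power_abs)
  also have "\<dots> \<le> 1 * (x ^ I / fact I)" using t(1) assms by (intro mult_right_mono) auto
  finally show ?thesis using t(2) by simp
qed

section \<open>Algebra of the duality functions\<close>

lemma dual1_0 [simp]: "0 < m \<Longrightarrow> dual1 m 0 l = 1"
  using Gamma_real_pos[of "m / 2"] by (simp add: dual1_def less_imp_neq[symmetric])

lemma dual1_nonneg: "0 < m \<Longrightarrow> 0 \<le> dual1 m k l"
  using Gamma_real_pos[of "m / 2"] Gamma_real_pos[of "m / 2 + real k"] by (simp add: dual1_def)

text \<open>Write \<open>l\<close> as \<open>(l - k) + k\<close>: the factor \<open>l - k\<close>
  extends the falling factorial by one, and the functional equation of Gamma supplies
  \<open>m / 2 + k\<close>.\<close>

lemma dual1_mult: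
  assumes "0 < m"
  shows "real l * dual1 m k l = (m / 2 + real k) * dual1 m (Suc k) l + real k * dual1 m k l"
proof (cases "k < l")
  case True
  let ?a = "fact l / fact (l - Suc k) * (Gamma (m / 2) / Gamma (m / 2 + real k))"
  have Gam: "Gamma (m / 2 + real (Suc k)) = (m / 2 + real k) * Gamma (m / 2 + real k)"
  proof -
    have "m / 2 + real k \<notin> \<int>\<^sub>\<le>\<^sub>0" using nonpos_Ints_nonpos[of "m / 2 + real k"] assms by auto
    from Gamma_plus1[OF this] show ?thesis by (simp add: add_ac)
  qed
  have fct: "fact (l - k) = (real l - real k) * (fact (l - Suc k) :: real)"
    using True by (simp add: fact_reduce of_nat_diff)
  have "(m / 2 + real k) * dual1 m (Suc k) l = ?a"
    unfolding dual1_def Gam using True assms by simp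
  moreover have "(real l - real k) * dual1 m k l = ?a"
    unfolding dual1_def fct using True by simp
  ultimately show ?thesis by (simp add: algebra_simps)
qed (auto simp: dual1_def)

lemma dual_eq_prod:
  assumes "0 < m" "finite S" "{x. \<xi> x \<noteq> 0} \<subseteq> S"
  shows "dual m \<xi> \<eta> = (\<Prod>x\<in>S. dual1 m (\<xi> x) (\<eta> x))"
  unfolding dual_def using assms by (intro prod.mono_neutral_left) auto

lemma dual_nonneg: "0 < m \<Longrightarrow> 0 \<le> dual m \<xi> \<eta>"
  unfolding dual_def by (intro prod_nonneg dual1_nonneg)

lemma finite_config_add_delta:
  assumes "finite_config \<xi>"
  shows "finite_config (\<lambda>z. \<xi> z + delta x z)"
  using assms unfolding finite_config_def
  by (rule finite_subset[rotated, of "insert x {z. \<xi> z \<noteq> 0}", OF finite_insert[THEN iffD2]]) (auto simp: delta_def)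

text \<open>The span of the duality functions is closed under multiplication by occupation numbers,
  so convergence of duality moments yields convergence of all polynomial moments.\<close>

lemma dual_mult_occupation:
  assumes m: "0 < m" and \<xi>: "finite_config \<xi>"
  shows "real (\<eta> x) * dual m \<xi> \<eta> =
    (m / 2 + real (\<xi> x)) * dual m (\<lambda>z. \<xi> z + delta x z) \<eta> + real (\<xi> x) * dual m \<xi> \<eta>"
proof -
  let ?S = "insert x {z. \<xi> z \<noteq> 0}"
  have fin: "finite ?S" using \<xi> by (simp add: finite_config_def)
  define p where "p = (\<Prod>z\<in>?S - {x}. dual1 m (\<xi> z) (\<eta> z))"
  have "dual m \<xi> \<eta> = dual1 m (\<xi> x) (\<eta> x) * p"
    unfolding p_def dual_eq_prod[OF m fin subset_insertI] by (rule prod.remove[OF fin]) simp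
  moreover have "dual m (\<lambda>z. \<xi> z + delta x z) \<eta> = dual1 m (Suc (\<xi> x)) (\<eta> x) * p"
  proof -
    have "(\<Prod>z\<in>?S - {x}. dual1 m (\<xi> z + delta x z) (\<eta> z)) = p"
      unfolding p_def by (intro prod.cong) (auto simp: delta_def)
    moreover have "dual m (\<lambda>z. \<xi> z + delta x z) \<eta> = (\<Prod>z\<in>?S. dual1 m (\<xi> z + delta x z) (\<eta> z))"
      by (rule dual_eq_prod[OF m fin]) (auto simp: delta_def)
    ultimately show ?thesis by (subst (asm) prod.remove[OF fin, of x]) (auto simp: delta_def)
  qed
  ultimately show ?thesis using dual1_mult[OF m, of "\<eta> x" "\<xi> x"] by (simp add: algebra_simps flip: mult.assoc)
qed

lemma cylinder_dual: "finite_config \<xi> \<Longrightarrow> cylinder (dual m \<xi>)"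
  unfolding cylinder_def finite_config_def
  by (rule exI[of _ "{x. \<xi> x \<noteq> 0}"]) (auto simp: dual_def intro!: prod.cong)

section \<open>Occupation numbers and the method of moments\<close>

definition occupation :: "(int ^ 'n) set \<Rightarrow> 'n config \<Rightarrow> real" where
  "occupation A \<eta> = (\<Sum>x\<in>A. real (\<eta> x))"

lemma cylinder_occupation: "finite A \<Longrightarrow> cylinder (occupation A)"
  unfolding cylinder_def occupation_def by (rule exI[of _ A]) (auto intro!: sum.cong)

lemma occupation_nonneg [simp]: "0 \<le> occupation A \<eta>"
  by (simp add: occupation_def sum_nonneg)

text \<open>A basic neighbourhood of \<eta> in the product topology constrains finitely many
  coordinates, and agreement with \<eta> there satisfies the constraint.\<close>

lemma eventually_agree_on_finite_set:
  fixes f :: "'n::finite config \<Rightarrow> real" and \<eta> :: "'n config"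
  assumes f: "continuous_on UNIV f" and a: "a < f \<eta>"
  shows "\<exists>A. finite A \<and> (\<forall>\<zeta>. (\<forall>x\<in>A. \<zeta> x = \<eta> x) \<longrightarrow> a < f \<zeta>)"
proof -
  have "open (f -` {a<..})" using f by (intro open_vimage) auto
  hence "openin (product_topology (\<lambda>i. euclidean) UNIV) (f -` {a<..})" by (simp add: open_fun_def)
  from product_topology_open_contains_basis[OF this, of \<eta>] a
  obtain X where X: "\<eta> \<in> PiE UNIV X" "finite {i. X i \<noteq> topspace euclidean}" "PiE UNIV X \<subseteq> f -` {a<..}"
    by auto
  have "a < f \<zeta>" if "\<forall>x\<in>{i. X i \<noteq> UNIV}. \<zeta> x = \<eta> x" for \<zeta>
  proof -
    have "\<zeta> i \<in> X i" for i
    proof (cases "X i = UNIV")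
      case False
      hence "\<zeta> i = \<eta> i" using that by blast
      thus ?thesis using X(1) by (auto simp: PiE_def)
    qed simp
    hence "\<zeta> \<in> PiE UNIV X" by auto
    thus ?thesis using X(3) by auto
  qed
  thus ?thesis using X(2) by (intro exI[of _ "{i. X i \<noteq> UNIV}"]) auto
qed

text \<open>Exponential integrability is required of the limit \<open>N\<close> alone and for a
  single, possibly small, exponent \<open>c\<close>; about \<open>M t\<close> only the duality
  moments are known.\<close>

locale moment_convergence =
  fixes m :: real and M :: "'b \<Rightarrow> 'n::finite config measure" and N :: "'n config measure" and F :: "'b filter" and c :: real
  assumes m: "0 < m" and c: "0 < c"
    and N: "prob_space N" "sets N = sets borel"
    and M: "\<forall>\<^sub>F t in F. prob_space (M t) \<and> sets (M t) = sets borel"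
    and moments: "finite_config \<xi> \<Longrightarrow> conv_integral M N F (dual m \<xi>)"
    and exp_moments: "finite_config \<xi> \<Longrightarrow> finite A \<Longrightarrow>
      integrable N (\<lambda>\<eta>. dual m \<xi> \<eta> * occupation A \<eta> ^ i * exp (c * occupation A \<eta>))"
begin

lemma sets_M: "\<forall>\<^sub>F t in F. sets (M t) = sets N"
  using M by eventually_elim (simp add: N)

lemma cylinder_measurable_N: "cylinder f \<Longrightarrow> f \<in> borel_measurable N"
  using cylinder_measurable measurable_cong_sets[OF N(2) refl] by blast

lemma measurable_dual_N [measurable]: "finite_config \<xi> \<Longrightarrow> dual m \<xi> \<in> borel_measurable N"
  by (intro cylinder_measurable_N cylinder_dual)

lemma measurable_occupation_N [measurable]: "finite A \<Longrightarrow> occupation A \<in> borel_measurable N"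
  by (intro cylinder_measurable_N cylinder_occupation)

lemma conv_dual_occupation:
  assumes "finite_config \<xi>" "finite A"
  shows "conv_integral M N F (\<lambda>\<eta>. dual m \<xi> \<eta> * occupation A \<eta> ^ i)"
  using assms(1)
proof (induction i arbitrary: \<xi>)
  case 0
  thus ?case using moments by simp
next
  case (Suc i)
  \<comment> \<open>One factor of the occupation number is absorbed into the duality function, which
    adds a particle to \<xi>; hence the induction is over all \<xi>.\<close>
  have "conv_integral M N F (\<lambda>\<eta>. \<Sum>x\<in>A. (m / 2 + real (\<xi> x)) * (dual m (\<lambda>z. \<xi> z + delta x z) \<eta> * occupation A \<eta> ^ i) +
      real (\<xi> x) * (dual m \<xi> \<eta> * occupation A \<eta> ^ i))"
    by (intro conv_integral_sum conv_integral_add conv_integral_cmult Suc.IH finite_config_add_delta Suc.prems)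
  also have "(\<lambda>\<eta>. \<Sum>x\<in>A. (m / 2 + real (\<xi> x)) * (dual m (\<lambda>z. \<xi> z + delta x z) \<eta> * occupation A \<eta> ^ i) +
      real (\<xi> x) * (dual m \<xi> \<eta> * occupation A \<eta> ^ i)) = (\<lambda>\<eta>. dual m \<xi> \<eta> * occupation A \<eta> ^ Suc i)"
  proof
    fix \<eta>
    have "(\<Sum>x\<in>A. (m / 2 + real (\<xi> x)) * (dual m (\<lambda>z. \<xi> z + delta x z) \<eta> * occupation A \<eta> ^ i) +
      real (\<xi> x) * (dual m \<xi> \<eta> * occupation A \<eta> ^ i)) =
      (\<Sum>x\<in>A. real (\<eta> x) * dual m \<xi> \<eta> * occupation A \<eta> ^ i)"
      unfolding dual_mult_occupation[OF m Suc.prems] by (simp add: algebra_simps)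
    thus "(\<Sum>x\<in>A. (m / 2 + real (\<xi> x)) * (dual m (\<lambda>z. \<xi> z + delta x z) \<eta> * occupation A \<eta> ^ i) +
      real (\<xi> x) * (dual m \<xi> \<eta> * occupation A \<eta> ^ i)) = dual m \<xi> \<eta> * occupation A \<eta> ^ Suc i"
      by (simp add: occupation_def sum_distrib_left sum_distrib_right mult_ac)
  qed
  finally show ?case .
qed

text \<open>
  Tilting by \<open>exp (- \<theta> N)\<close> in steps of size \<open>c\<close>: each step is a Taylor expansion whose remainder
  is controlled by moments alone, so that large \<open>\<theta>\<close> are reached although the generating function
  need not be analytic in a single disc.
\<close>

lemma conv_tilted:
  assumes "finite_config \<xi>" "finite A"
  shows "conv_integral M N F (\<lambda>\<eta>. dual m \<xi> \<eta> * occupation A \<eta> ^ i * exp (- (real k * c) * occupation A \<eta>))"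
proof (induction k arbitrary: i)
  case 0
  thus ?case using conv_dual_occupation[OF assms] by simp
next
  case (Suc k)
  let ?n = "occupation A" and ?h = "\<lambda>\<eta>. dual m \<xi> \<eta> * occupation A \<eta> ^ i"
  define f where "f I \<eta> = (\<Sum>j<I. ((- c) ^ j / fact j) * (dual m \<xi> \<eta> * ?n \<eta> ^ (i + j) * exp (- (real k * c) * ?n \<eta>)))" for I \<eta>
  define r where "r I \<eta> = (c ^ I / fact I) * (dual m \<xi> \<eta> * ?n \<eta> ^ (i + I))" for I \<eta>
  have r_eq: "r I \<eta> = ?h \<eta> * ((c * ?n \<eta>) ^ I / fact I)" for I \<eta>
    by (simp add: r_def power_add power_mult_distrib)
  have h: "0 \<le> ?h \<eta>" for \<eta> by (intro mult_nonneg_nonneg dual_nonneg m) simp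
  have f: "conv_integral M N F (f I)" for I
    unfolding f_def by (intro conv_integral_sum conv_integral_cmult Suc.IH)
  have r: "conv_integral M N F (r I)" for I
    unfolding r_def by (intro conv_integral_cmult conv_dual_occupation assms)
  have bound: "\<bar>?h \<eta> * exp (- (real (Suc k) * c) * ?n \<eta>) - f I \<eta>\<bar> \<le> r I \<eta>" for I \<eta>
  proof -
    have split: "exp (- (real (Suc k) * c) * ?n \<eta>) = exp (- (real k * c) * ?n \<eta>) * exp (- (c * ?n \<eta>))"
      by (simp add: algebra_simps flip: exp_add)
    have "(- (c * ?n \<eta>)) ^ j = (- c) ^ j * ?n \<eta> ^ j" for j
      by (metis mult_minus_left power_mult_distrib)
    hence "f I \<eta> = ?h \<eta> * exp (- (real k * c) * ?n \<eta>) * (\<Sum>j<I. (- (c * ?n \<eta>)) ^ j / fact j)"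
      unfolding f_def sum_distrib_left by (intro sum.cong refl) (simp only: power_add, simp)
    hence "?h \<eta> * exp (- (real (Suc k) * c) * ?n \<eta>) - f I \<eta> =
        (?h \<eta> * exp (- (real k * c) * ?n \<eta>)) * (exp (- (c * ?n \<eta>)) - (\<Sum>j<I. (- (c * ?n \<eta>)) ^ j / fact j))"
      unfolding split by (simp add: algebra_simps)
    also have "\<bar>\<dots>\<bar> \<le> ?h \<eta> * ((c * ?n \<eta>) ^ I / fact I)"
      unfolding abs_mult
    proof (rule mult_mono)
      have "exp (- (real k * c) * ?n \<eta>) \<le> 1" using c by simp
      thus "\<bar>dual m \<xi> \<eta>\<bar> * \<bar>?n \<eta> ^ i\<bar> * \<bar>exp (- (real k * c) * ?n \<eta>)\<bar> \<le> ?h \<eta>"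
        using h[of \<eta>] dual_nonneg[OF m, of \<xi> \<eta>] by (simp add: mult_left_le)
      show "\<bar>exp (- (c * ?n \<eta>)) - (\<Sum>j<I. (- (c * ?n \<eta>)) ^ j / fact j)\<bar> \<le> (c * ?n \<eta>) ^ I / fact I"
        using c by (intro exp_minus_taylor) simp
    qed (use h in auto)
    finally show ?thesis by (simp add: r_eq)
  qed
  \<comment> \<open>A single term of the exponential series is dominated by the whole series, here
    \<open>exp (c * ?n \<eta>)\<close>. This is why the step size of the tilting equals the exponent
    in \<open>exp_moments\<close>.\<close>
  have "(\<lambda>I. \<integral>\<eta>. r I \<eta> \<partial>N) \<longlonglongrightarrow> (\<integral>\<eta>. 0 \<partial>N)"
  proof (rule integral_dominated_convergence[where w = "\<lambda>\<eta>. ?h \<eta> * exp (c * ?n \<eta>)"])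
    show "integrable N (\<lambda>\<eta>. ?h \<eta> * exp (c * ?n \<eta>))" by (rule exp_moments[OF assms])
    have "(\<lambda>I. r I \<eta>) \<longlonglongrightarrow> 0" for \<eta>
      unfolding r_eq by (intro tendsto_mult_right_zero power_over_fact_tendsto_0)
    thus "AE \<eta> in N. (\<lambda>I. r I \<eta>) \<longlonglongrightarrow> 0" by simp
    have "\<bar>r I \<eta>\<bar> \<le> ?h \<eta> * exp (c * ?n \<eta>)" for I \<eta>
    proof -
      have "(c * ?n \<eta>) ^ I / fact I \<le> exp (c * ?n \<eta>)"
        using power_le_exp[OF occupation_nonneg c, of A \<eta> I] c by (simp add: power_mult_distrib field_simps)
      hence "r I \<eta> \<le> ?h \<eta> * exp (c * ?n \<eta>)" unfolding r_eq by (intro mult_left_mono h)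
      moreover have "0 \<le> r I \<eta>" unfolding r_eq using c by (intro mult_nonneg_nonneg[OF h]) simp
      ultimately show ?thesis by simp
    qed
    thus "AE \<eta> in N. norm (r I \<eta>) \<le> ?h \<eta> * exp (c * ?n \<eta>)" for I by simp
    show "r I \<in> borel_measurable N" for I using r[of I] by (auto simp: conv_integral_def)
  qed simp
  hence small: "\<exists>I. (\<integral>\<eta>. r I \<eta> \<partial>N) < \<epsilon>" if "0 < \<epsilon>" for \<epsilon>
    using order_tendstoD(2)[of "\<lambda>I. \<integral>\<eta>. r I \<eta> \<partial>N" 0 sequentially \<epsilon>] that
    by (auto simp: eventually_at_top_linorder)
  show ?case
  proof (rule conv_integral_approx[OF sets_M])
    show "(\<lambda>\<eta>. ?h \<eta> * exp (- (real (Suc k) * c) * ?n \<eta>)) \<in> borel_measurable N"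
      using assms by measurable
    fix \<epsilon> :: real assume "0 < \<epsilon>"
    then obtain I where "(\<integral>\<eta>. r I \<eta> \<partial>N) < \<epsilon>" using small by blast
    thus "\<exists>f r. conv_integral M N F f \<and> conv_integral M N F r \<and>
      (\<forall>\<eta>. \<bar>?h \<eta> * exp (- (real (Suc k) * c) * ?n \<eta>) - f \<eta>\<bar> \<le> r \<eta>) \<and> (\<integral>\<eta>. r \<eta> \<partial>N) < \<epsilon>"
      using f r bound by blast
  qed
qed

text \<open>As \<open>\<theta> \<rightarrow> \<infinity>\<close>, the tilted duality function \<open>exp (\<theta> |\<kappa>| - \<theta> N) D(\<kappa>, \<cdot>) / D(\<kappa>, \<kappa>)\<close> tends to the indicator.\<close>

lemma conv_indicator:
  assumes A: "finite A" and \<kappa>: "{x. \<kappa> x \<noteq> 0} \<subseteq> A"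
  shows "conv_integral M N F (indicator {\<eta>. \<forall>x\<in>A. \<eta> x = \<kappa> x})"
proof (rule conv_integral_approx[OF sets_M])
  let ?I = "indicator {\<eta>. \<forall>x\<in>A. \<eta> x = \<kappa> x} :: 'n config \<Rightarrow> real"
  let ?n = "occupation A"
  have \<kappa>_fin: "finite_config \<kappa>" unfolding finite_config_def using finite_subset[OF \<kappa> A] .
  have "cylinder ?I" unfolding cylinder_def by (rule exI[of _ A]) (use A in \<open>auto simp: indicator_def\<close>)
  thus "?I \<in> borel_measurable N" by (rule cylinder_measurable_N)
  have dual_A: "dual m \<kappa> \<eta> = (\<Prod>x\<in>A. dual1 m (\<kappa> x) (\<eta> x))" for \<eta> by (rule dual_eq_prod[OF m A \<kappa>])
  have "dual1 m k k > 0" for k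
    using m Gamma_real_pos[of "m / 2"] Gamma_real_pos[of "m / 2 + real k"] by (simp add: dual1_def)
  hence Dpos: "0 < dual m \<kappa> \<kappa>" unfolding dual_def by (intro prod_pos) auto
  define h where "h \<eta> = dual m \<kappa> \<eta> / dual m \<kappa> \<kappa>" for \<eta>
  have h: "0 \<le> h \<eta>" for \<eta> unfolding h_def using dual_nonneg[OF m, of \<kappa> \<eta>] Dpos by simp
  \<comment> \<open>Here \<theta> is \<open>k * c\<close>; the power \<open>^ 0\<close> only matches
    the form of \<open>conv_tilted\<close>.\<close>
  define f where "f k \<eta> = (exp (real k * c * ?n \<kappa>) / dual m \<kappa> \<kappa>) * (dual m \<kappa> \<eta> * ?n \<eta> ^ 0 * exp (- (real k * c) * ?n \<eta>))" for k \<eta>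
  define r where "r k \<eta> = (exp (- (real k * c)) / dual m \<kappa> \<kappa>) * dual m \<kappa> \<eta>" for k \<eta>
  have f: "conv_integral M N F (f k)" for k
    unfolding f_def by (intro conv_integral_cmult conv_tilted \<kappa>_fin A)
  have r: "conv_integral M N F (r k)" for k
    unfolding r_def by (intro conv_integral_cmult moments \<kappa>_fin)
  have f_eq: "f k \<eta> = h \<eta> * exp (- (real k * c) * (?n \<eta> - ?n \<kappa>))" for k \<eta>
    unfolding f_def h_def by (simp add: algebra_simps exp_diff exp_minus divide_simps)
  have bound: "\<bar>?I \<eta> - f k \<eta>\<bar> \<le> r k \<eta>" for k \<eta>
  proof (cases "\<forall>x\<in>A. \<eta> x = \<kappa> x")
    case True
    hence "dual m \<kappa> \<eta> = dual m \<kappa> \<kappa>" unfolding dual_A by (intro prod.cong) auto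
    moreover have "?n \<eta> = ?n \<kappa>" unfolding occupation_def using True by (intro sum.cong) auto
    ultimately have "f k \<eta> = 1" using Dpos by (simp add: f_eq h_def)
    moreover have "0 \<le> r k \<eta>" unfolding r_def using Dpos dual_nonneg[OF m, of \<kappa> \<eta>] by simp
    ultimately show ?thesis using True by simp
  next
    case False
    \<comment> \<open>Where the duality function does not vanish, \<eta> dominates \<kappa> on
      \<open>A\<close>; being different there it has at least one particle more, worth a factor
      \<open>exp (- \<theta>)\<close>.\<close>
    have "h \<eta> * exp (- (real k * c) * (?n \<eta> - ?n \<kappa>)) \<le> h \<eta> * exp (- (real k * c))"
    proof (cases "\<forall>x\<in>A. \<kappa> x \<le> \<eta> x")
      case True
      from False obtain x where x: "x \<in> A" "\<eta> x \<noteq> \<kappa> x" by blast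
      have "(\<Sum>x\<in>A. \<kappa> x) < (\<Sum>x\<in>A. \<eta> x)"
        using A True x by (intro sum_strict_mono_ex1) (auto intro!: bexI[of _ x] simp: order.strict_iff_order)
      hence "?n \<kappa> + 1 \<le> ?n \<eta>" unfolding occupation_def by (simp flip: of_nat_sum)
      hence "real k * c * 1 \<le> real k * c * (?n \<eta> - ?n \<kappa>)" using c by (intro mult_left_mono) auto
      thus ?thesis using h by (intro mult_left_mono) auto
    next
      case False
      then obtain x where "x \<in> A" "\<not> \<kappa> x \<le> \<eta> x" by blast
      hence "dual m \<kappa> \<eta> = 0" unfolding dual_A using A by (auto simp: dual1_def intro!: prod_zero)
      thus ?thesis by (simp add: h_def)
    qed
    moreover have "0 \<le> f k \<eta>" unfolding f_eq using h by simp
    ultimately have "\<bar>f k \<eta>\<bar> \<le> h \<eta> * exp (- (real k * c))" unfolding f_eq by linarith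
    thus ?thesis using False by (simp add: r_def h_def mult.commute)
  qed
  fix \<epsilon> :: real assume \<epsilon>: "0 < \<epsilon>"
  let ?K = "(\<integral>\<eta>. dual m \<kappa> \<eta> \<partial>N) / dual m \<kappa> \<kappa>"
  have "(\<integral>\<eta>. r k \<eta> \<partial>N) = exp (- c) ^ k * ?K" for k
    unfolding r_def using moments[OF \<kappa>_fin] by (simp add: conv_integral_def flip: exp_of_nat_mult)
  moreover have "(\<lambda>k. exp (- c) ^ k * ?K) \<longlonglongrightarrow> 0"
    using c by (intro tendsto_mult_left_zero LIMSEQ_realpow_zero) auto
  ultimately have "\<forall>\<^sub>F k in sequentially. (\<integral>\<eta>. r k \<eta> \<partial>N) < \<epsilon>"
    using \<epsilon> by (intro order_tendstoD(2)[of _ 0]) auto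
  then obtain k where "(\<integral>\<eta>. r k \<eta> \<partial>N) < \<epsilon>" by (auto simp: eventually_at_top_linorder)
  thus "\<exists>f r. conv_integral M N F f \<and> conv_integral M N F r \<and> (\<forall>\<eta>. \<bar>?I \<eta> - f \<eta>\<bar> \<le> r \<eta>) \<and> (\<integral>\<eta>. r \<eta> \<partial>N) < \<epsilon>"
    using f r bound by blast
qed

lemma conv_const: "conv_integral M N F (\<lambda>_. a)"
proof -
  interpret N: prob_space N by (rule N(1))
  have "\<forall>\<^sub>F t in F. a = (\<integral>x. a \<partial>M t)" using M by eventually_elim (simp add: prob_space.prob_space)
  hence "((\<lambda>t. \<integral>x. a \<partial>M t) \<longlongrightarrow> a) F" by (rule Lim_transform_eventually[OF tendsto_const])
  moreover have "\<forall>\<^sub>F t in F. integrable (M t) (\<lambda>_. a)"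
    using M by eventually_elim (simp add: prob_space_def finite_measure.integrable_const)
  ultimately show ?thesis by (simp add: conv_integral_def N.prob_space)
qed

text \<open>Finitely many cylinder sets carry almost all of \<open>N\<close>. The indicator of the
  remainder is 1 minus finitely many indicators, so its integrals converge as well, and it serves as
  the error bound.\<close>

lemma conv_cylinder:
  assumes cyl: "cylinder f" and bd: "\<And>\<eta>. \<bar>f \<eta>\<bar> \<le> C"
  shows "conv_integral M N F f"
proof (rule conv_integral_approx[OF sets_M cylinder_measurable_N[OF cyl]])
  interpret N: prob_space N by (rule N(1))
  fix \<epsilon> :: real assume \<epsilon>: "0 < \<epsilon>"
  obtain A where A: "finite A" and f: "\<And>\<eta> \<zeta>. (\<forall>x\<in>A. \<eta> x = \<zeta> x) \<Longrightarrow> f \<eta> = f \<zeta>"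
    using cyl unfolding cylinder_def by metis
  have C: "0 \<le> C" using order.trans[OF abs_ge_zero bd] .
  \<comment> \<open>Configurations supported in \<open>A\<close> represent the classes of
    configurations agreeing on \<open>A\<close>; there are countably many.\<close>
  define R where "R = {\<kappa> :: 'n config. {x. \<kappa> x \<noteq> 0} \<subseteq> A}"
  have "countable R"
    by (rule countable_subset[OF _ countable_finite_configs]) (auto simp: R_def finite_config_def intro: finite_subset A)
  moreover have "(\<lambda>_. 0) \<in> R" by (auto simp: R_def)
  ultimately have R: "range (from_nat_into R) = R" by (intro range_from_nat_into) auto
  define Z where "Z \<kappa> = {\<eta> :: 'n config. \<forall>x\<in>A. \<eta> x = \<kappa> x}" for \<kappa>
  have cylZ: "cylinder (indicator (Z \<kappa>))" for \<kappa>
    unfolding cylinder_def by (rule exI[of _ A]) (use A in \<open>auto simp: indicator_def Z_def\<close>)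
  have spaceN: "space N = UNIV" using sets_eq_imp_space_eq[OF N(2)] by simp
  have Z_sets: "Z \<kappa> \<in> sets N" for \<kappa>
    using cylinder_measurable_N[OF cylZ[of \<kappa>]] by (simp add: borel_measurable_indicator_iff spaceN)
  have disj: "\<kappa> = \<kappa>'" if "\<kappa> \<in> R" "\<kappa>' \<in> R" "\<eta> \<in> Z \<kappa>" "\<eta> \<in> Z \<kappa>'" for \<kappa> \<kappa>' \<eta>
  proof
    fix x
    have "\<kappa> x = 0" "\<kappa>' x = 0" if "x \<notin> A" using that \<open>\<kappa> \<in> R\<close> \<open>\<kappa>' \<in> R\<close> unfolding R_def by blast+
    thus "\<kappa> x = \<kappa>' x" using that(3,4) by (cases "x \<in> A") (auto simp: Z_def)
  qed
  define S where "S k = from_nat_into R ` {..<k}" for k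
  have S: "finite (S k)" "S k \<subseteq> R" for k unfolding S_def using R by auto
  have sumS: "(\<Sum>\<kappa>\<in>S k. a \<kappa> * indicator (Z \<kappa>) \<eta>) = a \<kappa>0" if "\<kappa>0 \<in> S k" "\<eta> \<in> Z \<kappa>0" for k \<kappa>0 \<eta> and a :: "'n config \<Rightarrow> real"
  proof -
    have "(\<Sum>\<kappa>\<in>S k. a \<kappa> * indicator (Z \<kappa>) \<eta>) = (\<Sum>\<kappa>\<in>S k. if \<kappa> = \<kappa>0 then a \<kappa>0 else 0)"
    proof (intro sum.cong refl)
      fix \<kappa> assume "\<kappa> \<in> S k"
      show "a \<kappa> * indicator (Z \<kappa>) \<eta> = (if \<kappa> = \<kappa>0 then a \<kappa>0 else 0)"
      proof (cases "\<kappa> = \<kappa>0")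
        case False
        hence "\<eta> \<notin> Z \<kappa>" using disj[of \<kappa> \<kappa>0 \<eta>] that S(2)[of k] \<open>\<kappa> \<in> S k\<close> by blast
        thus ?thesis using False by simp
      qed (use that in simp)
    qed
    thus ?thesis using that S by simp
  qed
  have sumS0: "(\<Sum>\<kappa>\<in>S k. a \<kappa> * indicator (Z \<kappa>) \<eta>) = 0" if "\<eta> \<notin> (\<Union>\<kappa>\<in>S k. Z \<kappa>)" for k \<eta> and a :: "'n config \<Rightarrow> real"
    using that by (intro sum.neutral) (auto simp: indicator_def)
  define g where "g k \<eta> = (\<Sum>\<kappa>\<in>S k. f \<kappa> * indicator (Z \<kappa>) \<eta>)" for k \<eta>
  \<comment> \<open>Written with sums and multiples only, so that the closure rules of
    \<open>conv_integral\<close> apply; it is \<open>C\<close> times the indicator of the part not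
    yet covered.\<close>
  define r where "r k \<eta> = C * (1 + (\<Sum>\<kappa>\<in>S k. - 1 * indicator (Z \<kappa>) \<eta>))" for k \<eta>
  have convZ: "conv_integral M N F (indicator (Z \<kappa>))" if "\<kappa> \<in> S k" for k \<kappa>
    unfolding Z_def using S(2)[of k] that by (intro conv_indicator A) (auto simp only: R_def)
  have conv: "conv_integral M N F (g k)" "conv_integral M N F (r k)" for k
    unfolding g_def[abs_def] r_def[abs_def]
    by (intro conv_integral_sum conv_integral_cmult convZ, assumption)
      (intro conv_integral_cmult conv_integral_add conv_const conv_integral_sum convZ, assumption)
  have r_eq: "r k \<eta> = C * (1 - indicator (\<Union>\<kappa>\<in>S k. Z \<kappa>) \<eta>)" for k \<eta>
  proof (cases "\<eta> \<in> (\<Union>\<kappa>\<in>S k. Z \<kappa>)")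
    case True
    then obtain \<kappa>0 where k: "\<kappa>0 \<in> S k" "\<eta> \<in> Z \<kappa>0" by blast
    show ?thesis unfolding r_def sumS[OF k, of "\<lambda>_. - 1"] using True by simp
  next
    case False
    show ?thesis unfolding r_def sumS0[OF False, of "\<lambda>_. - 1"] using False by simp
  qed
  have bound: "\<bar>f \<eta> - g k \<eta>\<bar> \<le> r k \<eta>" for k \<eta>
  proof (cases "\<eta> \<in> (\<Union>\<kappa>\<in>S k. Z \<kappa>)")
    case True
    then obtain \<kappa>0 where k: "\<kappa>0 \<in> S k" "\<eta> \<in> Z \<kappa>0" by blast
    have "f \<eta> = f \<kappa>0" using k(2) by (intro f) (simp add: Z_def)
    thus ?thesis unfolding g_def sumS[OF k] r_eq using True by simp
  next
    case False
    thus ?thesis unfolding g_def sumS0[OF False] r_eq using bd by simp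
  qed
  have "(\<lambda>k. measure N (\<Union>\<kappa>\<in>S k. Z \<kappa>)) \<longlonglongrightarrow> measure N (\<Union>k. \<Union>\<kappa>\<in>S k. Z \<kappa>)"
  proof (rule N.finite_Lim_measure_incseq)
    have "S k \<subseteq> S l" if "k \<le> l" for k l unfolding S_def using that by (intro image_mono) auto
    thus "incseq (\<lambda>k. \<Union>\<kappa>\<in>S k. Z \<kappa>)" unfolding incseq_def by (intro allI impI UN_mono) auto
  qed (use Z_sets S in \<open>auto intro!: sets.finite_UN\<close>)
  also have "(\<Union>k. \<Union>\<kappa>\<in>S k. Z \<kappa>) = space N"
  proof -
    have "\<exists>k. \<exists>\<kappa>\<in>S k. \<eta> \<in> Z \<kappa>" for \<eta>
    proof -
      let ?\<kappa> = "\<lambda>x. if x \<in> A then \<eta> x else 0"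
      have "?\<kappa> \<in> R" by (auto simp: R_def)
      then obtain j where "from_nat_into R j = ?\<kappa>" using R by (metis imageE)
      hence "?\<kappa> \<in> S (Suc j)" unfolding S_def by (metis image_eqI lessI lessThan_iff)
      moreover have "\<eta> \<in> Z ?\<kappa>" by (simp add: Z_def)
      ultimately show ?thesis by blast
    qed
    thus ?thesis by (auto simp: spaceN)
  qed
  finally have "(\<lambda>k. C * (1 - measure N (\<Union>\<kappa>\<in>S k. Z \<kappa>))) \<longlonglongrightarrow> C * (1 - 1)"
    unfolding N.prob_space by (intro tendsto_intros)
  hence "\<forall>\<^sub>F k in sequentially. C * (1 - measure N (\<Union>\<kappa>\<in>S k. Z \<kappa>)) < \<epsilon>"
    using \<epsilon> by (intro order_tendstoD(2)) auto
  then obtain k where "C * (1 - measure N (\<Union>\<kappa>\<in>S k. Z \<kappa>)) < \<epsilon>" by (auto simp: eventually_at_top_linorder)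
  moreover have "(\<integral>\<eta>. r k \<eta> \<partial>N) = C * (1 - measure N (\<Union>\<kappa>\<in>S k. Z \<kappa>))"
  proof -
    have "(\<Union>\<kappa>\<in>S k. Z \<kappa>) \<in> sets N" using S Z_sets by (intro sets.finite_UN) auto
    moreover from this have "integrable N (indicator (\<Union>\<kappa>\<in>S k. Z \<kappa>) :: 'n config \<Rightarrow> real)"
      by (intro N.integrable_const_bound[where B = 1]) auto
    ultimately show ?thesis
      unfolding r_eq using N.prob_space by (simp add: Bochner_Integration.integral_diff spaceN)
  qed
  ultimately show "\<exists>g r. conv_integral M N F g \<and> conv_integral M N F r \<and> (\<forall>\<eta>. \<bar>f \<eta> - g \<eta>\<bar> \<le> r \<eta>) \<and> (\<integral>\<eta>. r \<eta> \<partial>N) < \<epsilon>"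
    using conv bound by (metis (no_types, lifting))
qed

text \<open>The infimum of \<open>f\<close> over configurations agreeing on a finite box is a
  bounded cylinder function below \<open>f\<close>, and continuity makes it converge to
  \<open>f\<close> pointwise. The matching upper bound comes from applying this to
  \<open>- f\<close>.\<close>

lemma liminf_continuous:
  fixes f :: "'n config \<Rightarrow> real"
  assumes f: "continuous_on UNIV f" and bd: "\<And>\<eta>. \<bar>f \<eta>\<bar> \<le> C" and \<epsilon>: "0 < \<epsilon>"
  shows "\<forall>\<^sub>F t in F. (\<integral>\<eta>. f \<eta> \<partial>N) - \<epsilon> < (\<integral>\<eta>. f \<eta> \<partial>M t)"
proof -
  interpret N: prob_space N by (rule N(1))
  define B :: "nat \<Rightarrow> (int ^ 'n) set" where "B k = from_nat_into UNIV ` {..<k}" for k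
  define f' where "f' k \<eta> = (INF \<zeta>\<in>{\<zeta>. \<forall>x\<in>B k. \<zeta> x = \<eta> x}. f \<zeta>)" for k \<eta>
  have bdd: "bdd_below (f ` X)" for X using bd by (intro bdd_belowI2[where m = "- C"]) (simp add: abs_le_iff minus_le_iff)
  have f'_le: "f' k \<eta> \<le> f \<eta>" for k \<eta> unfolding f'_def by (rule cINF_lower[OF bdd]) simp
  have f'_ge: "a \<le> f' k \<eta>" if "\<And>\<zeta>. \<forall>x\<in>B k. \<zeta> x = \<eta> x \<Longrightarrow> a \<le> f \<zeta>" for a k \<eta>
    unfolding f'_def using that by (intro cINF_greatest) auto
  have f'_bd: "\<bar>f' k \<eta>\<bar> \<le> C" for k \<eta>
  proof -
    have "- C \<le> f' k \<eta>" using bd by (intro f'_ge) (simp add: abs_le_iff minus_le_iff)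
    moreover have "f' k \<eta> \<le> C" using f'_le[of k \<eta>] bd[of \<eta>] by linarith
    ultimately show ?thesis by simp
  qed
  have f'_cyl: "cylinder (f' k)" for k
    unfolding cylinder_def
  proof (intro exI[of _ "B k"] conjI allI impI)
    fix \<eta> \<zeta> :: "'n config" assume "\<forall>x\<in>B k. \<eta> x = \<zeta> x"
    hence "{\<theta>. \<forall>x\<in>B k. \<theta> x = \<eta> x} = {\<theta>. \<forall>x\<in>B k. \<theta> x = \<zeta> x}" by auto
    thus "f' k \<eta> = f' k \<zeta>" by (simp add: f'_def)
  qed (simp add: B_def)
  have lim: "(\<lambda>k. f' k \<eta>) \<longlonglongrightarrow> f \<eta>" for \<eta>
  proof (rule order_tendstoI)
    fix a assume "a < f \<eta>"
    then obtain b where b: "a < b" "b < f \<eta>" using dense by blast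
    obtain A where A: "finite A" "\<And>\<zeta>. \<forall>x\<in>A. \<zeta> x = \<eta> x \<Longrightarrow> b < f \<zeta>"
      using eventually_agree_on_finite_set[OF f b(2)] by blast
    have "\<forall>\<^sub>F k in sequentially. A \<subseteq> B k"
    proof -
      have "\<forall>\<^sub>F k in sequentially. \<forall>z\<in>A. z \<in> B k"
      proof (intro eventually_ball_finite A(1) ballI)
        fix z :: "int ^ 'n"
        have "from_nat_into UNIV (to_nat_on UNIV z) = z" by (rule from_nat_into_to_nat_on) auto
        hence "z \<in> B k" if "k > to_nat_on UNIV z" for k unfolding B_def using that by (metis image_eqI lessThan_iff)
        thus "\<forall>\<^sub>F k in sequentially. z \<in> B k"
          using eventually_gt_at_top[of "to_nat_on UNIV z"] by (rule eventually_mono[rotated])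
      qed
      thus ?thesis by (auto elim: eventually_mono)
    qed
    thus "\<forall>\<^sub>F k in sequentially. a < f' k \<eta>"
    proof eventually_elim
      case (elim k)
      have "b \<le> f' k \<eta>" using A(2) elim by (intro f'_ge less_imp_le) blast
      thus ?case using b by simp
    qed
  next
    fix a assume "f \<eta> < a"
    thus "\<forall>\<^sub>F k in sequentially. f' k \<eta> < a" using f'_le by (intro always_eventually) (auto intro: le_less_trans)
  qed
  have fN: "f \<in> borel_measurable N"
    using borel_measurable_continuous_onI[OF f] measurable_cong_sets[OF N(2) refl] by blast
  have "(\<lambda>k. \<integral>\<eta>. f' k \<eta> \<partial>N) \<longlonglongrightarrow> (\<integral>\<eta>. f \<eta> \<partial>N)"
    by (rule integral_dominated_convergence[where w = "\<lambda>_. C"])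
      (use lim f'_bd fN cylinder_measurable_N[OF f'_cyl] in auto)
  hence "\<forall>\<^sub>F k in sequentially. (\<integral>\<eta>. f \<eta> \<partial>N) - \<epsilon> < (\<integral>\<eta>. f' k \<eta> \<partial>N)"
    using \<epsilon> by (intro order_tendstoD(1)) auto
  then obtain k where k: "(\<integral>\<eta>. f \<eta> \<partial>N) - \<epsilon> < (\<integral>\<eta>. f' k \<eta> \<partial>N)" by (auto simp: eventually_at_top_linorder)
  have conv: "conv_integral M N F (f' k)" by (rule conv_cylinder[OF f'_cyl f'_bd])
  have "\<forall>\<^sub>F t in F. (\<integral>\<eta>. f \<eta> \<partial>N) - \<epsilon> < (\<integral>\<eta>. f' k \<eta> \<partial>M t)"
    using conv by (intro order_tendstoD(1)[OF _ k]) (simp add: conv_integral_def)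
  moreover have "\<forall>\<^sub>F t in F. integrable (M t) (f' k)" using conv by (simp add: conv_integral_def)
  ultimately show ?thesis using M
  proof eventually_elim
    case (elim t)
    have "f \<in> borel_measurable (M t)"
      using borel_measurable_continuous_onI[OF f] measurable_cong_sets[of "M t" borel, OF _ refl] elim(3) by blast
    hence "integrable (M t) f"
      using elim(3) bd by (intro finite_measure.integrable_const_bound[where B = C]) (auto simp: prob_space_def)
    hence "(\<integral>\<eta>. f' k \<eta> \<partial>M t) \<le> (\<integral>\<eta>. f \<eta> \<partial>M t)" using elim(2) f'_le by (intro integral_mono)
    thus ?case using elim(1) by simp
  qed
qed

lemma weak_convergence: "weak_convergence M N F"
  unfolding weak_convergence_def
proof (intro allI impI)
  fix f :: "'n config \<Rightarrow> real"
  assume f: "continuous_on UNIV f" and "bounded (range f)"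
  then obtain C where C: "\<And>\<eta>. \<bar>f \<eta>\<bar> \<le> C" by (auto simp: bounded_iff)
  show "((\<lambda>t. \<integral>\<eta>. f \<eta> \<partial>M t) \<longlongrightarrow> (\<integral>\<eta>. f \<eta> \<partial>N)) F"
  proof (rule tendstoI)
    fix \<epsilon> :: real assume \<epsilon>: "0 < \<epsilon>"
    have "\<forall>\<^sub>F t in F. (\<integral>\<eta>. f \<eta> \<partial>N) - \<epsilon> < (\<integral>\<eta>. f \<eta> \<partial>M t)"
      by (rule liminf_continuous[OF f C \<epsilon>])
    moreover have "\<forall>\<^sub>F t in F. (\<integral>\<eta>. - f \<eta> \<partial>N) - \<epsilon> < (\<integral>\<eta>. - f \<eta> \<partial>M t)"
      using C by (intro liminf_continuous[where C = C] \<epsilon> continuous_on_minus f) simp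
    ultimately show "\<forall>\<^sub>F t in F. dist (\<integral>\<eta>. f \<eta> \<partial>M t) (\<integral>\<eta>. f \<eta> \<partial>N) < \<epsilon>"
      by eventually_elim (simp add: dist_real_def abs_less_iff)
  qed
qed

end

section \<open>The limit measure and the convergence theorem\<close>

text \<open>Negative binomial weights with real shape parameter \<open>m / 2\<close>.\<close>

definition sip_weight :: "real \<Rightarrow> real \<Rightarrow> nat \<Rightarrow> real" where
  "sip_weight m l k = (1 - l) powr (m / 2) * (l ^ k / fact k) * (Gamma (m / 2 + real k) / Gamma (m / 2))"

lemma sip_weight_nonneg: "0 < m \<Longrightarrow> 0 \<le> l \<Longrightarrow> l < 1 \<Longrightarrow> 0 \<le> sip_weight m l k"
  unfolding sip_weight_def by (intro mult_nonneg_nonneg divide_nonneg_nonneg) (auto intro: less_imp_le Gamma_real_pos)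

lemma sip_marginal_sets [simp]: "sets (sip_marginal m l) = UNIV" "space (sip_marginal m l) = UNIV"
  by (simp_all add: sip_marginal_def sets_point_measure space_point_measure)

lemma measurable_sip_marginal [simp]: "f \<in> sip_marginal m l \<rightarrow>\<^sub>M X \<longleftrightarrow> f \<in> UNIV \<rightarrow> space X"
  by (simp add: measurable_def)

lemma nn_integral_sip_marginal:
  "(\<integral>\<^sup>+k. f k \<partial>sip_marginal m l) = (\<integral>\<^sup>+k. ennreal (sip_weight m l k) * f k \<partial>count_space UNIV)"
  unfolding sip_marginal_def point_measure_def sip_weight_def by (simp add: nn_integral_density)

lemma nn_integral_sip_weight:
  assumes "0 < m" "0 \<le> l" "l < 1"
  shows "(\<integral>\<^sup>+k. ennreal (sip_weight m l k) \<partial>count_space UNIV) = 1"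
proof -
  interpret prob_space "sip_marginal m l" by (rule prob_space_sip_marginal[OF assms])
  show ?thesis using emeasure_space_1 nn_integral_sip_marginal[where f = "\<lambda>_. 1" and m = m and l = l] by simp
qed

text \<open>Biasing by a falling factorial shifts a negative binomial law by \<open>k\<close> and
  raises its shape to \<open>m / 2 + k\<close>. The shifted weights again sum to 1, which leaves
  \<open>(l / (1 - l)) ^ k\<close> as the moment.\<close>

lemma sip_weight_shift:
  assumes m: "0 < m" and l: "0 \<le> l" "l < 1"
  shows "sip_weight m l (j + k) * dual1 m k (j + k) = (l / (1 - l)) ^ k * sip_weight (m + 2 * real k) l j"
proof -
  have half: "(m + 2 * real k) / 2 = m / 2 + real k" by simp
  have "(1 - l) powr (m / 2 + real k) = (1 - l) powr (m / 2) * (1 - l) ^ k"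
    using l by (simp add: powr_add powr_realpow)
  moreover have "Gamma (m / 2) \<noteq> 0" "Gamma (m / 2 + real k) \<noteq> 0"
    using m Gamma_real_pos[of "m / 2"] Gamma_real_pos[of "m / 2 + real k"] by linarith+
  moreover have "m / 2 + real (j + k) = m / 2 + real k + real j" by simp
  ultimately show ?thesis
    unfolding sip_weight_def dual1_def half using l by (simp add: power_add power_divide add.assoc add.commute[of "real j"])
qed

lemma nn_integral_dual1:
  assumes m: "0 < m" and l: "0 \<le> l" "l < 1"
  shows "(\<integral>\<^sup>+i. ennreal (dual1 m k i) \<partial>sip_marginal m l) = ennreal ((l / (1 - l)) ^ k)"
proof -
  let ?g = "\<lambda>i. ennreal (sip_weight m l i * dual1 m k i)"
  have "(\<integral>\<^sup>+i. ennreal (dual1 m k i) \<partial>sip_marginal m l) = (\<integral>\<^sup>+i. ?g i \<partial>count_space UNIV)"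
    unfolding nn_integral_sip_marginal using sip_weight_nonneg[OF m l] dual1_nonneg[OF m] by (simp add: ennreal_mult)
  also have "\<dots> = (\<integral>\<^sup>+i. ?g i \<partial>count_space {k..})"
    by (rule nn_integral_count_space_eq) (auto simp: dual1_def)
  also have "\<dots> = (\<integral>\<^sup>+j. ?g (j + k) \<partial>count_space UNIV)"
    by (rule nn_integral_bij_count_space[symmetric]) (auto intro!: bij_betw_byWitness[where f' = "\<lambda>i. i - k"])
  also have "\<dots> = (\<integral>\<^sup>+j. ennreal ((l / (1 - l)) ^ k) * ennreal (sip_weight (m + 2 * real k) l j) \<partial>count_space UNIV)"
    using l sip_weight_nonneg[of "m + 2 * real k" l] m by (simp add: sip_weight_shift[OF m l] ennreal_mult)
  also have "\<dots> = ennreal ((l / (1 - l)) ^ k)"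
    using m l nn_integral_sip_weight[of "m + 2 * real k" l] by (simp add: nn_integral_cmult)
  finally show ?thesis .
qed

text \<open>Exponential tilting stays within the family: up to the constant \<open>K\<close> it
  replaces \<open>l\<close> by \<open>l * exp a\<close>.\<close>

lemma nn_integral_exp_sip_marginal:
  assumes m: "0 < m" and l: "0 \<le> l" "l < 1" and a: "l * exp a < 1"
  shows "(\<integral>\<^sup>+k. ennreal (exp (a * real k)) \<partial>sip_marginal m l) < \<infinity>"
proof -
  define K where "K = (1 - l) powr (m / 2) / (1 - l * exp a) powr (m / 2)"
  have K: "0 \<le> K" by (simp add: K_def)
  have "sip_weight m l k * exp (a * real k) = K * sip_weight m (l * exp a) k" for k
    unfolding sip_weight_def K_def using a by (simp add: power_mult_distrib mult.commute[of a] exp_of_nat_mult)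
  hence "ennreal (sip_weight m l k) * ennreal (exp (a * real k)) = ennreal K * ennreal (sip_weight m (l * exp a) k)" for k
    using sip_weight_nonneg[OF m l] K by (simp flip: ennreal_mult')
  hence "(\<integral>\<^sup>+k. ennreal (exp (a * real k)) \<partial>sip_marginal m l) = ennreal K * 1"
    unfolding nn_integral_sip_marginal using m l a by (simp add: nn_integral_cmult nn_integral_sip_weight)
  thus ?thesis by simp
qed

section \<open>The product measure and its moments\<close>

context
  fixes m l :: real
  assumes m: "0 < m" and l: "0 \<le> l" "l < 1"
begin

interpretation marg: product_prob_space "\<lambda>_ :: int ^ 'n::finite. sip_marginal m l" "UNIV :: (int ^ 'n) set"
  by (intro product_prob_space.intro product_sigma_finite.intro product_prob_space_axioms.intro
      prob_space_imp_sigma_finite prob_space_sip_marginal m l)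

lemma prob_space_sip_product: "prob_space (sip_product m l :: 'n::finite config measure)"
  unfolding sip_product_def by (rule marg.P.prob_space_axioms)

lemma sets_sip_product: "sets (sip_product m l :: 'n::finite config measure) = sets borel"
proof -
  have "sets (sip_product m l :: 'n config measure) = sets (Pi\<^sub>M UNIV (\<lambda>_ :: int ^ 'n. borel :: nat measure))"
    unfolding sip_product_def by (intro sets_PiM_cong refl) (simp add: sets_borel_eq_count_space)
  thus ?thesis by (simp add: sets_PiM_equal_borel)
qed

lemma nn_integral_sip_product:
  fixes f :: "int ^ 'n::finite \<Rightarrow> nat \<Rightarrow> ennreal"
  assumes A: "finite A"
  shows "(\<integral>\<^sup>+\<eta>. (\<Prod>x\<in>A. f x (\<eta> x)) \<partial>sip_product m l) = (\<Prod>x\<in>A. \<integral>\<^sup>+k. f x k \<partial>sip_marginal m l)"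
proof -
  have meas: "(\<lambda>\<eta>. \<Prod>x\<in>A. f x (\<eta> x)) \<in> borel_measurable (Pi\<^sub>M A (\<lambda>_. sip_marginal m l))"
    by (intro borel_measurable_prod_ennreal measurable_compose[OF measurable_component_singleton]) auto
  have "(\<Prod>x\<in>A. \<integral>\<^sup>+k. f x k \<partial>sip_marginal m l) = (\<integral>\<^sup>+\<eta>. (\<Prod>x\<in>A. f x (\<eta> x)) \<partial>Pi\<^sub>M A (\<lambda>_. sip_marginal m l))"
    by (rule marg.product_nn_integral_prod[symmetric]) (use A in auto)
  also have "\<dots> = (\<integral>\<^sup>+\<eta>. (\<Prod>x\<in>A. f x (restrict \<eta> A x)) \<partial>sip_product m l)"
    unfolding sip_product_def
    by (subst marg.distr_PiM_restrict_finite[OF A subset_UNIV, symmetric], rule nn_integral_distr)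
      (use meas in \<open>auto intro!: measurable_restrict_subset cong: measurable_cong_sets\<close>)
  also have "\<dots> = (\<integral>\<^sup>+\<eta>. (\<Prod>x\<in>A. f x (\<eta> x)) \<partial>sip_product m l)"
    by (intro nn_integral_cong prod.cong) auto
  finally show ?thesis by simp
qed

lemma cylinder_measurable_sip_product: "cylinder f \<Longrightarrow> f \<in> borel_measurable (sip_product m l :: 'n::finite config measure)"
  using cylinder_measurable measurable_cong_sets[OF sets_sip_product refl] by blast

lemma
  fixes \<xi> :: "'n::finite config"
  assumes \<xi>: "finite_config \<xi>"
  shows integrable_dual_sip_product: "integrable (sip_product m l :: 'n config measure) (dual m \<xi>)"
    and integral_dual_sip_product: "(\<integral>\<eta>. dual m \<xi> \<eta> \<partial>(sip_product m l :: 'n config measure)) = (l / (1 - l)) ^ num_particles \<xi>"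
proof -
  have fin: "finite {x. \<xi> x \<noteq> 0}" using \<xi> by (simp add: finite_config_def)
  have pos: "0 \<le> l / (1 - l)" using l by simp
  have "(\<integral>\<^sup>+\<eta>. ennreal (dual m \<xi> \<eta>) \<partial>(sip_product m l :: 'n config measure)) =
      (\<integral>\<^sup>+\<eta>. (\<Prod>x | \<xi> x \<noteq> 0. ennreal (dual1 m (\<xi> x) (\<eta> x))) \<partial>sip_product m l)"
    unfolding dual_def using dual1_nonneg[OF m] by (simp add: prod_ennreal)
  also have "\<dots> = (\<Prod>x | \<xi> x \<noteq> 0. ennreal ((l / (1 - l)) ^ \<xi> x))"
    by (simp only: nn_integral_sip_product[OF fin, of "\<lambda>x i. ennreal (dual1 m (\<xi> x) i)"] nn_integral_dual1[OF m l])
  also have "\<dots> = ennreal ((l / (1 - l)) ^ num_particles \<xi>)"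
    unfolding num_particles_def power_sum using pos by (intro prod_ennreal zero_le_power)
  finally have eq: "(\<integral>\<^sup>+\<eta>. ennreal (dual m \<xi> \<eta>) \<partial>(sip_product m l :: 'n config measure)) = \<dots>" .
  have meas: "dual m \<xi> \<in> borel_measurable (sip_product m l :: 'n::finite config measure)"
    by (intro cylinder_measurable_sip_product cylinder_dual \<xi>)
  show "integrable (sip_product m l :: 'n config measure) (dual m \<xi>)"
    using meas dual_nonneg[OF m] eq by (intro integrableI_nonneg) auto
  show "(\<integral>\<eta>. dual m \<xi> \<eta> \<partial>(sip_product m l :: 'n config measure)) = (l / (1 - l)) ^ num_particles \<xi>"
    using meas dual_nonneg[OF m] pos by (subst integral_eq_nn_integral) (auto simp: eq)
qed

lemma dual1_le_exp:
  assumes "0 < c"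
  shows "\<exists>B\<ge>0. \<forall>i. dual1 m k i \<le> B * exp (c * real i)"
proof -
  let ?G = "Gamma (m / 2) / Gamma (m / 2 + real k)"
  have G: "0 \<le> ?G" using m by (intro divide_nonneg_nonneg) (auto intro: less_imp_le Gamma_real_pos)
  have "dual1 m k i \<le> ?G * (fact k / c ^ k) * exp (c * real i)" for i
  proof (cases "k \<le> i")
    case True
    have "fact i / fact (i - k) = real (fact i div fact (i - k))"
      by (subst real_of_nat_div) (auto intro: fact_dvd)
    also have "\<dots> \<le> real (i ^ k)" using fact_div_fact_le_pow[OF True] by (simp only: of_nat_le_iff)
    also have "\<dots> \<le> fact k / c ^ k * exp (c * real i)" using power_le_exp[of "real i" c k] assms by simp
    finally have "fact i / fact (i - k) * ?G \<le> fact k / c ^ k * exp (c * real i) * ?G" by (intro mult_right_mono G)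
    thus ?thesis using True by (simp add: dual1_def mult_ac)
  next
    case False
    have "0 \<le> ?G * (fact k / c ^ k) * exp (c * real i)"
      using assms by (intro mult_nonneg_nonneg G) auto
    thus ?thesis using False by (simp add: dual1_def)
  qed
  moreover have "0 \<le> ?G * (fact k / c ^ k)" using assms by (intro mult_nonneg_nonneg G) auto
  ultimately show ?thesis by blast
qed

text \<open>The duality function, the power and the given exponential each cost a factor
  \<open>exp (c * occupation S \<eta>)\<close>; this is the origin of \<open>3 * c\<close>.\<close>

lemma integrable_exp_moment:
  fixes \<xi> :: "'n::finite config"
  assumes c: "0 < c" "l * exp (3 * c) < 1" and \<xi>: "finite_config \<xi>" and A: "finite A"
  shows "integrable (sip_product m l :: 'n config measure)
    (\<lambda>\<eta>. dual m \<xi> \<eta> * occupation A \<eta> ^ i * exp (c * occupation A \<eta>))"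
proof -
  let ?N = "sip_product m l :: 'n config measure"
  define S where "S = A \<union> {x. \<xi> x \<noteq> 0}"
  have S: "finite S" using A \<xi> by (simp add: S_def finite_config_def)
  obtain B where B: "\<And>k. 0 \<le> B k" "\<And>k i. dual1 m k i \<le> B k * exp (c * real i)"
    using dual1_le_exp[OF c(1)] by metis
  have dual_le: "dual m \<xi> \<eta> \<le> (\<Prod>x\<in>S. B (\<xi> x)) * exp (c * occupation S \<eta>)" for \<eta>
  proof -
    have "dual m \<xi> \<eta> = (\<Prod>x\<in>S. dual1 m (\<xi> x) (\<eta> x))"
      by (rule dual_eq_prod[OF m S]) (auto simp: S_def)
    also have "\<dots> \<le> (\<Prod>x\<in>S. B (\<xi> x) * exp (c * real (\<eta> x)))"
      using B dual1_nonneg[OF m] by (intro prod_mono) auto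
    also have "\<dots> = (\<Prod>x\<in>S. B (\<xi> x)) * exp (c * occupation S \<eta>)"
      unfolding occupation_def sum_distrib_left by (simp add: prod.distrib exp_sum[OF S])
    finally show ?thesis .
  qed
  have occ_le: "occupation A \<eta> \<le> occupation S \<eta>" for \<eta> :: "'n config"
    unfolding occupation_def using S by (intro sum_mono2) (auto simp: S_def)
  let ?K = "(\<Prod>x\<in>S. B (\<xi> x)) * (fact i / c ^ i)"
  have K: "0 \<le> (\<Prod>x\<in>S. B (\<xi> x))" by (intro prod_nonneg B)
  have bound: "dual m \<xi> \<eta> * occupation A \<eta> ^ i * exp (c * occupation A \<eta>) \<le> ?K * exp (3 * c * occupation S \<eta>)" for \<eta>
  proof -
    have "dual m \<xi> \<eta> * occupation A \<eta> ^ i * exp (c * occupation A \<eta>) \<le>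
        ((\<Prod>x\<in>S. B (\<xi> x)) * exp (c * occupation S \<eta>)) * (fact i / c ^ i * exp (c * occupation S \<eta>)) * exp (c * occupation S \<eta>)"
    proof (intro mult_mono dual_le)
      have "occupation A \<eta> ^ i \<le> fact i / c ^ i * exp (c * occupation A \<eta>)"
        by (rule power_le_exp[OF occupation_nonneg c(1)])
      also have "\<dots> \<le> fact i / c ^ i * exp (c * occupation S \<eta>)" using c(1) occ_le[of \<eta>] by (intro mult_left_mono) auto
      finally show "occupation A \<eta> ^ i \<le> fact i / c ^ i * exp (c * occupation S \<eta>)" .
    qed (use c occ_le[of \<eta>] K dual_nonneg[OF m, of \<xi> \<eta>] in auto)
    also have "\<dots> = ?K * (exp (c * occupation S \<eta>) * exp (c * occupation S \<eta>) * exp (c * occupation S \<eta>))" by simp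
    also have "exp (c * occupation S \<eta>) * exp (c * occupation S \<eta>) * exp (c * occupation S \<eta>) = exp (3 * c * occupation S \<eta>)"
      unfolding exp_add[symmetric] by (rule arg_cong[where f = exp]) simp
    finally show ?thesis .
  qed
  have meas: "(\<lambda>\<eta>. dual m \<xi> \<eta> * occupation A \<eta> ^ i * exp (c * occupation A \<eta>)) \<in> borel_measurable ?N"
    "(\<lambda>\<eta>. exp (3 * c * occupation S \<eta>)) \<in> borel_measurable ?N"
    using cylinder_measurable_sip_product[OF cylinder_dual[OF \<xi>, of m]]
      cylinder_measurable_sip_product[OF cylinder_occupation[OF A]]
      cylinder_measurable_sip_product[OF cylinder_occupation[OF S]] by measurable
  have "integrable ?N (\<lambda>\<eta>. exp (3 * c * occupation S \<eta>))"
  proof (rule integrableI_nonneg)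
    have "(\<integral>\<^sup>+\<eta>. ennreal (exp (3 * c * occupation S \<eta>)) \<partial>?N) = (\<integral>\<^sup>+\<eta>. (\<Prod>x\<in>S. ennreal (exp (3 * c * real (\<eta> x)))) \<partial>?N)"
      unfolding occupation_def sum_distrib_left by (simp add: exp_sum[OF S] prod_ennreal)
    also have "\<dots> = (\<Prod>x\<in>S. \<integral>\<^sup>+k. ennreal (exp (3 * c * real k)) \<partial>sip_marginal m l)"
      by (rule nn_integral_sip_product[OF S, of "\<lambda>_ k. ennreal (exp (3 * c * real k))"])
    also have "\<dots> < \<infinity>"
      using nn_integral_exp_sip_marginal[OF m l c(2)] by (simp add: less_top[symmetric] ennreal_prod_eq_top power_eq_top_ennreal)
    finally show "(\<integral>\<^sup>+\<eta>. ennreal (exp (3 * c * occupation S \<eta>)) \<partial>?N) < \<infinity>" .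
  qed (use meas in auto)
  hence "integrable ?N (\<lambda>\<eta>. ?K * exp (3 * c * occupation S \<eta>))" by (rule integrable_mult_right)
  thus ?thesis
  proof (rule Bochner_Integration.integrable_bound[OF _ meas(1)], intro AE_I2)
    fix \<eta>
    have "0 \<le> dual m \<xi> \<eta> * occupation A \<eta> ^ i * exp (c * occupation A \<eta>)"
      using dual_nonneg[OF m, of \<xi> \<eta>] by simp
    thus "norm (dual m \<xi> \<eta> * occupation A \<eta> ^ i * exp (c * occupation A \<eta>)) \<le> norm (?K * exp (3 * c * occupation S \<eta>))"
      using bound[of \<eta>] unfolding real_norm_def by linarith
  qed
qed

end

section \<open>Duality moments of the initial measure\<close>

lemma num_particles_delta [simp]: "num_particles (delta x) = 1"
  and finite_config_delta [simp]: "finite_config (delta x)"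
  by (simp_all add: num_particles_def finite_config_def delta_def)

lemma dual_delta: "dual m (delta y) \<eta> = dual1 m 1 (\<eta> y)"
  by (simp add: dual_def delta_def)

text \<open>Distance at least 1 means distinct sites, so every occupied site carries one particle.
  The result is a product of translates of one local function, as in (AI).\<close>

lemma dual_conf_separated:
  assumes "separated n 1 y"
  shows "dual m (conf n y) \<eta> = (\<Prod>i<n. dual m (delta (y i)) \<eta>)"
proof -
  have inj: "inj_on y {..<n}"
  proof (rule inj_onI, rule ccontr)
    fix i j assume "i \<in> {..<n}" "j \<in> {..<n}" "y i = y j" "i \<noteq> j"
    hence "1 \<le> l1norm (y i - y j)" using assms unfolding separated_def by blast
    thus False using \<open>y i = y j\<close> by (simp add: l1norm_def)
  qed
  have one: "conf n y (y i) = 1" if "i < n" for i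
  proof -
    have "{j. j < n \<and> y j = y i} = {i}" using inj that by (auto simp: inj_on_def)
    thus ?thesis by (simp add: conf_def)
  qed
  have "dual m (conf n y) \<eta> = (\<Prod>z\<in>y ` {..<n}. dual1 m (conf n y z) (\<eta> z))"
    unfolding dual_def conf_support ..
  also have "\<dots> = (\<Prod>i<n. dual1 m (conf n y (y i)) (\<eta> (y i)))" by (simp add: prod.reindex[OF inj])
  also have "\<dots> = (\<Prod>i<n. dual m (delta (y i)) \<eta>)" by (intro prod.cong) (simp_all add: one dual_delta)
  finally show ?thesis .
qed

lemma shift_dual_delta: "shift y (dual m (delta 0)) = dual m (delta y)"
  by (rule ext) (simp add: shift_def dual_delta)

lemma local_function_dual: "finite_config \<xi> \<Longrightarrow> local_function m (dual m \<xi>)"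
  unfolding local_function_def by (intro exI[of _ "{\<xi>}"] exI[of _ "\<lambda>_. 1"]) auto

definition init_moment :: "real \<Rightarrow> 'n::finite config measure \<Rightarrow> 'n config \<Rightarrow> real" where
  "init_moment m \<mu> \<xi> = (\<integral>\<eta>. dual m \<xi> \<eta> \<partial>\<mu>)"

context
  fixes m :: real and \<mu> :: "'n::finite config measure"
  assumes m: "0 < m" and \<mu>: "prob_space \<mu>" "sets \<mu> = sets borel" and temp: "tempered m \<mu>"
begin

lemma init_moment_measurable: "finite_config \<xi> \<Longrightarrow> dual m \<xi> \<in> borel_measurable \<mu>"
  using cylinder_measurable[OF cylinder_dual] measurable_cong_sets[OF \<mu>(2) refl] by blast

lemma
  assumes \<xi>: "finite_config \<xi>"
  shows nn_integral_init_moment: "(\<integral>\<^sup>+\<eta>. ennreal (dual m \<xi> \<eta>) \<partial>\<mu>) = ennreal (init_moment m \<mu> \<xi>)"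
    and init_moment_bounded: "\<bar>init_moment m \<mu> \<xi>\<bar> \<le> enn2real (tempered_const m \<mu> (num_particles \<xi>))"
proof -
  have le: "(\<integral>\<^sup>+\<eta>. ennreal (dual m \<xi> \<eta>) \<partial>\<mu>) \<le> tempered_const m \<mu> (num_particles \<xi>)"
    unfolding tempered_const_def by (rule SUP_upper) (use \<xi> in simp)
  have fin: "tempered_const m \<mu> n < \<infinity>" for n using temp by (simp add: tempered_def)
  have "integrable \<mu> (dual m \<xi>)"
    using \<xi> dual_nonneg[OF m] le_less_trans[OF le fin] by (intro integrableI_nonneg init_moment_measurable) auto
  thus eq: "(\<integral>\<^sup>+\<eta>. ennreal (dual m \<xi> \<eta>) \<partial>\<mu>) = ennreal (init_moment m \<mu> \<xi>)"
    unfolding init_moment_def using dual_nonneg[OF m] by (intro nn_integral_eq_integral) auto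
  have "0 \<le> init_moment m \<mu> \<xi>"
    unfolding init_moment_def by (intro Bochner_Integration.integral_nonneg dual_nonneg m)
  moreover have "init_moment m \<mu> \<xi> \<le> enn2real (tempered_const m \<mu> (num_particles \<xi>))"
    using le fin unfolding eq by (metis ennreal_enn2real enn2real_nonneg ennreal_le_iff infinity_ennreal_def)
  ultimately show "\<bar>init_moment m \<mu> \<xi>\<bar> \<le> enn2real (tempered_const m \<mu> (num_particles \<xi>))" by simp
qed

lemma init_moment_separated:
  assumes "asymp_independent m \<mu>" "0 < \<epsilon>"
  shows "\<exists>R. \<forall>y. separated n R y \<longrightarrow> \<bar>init_moment m \<mu> (conf n y) - (\<Prod>i<n. init_moment m \<mu> (delta (y i)))\<bar> \<le> \<epsilon>"
proof -
  obtain R where R: "\<And>y. \<forall>i<n. \<forall>j<n. i \<noteq> j \<longrightarrow> l1norm (y i - y j) \<ge> R \<Longrightarrow>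
      \<bar>(\<integral>\<eta>. (\<Prod>i<n. shift (y i) (dual m (delta 0)) \<eta>) \<partial>\<mu>) -
        (\<Prod>i<n. \<integral>\<eta>. shift (y i) (dual m (delta 0)) \<eta> \<partial>\<mu>)\<bar> < \<epsilon>"
    using assms(1)[unfolded asymp_independent_def, rule_format, of n "\<lambda>_. dual m (delta 0)" \<epsilon>] assms(2)
      local_function_dual[OF finite_config_delta, of m 0] by blast
  \<comment> \<open>The distance provided by (AI) may be too small to exclude coinciding sites,
    hence the maximum with 1.\<close>
  have "\<bar>init_moment m \<mu> (conf n y) - (\<Prod>i<n. init_moment m \<mu> (delta (y i)))\<bar> \<le> \<epsilon>" if "separated n (max R 1) y" for y
  proof -
    have "separated n R y" "separated n 1 y" using that by (auto simp: separated_def)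
    thus ?thesis
      using R[of y] by (simp add: init_moment_def dual_conf_separated shift_dual_delta separated_def[of n R])
  qed
  thus ?thesis by blast
qed

lemma init_moment_homogeneous:
  assumes "asymp_homogeneous m \<mu> \<rho>" "0 < \<epsilon>"
  shows "\<exists>T>0. \<forall>z. \<bar>heat (m / 2) (\<lambda>z. init_moment m \<mu> (delta z)) T z - \<rho>\<bar> \<le> \<epsilon>"
proof -
  let ?g = "\<lambda>z. init_moment m \<mu> (delta z)"
  have g: "\<bar>?g z\<bar> \<le> enn2real (tempered_const m \<mu> 1)" for z
    using init_moment_bounded[OF finite_config_delta, of z] by simp
  have "\<forall>\<^sub>F t in at_top. (SUP x. ennreal \<bar>measure_pmf.expectation (ctrw (m / 2) t x) ?g - \<rho>\<bar>) < ennreal \<epsilon>"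
    using assms unfolding asymp_homogeneous_def init_moment_def by (intro order_tendstoD(2)) auto
  then obtain T0 where T0: "\<And>t. T0 \<le> t \<Longrightarrow> (SUP x. ennreal \<bar>measure_pmf.expectation (ctrw (m / 2) t x) ?g - \<rho>\<bar>) < ennreal \<epsilon>"
    by (auto simp: eventually_at_top_linorder)
  \<comment> \<open>Positivity of \<open>T\<close> is needed to identify \<open>heat\<close> with
    the walk.\<close>
  define T where "T = max T0 1"
  have T: "0 < T" "T0 \<le> T" by (auto simp: T_def)
  have "\<bar>heat (m / 2) ?g T z - \<rho>\<bar> \<le> \<epsilon>" for z
  proof -
    have "ennreal \<bar>measure_pmf.expectation (ctrw (m / 2) T z) ?g - \<rho>\<bar> < ennreal \<epsilon>"
      by (rule le_less_trans[OF SUP_upper T0[OF T(2)]]) simp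
    hence "\<bar>measure_pmf.expectation (ctrw (m / 2) T z) ?g - \<rho>\<bar> < \<epsilon>"
      using assms(2) by (simp add: ennreal_less_iff)
    thus ?thesis using m T(1) by (simp add: heat_eq_ctrw[of ?g, OF g])
  qed
  thus ?thesis using T(1) by blast
qed

end

section \<open>Convergence of the process\<close>

context sip_process
begin

text \<open>
  The integrand need not be measurable: \<open>P t \<xi>\<close> is carried by a countable set. This matters for
  \<open>\<lambda>\<zeta>. dual m \<zeta> \<eta>\<close>, which is not a cylinder function.
\<close>

lemma nn_integral_P_eq_law':
  fixes f :: "'n config \<Rightarrow> ennreal"
  assumes t: "0 \<le> t" and \<xi>: "finite_config \<xi>"
  shows "(\<integral>\<^sup>+\<zeta>. f \<zeta> \<partial>P t \<xi>) = (\<integral>\<^sup>+\<zeta>. f \<zeta> \<partial>measure_pmf (law t \<xi>))"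
proof -
  let ?E = "{\<zeta> :: 'n config. finite_config \<zeta>}"
  let ?f = "\<lambda>\<zeta>. f \<zeta> * indicator ?E \<zeta>"
  have meas: "?f \<in> borel_measurable borel"
    by (rule measurable_discrete_difference[where f = "\<lambda>_. 0" and X = ?E])
      (auto simp: countable_finite_configs singleton_config_borel)
  have "(\<integral>\<^sup>+\<zeta>. f \<zeta> \<partial>P t \<xi>) = (\<integral>\<^sup>+\<zeta>. ?f \<zeta> \<partial>P t \<xi>)"
    using conservation[OF t \<xi>] by (intro nn_integral_cong_AE) (auto elim!: AE_mp)
  also have "\<dots> = (\<integral>\<^sup>+\<zeta>. ?f \<zeta> \<partial>measure_pmf (law t \<xi>))"
    by (rule nn_integral_P_eq_law[OF t \<xi> meas])
  also have "\<dots> = (\<integral>\<^sup>+\<zeta>. f \<zeta> \<partial>measure_pmf (law t \<xi>))"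
    using set_law[OF t \<xi>] by (intro nn_integral_cong_AE) (auto simp: AE_measure_pmf_iff)
  finally show ?thesis .
qed

end

theorem theorem5p1:
  fixes m \<rho> :: real
    and \<Omega> :: "'n::finite config set"
    and P :: "real \<Rightarrow> 'n config \<Rightarrow> 'n config measure"
    and \<mu> :: "'n config measure"
  assumes "m > 0"
    and "sip_process m \<Omega> P"
    and "self_dual m \<Omega> P"
    and "prob_space \<mu>" and "sets \<mu> = sets borel"
    and "AE \<eta> in \<mu>. \<eta> \<in> \<Omega>"
    and "tempered m \<mu>"
    and "\<rho> > 0" and "asymp_homogeneous m \<mu> \<rho>"
    and "asymp_independent m \<mu>"
  shows "weak_convergence (\<lambda>t. \<mu> \<bind> P t) (sip_product m (\<rho> / (1 + \<rho>))) at_top"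
proof -
  interpret sip_process m \<Omega> P by fact
  let ?l = "\<rho> / (1 + \<rho>)"
  have l: "0 < ?l" "0 \<le> ?l" "?l < 1" "?l / (1 - ?l) = \<rho>"
    using assms(8) by (auto simp: divide_simps)
  note F_props = init_moment_bounded[OF assms(1,4,5,7)] nn_integral_init_moment[OF assms(1,4,5,7)]
  \<comment> \<open>Cut off outside \<open>n\<close>-particle configurations, so that the constant
    of temperedness bounds \<open>F n\<close> everywhere.\<close>
  define F where "F n \<zeta> = (if finite_config \<zeta> \<and> num_particles \<zeta> = n then init_moment m \<mu> \<zeta> else 0)" for n and \<zeta> :: "'n config"
  have F_bd: "\<bar>F n \<zeta>\<bar> \<le> enn2real (tempered_const m \<mu> n)" for n \<zeta>
    using F_props(1) by (auto simp: F_def)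
  have F_nonneg: "0 \<le> F n \<zeta>" for n \<zeta>
    by (auto simp: F_def init_moment_def intro!: Bochner_Integration.integral_nonneg dual_nonneg[OF assms(1)])
  have kern: "P t \<in> \<mu> \<rightarrow>\<^sub>M prob_algebra borel" if "0 \<le> t" for t
    using kernel[OF that] measurable_cong_sets[OF assms(5) refl] by blast
  have \<mu>_alg: "\<mu> \<in> space (prob_algebra borel)" using assms(4,5) by (simp add: space_prob_algebra)
  have bind_props: "prob_space (\<mu> \<bind> P t)" "sets (\<mu> \<bind> P t) = sets borel" if "0 \<le> t" for t
    using prob_space_bind'[OF \<mu>_alg kernel[OF that]] sets_bind'[OF \<mu>_alg kernel[OF that]] .
  have moment: "(\<integral>\<^sup>+\<eta>. ennreal (dual m \<xi> \<eta>) \<partial>(\<mu> \<bind> P t)) =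
      ennreal (measure_pmf.expectation (law t \<xi>) (F (num_particles \<xi>)))"
    if t: "0 \<le> t" and \<xi>: "finite_config \<xi>" for t \<xi>
  proof -
    have meas: "(\<lambda>\<eta>. ennreal (dual m \<zeta> \<eta>)) \<in> borel_measurable \<mu>" if "finite_config \<zeta>" for \<zeta>
      using init_moment_measurable[OF assms(1,4,5,7) that] by measurable
    have set: "finite_config \<zeta> \<and> num_particles \<zeta> = num_particles \<xi>" if "\<zeta> \<in> set_pmf (law t \<xi>)" for \<zeta>
      using set_law[OF t \<xi>] that by auto
    have law_count: "(\<integral>\<^sup>+\<zeta>. h \<zeta> \<partial>law t \<xi>) = (\<integral>\<^sup>+\<zeta>. ennreal (pmf (law t \<xi>) \<zeta>) * h \<zeta> \<partial>count_space (set_pmf (law t \<xi>)))"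
      for h :: "'n config \<Rightarrow> ennreal"
      unfolding nn_integral_measure_pmf by (rule nn_integral_count_space_eq) (auto simp: set_pmf_iff)
    have "(\<integral>\<^sup>+\<eta>. ennreal (dual m \<xi> \<eta>) \<partial>(\<mu> \<bind> P t)) = (\<integral>\<^sup>+\<eta>. \<integral>\<^sup>+\<zeta>. ennreal (dual m \<xi> \<zeta>) \<partial>P t \<eta> \<partial>\<mu>)"
      using cylinder_measurable[OF cylinder_dual[OF \<xi>, of m]]
      by (intro nn_integral_bind[where B = borel] measurable_prob_algebraD kern t) measurable
    \<comment> \<open>Self-duality holds on \<open>\<Omega>\<close>, which carries
      \<open>\<mu>\<close>.\<close>
    also have "\<dots> = (\<integral>\<^sup>+\<eta>. \<integral>\<^sup>+\<zeta>. ennreal (dual m \<zeta> \<eta>) \<partial>P t \<xi> \<partial>\<mu>)"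
      using assms(6) by (intro nn_integral_cong_AE, eventually_elim) (use assms(3) t \<xi> in \<open>auto simp: self_dual_def\<close>)
    also have "\<dots> = (\<integral>\<^sup>+\<eta>. \<integral>\<^sup>+\<zeta>. ennreal (pmf (law t \<xi>) \<zeta>) * ennreal (dual m \<zeta> \<eta>) \<partial>count_space (set_pmf (law t \<xi>)) \<partial>\<mu>)"
      by (simp only: nn_integral_P_eq_law'[OF t \<xi>] law_count)
    \<comment> \<open>Tonelli over the countable support of the dual law, where measurability in
      \<eta> for each fixed \<zeta> suffices.\<close>
    also have "\<dots> = (\<integral>\<^sup>+\<zeta>. \<integral>\<^sup>+\<eta>. ennreal (pmf (law t \<xi>) \<zeta>) * ennreal (dual m \<zeta> \<eta>) \<partial>\<mu> \<partial>count_space (set_pmf (law t \<xi>)))"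
      using set by (intro nn_integral_count_space_nn_integral countable_set_pmf borel_measurable_times_ennreal
          borel_measurable_const meas) auto
    also have "\<dots> = (\<integral>\<^sup>+\<zeta>. ennreal (pmf (law t \<xi>) \<zeta>) * ennreal (F (num_particles \<xi>) \<zeta>) \<partial>count_space (set_pmf (law t \<xi>)))"
      using set by (intro nn_integral_cong) (auto simp: nn_integral_cmult meas F_props(2) F_def)
    also have "\<dots> = (\<integral>\<^sup>+\<zeta>. ennreal (F (num_particles \<xi>) \<zeta>) \<partial>law t \<xi>)" by (rule law_count[symmetric])
    also have "\<dots> = ennreal (measure_pmf.expectation (law t \<xi>) (F (num_particles \<xi>)))"
      by (intro nn_integral_eq_integral integrable_pmf_bounded[OF F_bd]) (simp add: F_nonneg)
    finally show ?thesis .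
  qed
  have law_lim: "((\<lambda>t. measure_pmf.expectation (law t \<xi>) (F (num_particles \<xi>))) \<longlongrightarrow> \<rho> ^ num_particles \<xi>) at_top"
    if \<xi>: "finite_config \<xi>" for \<xi>
  proof -
    obtain x where x: "\<xi> = conf (num_particles \<xi>) x" using conf_surj[OF \<xi>] .
    have "((\<lambda>t. measure_pmf.expectation (law t (conf (num_particles \<xi>) x)) (F (num_particles \<xi>))) \<longlongrightarrow> \<rho> ^ num_particles \<xi>) at_top"
    proof (rule law_expectation_tendsto_power[OF F_bd])
      show "\<bar>init_moment m \<mu> (delta z)\<bar> \<le> enn2real (tempered_const m \<mu> 1)" for z
        using F_props(1)[OF finite_config_delta, of z] by simp
    qed (use init_moment_separated[OF assms(1,4,5,7,10)] init_moment_homogeneous[OF assms(1,4,5,7,9)] in \<open>auto simp: F_def\<close>)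
    thus ?thesis by (simp flip: x)
  qed
  have conv: "conv_integral (\<lambda>t. \<mu> \<bind> P t) (sip_product m ?l) at_top (dual m \<xi>)" if \<xi>: "finite_config \<xi>" for \<xi>
  proof -
    have props: "integrable (\<mu> \<bind> P t) (dual m \<xi>) \<and>
        measure_pmf.expectation (law t \<xi>) (F (num_particles \<xi>)) = (\<integral>\<eta>. dual m \<xi> \<eta> \<partial>(\<mu> \<bind> P t))" if t: "0 \<le> t" for t
    proof -
      have meas: "dual m \<xi> \<in> borel_measurable (\<mu> \<bind> P t)"
        using cylinder_measurable[OF cylinder_dual[OF \<xi>]] measurable_cong_sets[OF bind_props(2)[OF t] refl] by blast
      have "0 \<le> measure_pmf.expectation (law t \<xi>) (F (num_particles \<xi>))" by (simp add: F_nonneg)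
      thus ?thesis
        using meas dual_nonneg[OF assms(1)] moment[OF t \<xi>]
        by (auto intro!: integrableI_nonneg simp: integral_eq_nn_integral)
    qed
    have "\<forall>\<^sub>F t in at_top. measure_pmf.expectation (law t \<xi>) (F (num_particles \<xi>)) = (\<integral>\<eta>. dual m \<xi> \<eta> \<partial>(\<mu> \<bind> P t))"
      using eventually_ge_at_top[of 0] by eventually_elim (simp add: props)
    from Lim_transform_eventually[OF law_lim[OF \<xi>] this]
    have "((\<lambda>t. \<integral>\<eta>. dual m \<xi> \<eta> \<partial>(\<mu> \<bind> P t)) \<longlongrightarrow> (\<integral>\<eta>. dual m \<xi> \<eta> \<partial>sip_product m ?l)) at_top"
      using integral_dual_sip_product[OF assms(1) l(2,3) \<xi>] l(4) by simp
    moreover have "\<forall>\<^sub>F t in at_top. integrable (\<mu> \<bind> P t) (dual m \<xi>)"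
      using eventually_ge_at_top[of 0] by eventually_elim (simp add: props)
    ultimately show ?thesis
      using integrable_dual_sip_product[OF assms(1) l(2,3) \<xi>] by (simp add: conv_integral_def)
  qed
  \<comment> \<open>With this value \<open>?l * exp (3 * c)\<close> is the square root of
    \<open>?l\<close>, hence below 1.\<close>
  define c where "c = - ln ?l / 6"
  have c: "0 < c" "?l * exp (3 * c) < 1"
  proof -
    have ln: "ln ?l < 0" using l by (subst ln_less_zero_iff) auto
    thus "0 < c" by (simp add: c_def)
    have "?l * exp (3 * c) = exp (ln ?l + 3 * c)" using l(1) by (subst exp_add) simp
    also have "\<dots> < 1" using ln by (simp add: c_def)
    finally show "?l * exp (3 * c) < 1" .
  qed
  interpret moment_convergence m "\<lambda>t. \<mu> \<bind> P t" "sip_product m ?l" at_top c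
  proof (rule moment_convergence.intro)
    show "\<forall>\<^sub>F t in at_top. prob_space (\<mu> \<bind> P t) \<and> sets (\<mu> \<bind> P t) = sets borel"
      using eventually_ge_at_top[of 0] by eventually_elim (simp add: bind_props)
    show "0 < m" by fact
    show "0 < c" by (rule c)
    show "prob_space (sip_product m ?l :: 'n config measure)"
      by (rule prob_space_sip_product[OF assms(1) l(2,3)])
    show "sets (sip_product m ?l :: 'n config measure) = sets borel"
      by (rule sets_sip_product[OF assms(1) l(2,3)])
    show "conv_integral (\<lambda>t. \<mu> \<bind> P t) (sip_product m ?l) at_top (dual m \<xi>)" if "finite_config \<xi>" for \<xi>
      by (rule conv[OF that])
    show "integrable (sip_product m ?l) (\<lambda>\<eta>. dual m \<xi> \<eta> * occupation A \<eta> ^ i * exp (c * occupation A \<eta>))"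
      if "finite_config \<xi>" "finite A" for \<xi> A i
      by (rule integrable_exp_moment[OF assms(1) l(2,3) c that])
  qed
  show ?thesis by (rule weak_convergence)
qed

end
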